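(* Let $(W,S)$ be a Coxeter system with $W$ infinite and irreducible, let $\Sigma=(\Sigma_+,\Sigma_-)$ be a twin apartment of type $(W,S)$, and let $X=X_+\cup X_-$ be its twin Tits cone. Let $\Sigma'=(\Sigma'_+,\Sigma'_-)$ be a pair of nonempty subcomplexes ($\Sigma'_\epsilon\subseteq\Sigma_\epsilon$ for $\epsilon=\pm$) such that $\Sigma'_+$ and $\Sigma'_-$ each contain a spherical simplex. Then the following are equivalent: 1. $\Sigma'$ is convex in $\Sigma$, i.e. closed under projections. 2. $\Sigma'$ is an intersection of twin roots of $\Sigma$. 3. The union $X'$ of the cells of $X$ corresponding to the simplices of $\Sigma'$ is convex in $X$, i.e. for any two points $x,y\in X'$ one has $[x,y]\cap X\subseteq X'$, where $[x,y]$ is the straight line segment joining $x$ and $y$ in the ambient real vector space.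
   Context: Twin buildings. Let $(W,S)$ be a Coxeter system ($S$ finite) with length function $l$. A twin building of type $(W,S)$ is a triple $(\mathcal C_+,\mathcal C_-,\delta^* )$, where $(\mathcal C_\pm,\delta_\pm)$ are buildings of type $(W,S)$ (sets of chambers with Weyl distance) and $\delta^*:(\mathcal C_+\times\mathcal C_-)\cup(\mathcal C_-\times\mathcal C_+)\to W$ satisfies, for $C\in\mathcal C_\epsilon$, $D\in\mathcal C_{-\epsilon}$, $w=\delta^*(C,D)$: (i) $\delta^*(D,C)=w^{-1}$; (ii) if $\delta_\epsilon(C',C)=s\in S$ and $l(sw)<l(w)$ then $\delta^*(C',D)=sw$; (iii) for every $s\in S$ there is $C'\in\mathcal C_\epsilon$ with $\delta_\epsilon(C',C)=s$ and $\delta^*(C',D)=sw$. Chambers $C,D$ are opposite if $\delta^*(C,D)=1$; numerical codistance is $d^*(C,D)=l(\delta^*(C,D))$. Simplices correspond to residues (a $J$-residue, $J\subseteq S$, is a simplex of type $S\setminus J$; chambers are the $\emptyset$-residues), and a simplex is spherical if $W_J=\langle J\rangle$ is finite. A twin apartment is a pair $\Sigma=(\Sigma_+,\Sigma_-)$ of apartments $\Sigma_\pm$ of $\mathcal C_\pm$ such that each chamber of $\Sigma_+\cup\Sigma_-$ is opposite exactly one chamber of $\Sigma_+\cup\Sigma_-$; $\mathrm{op}_\Sigma$ denotes the resulting opposition involution on chambers and simplices. A twin root of $\Sigma$ is a pair $\alpha=(\alpha_+,\alpha_-)$ with $\alpha_\epsilon$ a root (closed half-apartment) of $\Sigma_\epsilon$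 and $\alpha_-=\mathrm{op}_\Sigma(-\alpha_+)$, where $-\alpha_+$ is the root of $\Sigma_+$ opposite to $\alpha_+$. Projections. If $A,B$ lie in the same component, $\mathrm{proj}_AB=AB$ is the simplex with $\sigma_H(AB)=\sigma_H(A)$ if $\sigma_H(A)\ne0$ and $\sigma_H(AB)=\sigma_H(B)$ if $\sigma_H(A)=0$, for all walls $H$ of an apartment containing $A$ and $B$, where $\sigma_H(\cdot)\in\{+,-,0\}$ says on which side of $H$ a simplex lies ($0$ if it lies in $H$). If $A$ and $B$ lie in different components and $A$ is spherical, then for a chamber $C$ having $B$ as a face $\mathrm{proj}_AC$ is the unique chamber having $A$ as a face with maximal codistance to $C$, and $\mathrm{proj}_AB=\bigcap_{C\ge B}\mathrm{proj}_AC$. "Closed under projections" means $\mathrm{proj}_AB\in\Sigma'$ for all $A,B\in\Sigma'$ for which it is defined (both within a component and between the two components). Twin Tits cone. $X_+\subseteq V$ is the Tits cone of $(W,S)$: $W$ acts on the real vector space $V$ (the dual of the canonical reflection representation), with fundamental simplicial cone $C$, and $X_+$ is the union of the cells $wF$, $w\in W$, $F$ an (open) face of $C$ (of cotype $J$, $J\subseteq S$); these cells correspond to the simplices of $\Sigma_+$ (the empty simplex corresponds to $\{0\}$). Put $X_-=-X_+$; then $X_+\cap X_-=\{0\}$, and the simplex $\mathrm{op}_\Sigma A$ of $\Sigma_-$, for $A$ a simplex of $\Sigma_+$ with cell $F_A$, corresponds to the cell $-F_A$. The twin Tits cone is $X=X_+\cup X_-$. *)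

theory Defs
  imports "HOL-Analysis.Analysis" "HOL-Algebra.Multiplicative_Group"
begin

section \<open>Coxeter systems\<close>

text \<open>
  The finite set \<open>S\<close> of generators is given by an injective family \<open>gen\<close> indexed by a finite type.
  A \<open>J\<close>-residue, \<open>J \<subseteq> S\<close>, is accordingly given by a subset of the index type.
\<close>

context group
begin

definition word_prod :: "('s \<Rightarrow> 'a) \<Rightarrow> 's list \<Rightarrow> 'a" where
  "word_prod gen ws = foldr (\<lambda>s x. gen s \<otimes> x) ws \<one>"

text \<open>\<open>m(s,t)\<close> is the order of \<open>st\<close>; the value \<open>0\<close> stands for \<open>\<infinity>\<close>.\<close>

definition cox_m :: "('s \<Rightarrow> 'a) \<Rightarrow> 's \<Rightarrow> 's \<Rightarrow> nat" where
  "cox_m gen s t = ord (gen s \<otimes> gen t)"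

text \<open>
  The congruence on words generated by the Coxeter relators \<open>(st)^m(s,t)\<close>, including \<open>ss\<close>.
  A pair with \<open>m(s,t) = 0\<close> contributes the empty relator. Because of the relators \<open>ss\<close>, monoid
  presentation and group presentation agree.
\<close>

inductive cox_equiv :: "('s \<Rightarrow> 'a) \<Rightarrow> 's list \<Rightarrow> 's list \<Rightarrow> bool" for gen where
  refl: "cox_equiv gen u u"
| sym: "cox_equiv gen u v \<Longrightarrow> cox_equiv gen v u"
| trans: "cox_equiv gen u v \<Longrightarrow> cox_equiv gen v w \<Longrightarrow> cox_equiv gen u w"
| relator: "cox_equiv gen (u @ concat (replicate (cox_m gen s t) [s, t]) @ v) (u @ v)"

end

locale coxeter_system = group W for W :: "('w, 'b) monoid_scheme" (structure) +
  fixes gen :: "'s::finite \<Rightarrow> 'w"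
  assumes gen_closed: "gen s \<in> carrier W"
    and gen_inj: "inj gen"
    and gen_nontrivial: "gen s \<noteq> \<one>"
    and gen_involution: "gen s \<otimes> gen s = \<one>"
    and generated: "w \<in> carrier W \<Longrightarrow> \<exists>ws. word_prod gen ws = w"
    and presentation: "word_prod gen u = word_prod gen v \<Longrightarrow> cox_equiv gen u v"
begin

definition len :: "'w \<Rightarrow> nat" where
  "len w = (LEAST n. \<exists>ws. length ws = n \<and> word_prod gen ws = w)"

definition parabolic :: "'s set \<Rightarrow> 'w set" where
  "parabolic J = generate W (gen ` J)"

text \<open>Connectedness of the Coxeter diagram, in which distinct \<open>s\<close>, \<open>t\<close> are joined iff
  \<open>m(s,t) \<noteq> 2\<close>.\<close>

definition irreducible :: bool where
  "irreducible \<longleftrightarrow> (\<forall>J. J \<noteq> {} \<and> J \<noteq> UNIV \<longrightarrow> (\<exists>s\<in>J. \<exists>t\<in>-J. cox_m gen s t \<noteq> 2))"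

subsection \<open>Tits cone\<close>

text \<open>The canonical bilinear form and reflection representation on the space with basis
  \<open>e\<^sub>s = axis s 1\<close>.\<close>

definition cox_form :: "'s \<Rightarrow> 's \<Rightarrow> real" where
  "cox_form s t = (if cox_m gen s t = 0 then -1 else - cos (pi / real (cox_m gen s t)))"

definition refl_gen :: "'s \<Rightarrow> real ^ 's \<Rightarrow> real ^ 's" where
  "refl_gen s v = v - (2 * (\<Sum>t\<in>UNIV. cox_form s t * v $ t)) *\<^sub>R axis s 1"

text \<open>The result does not depend on the chosen word, as the reflections satisfy the Coxeter
  relations.\<close>

definition refl_rep :: "'w \<Rightarrow> real ^ 's \<Rightarrow> real ^ 's" where
  "refl_rep w = foldr refl_gen (SOME ws. word_prod gen ws = w)"

text \<open>The contragredient representation: the dual space is identified with \<open>real ^ 's\<close> by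
  \<open>f \<mapsto> (f(e\<^sub>s))\<^sub>s\<close>, so that evaluation of functionals is the inner product.\<close>

definition dual_rep :: "'w \<Rightarrow> real ^ 's \<Rightarrow> real ^ 's" where
  "dual_rep w = adjoint (refl_rep (inv w))"

text \<open>The open face of cotype \<open>J\<close> of the fundamental cone; its stabilizer is \<open>parabolic J\<close>.\<close>

definition fund_face :: "'s set \<Rightarrow> (real ^ 's) set" where
  "fund_face J = {x. (\<forall>s\<in>J. x $ s = 0) \<and> (\<forall>s\<in>-J. x $ s > 0)}"

definition tits_cone :: "(real ^ 's) set" where
  "tits_cone = (\<Union>w\<in>carrier W. \<Union>J. dual_rep w ` fund_face J)"

definition twin_tits_cone :: "(real ^ 's) set" where
  "twin_tits_cone = tits_cone \<union> uminus ` tits_cone"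

subsection \<open>Buildings\<close>

definition building :: "'c set \<Rightarrow> ('c \<Rightarrow> 'c \<Rightarrow> 'w) \<Rightarrow> bool" where
  "building X d \<longleftrightarrow>
    X \<noteq> {} \<and>
    (\<forall>C\<in>X. \<forall>D\<in>X. d C D \<in> carrier W \<and> (d C D = \<one> \<longleftrightarrow> C = D)) \<and>
    (\<forall>C\<in>X. \<forall>D\<in>X. \<forall>C'\<in>X. \<forall>s. d C' C = gen s \<longrightarrow>
        d C' D \<in> {gen s \<otimes> d C D, d C D} \<and>
        (len (gen s \<otimes> d C D) = len (d C D) + 1 \<longrightarrow> d C' D = gen s \<otimes> d C D)) \<and>
    (\<forall>C\<in>X. \<forall>D\<in>X. \<forall>s. \<exists>C'\<in>X. d C' C = gen s \<and> d C' D = gen s \<otimes> d C D)"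

end

section \<open>Twin buildings\<close>

datatype sign = Pos | Neg

fun flip :: "sign \<Rightarrow> sign" where
  "flip Pos = Neg"
| "flip Neg = Pos"

text \<open>
  \<open>Ch \<epsilon>\<close> and \<open>\<delta> \<epsilon>\<close> are the chambers and the Weyl distance of the component of sign \<open>\<epsilon>\<close>, and
  \<open>cod \<epsilon> C D\<close> is the codistance for \<open>C \<in> Ch \<epsilon>\<close>, \<open>D \<in> Ch (flip \<epsilon>)\<close>. Since all objects carry their
  sign, \<open>Ch Pos\<close> and \<open>Ch Neg\<close> need not be disjoint as sets.
\<close>

locale twin_building = coxeter_system W gen
  for W :: "('w, 'b) monoid_scheme" (structure) and gen :: "'s::finite \<Rightarrow> 'w" +
  fixes Ch :: "sign \<Rightarrow> 'c set"
    and \<delta> :: "sign \<Rightarrow> 'c \<Rightarrow> 'c \<Rightarrow> 'w"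
    and cod :: "sign \<Rightarrow> 'c \<Rightarrow> 'c \<Rightarrow> 'w"
  assumes building: "building (Ch \<epsilon>) (\<delta> \<epsilon>)"
    and cod_closed: "\<lbrakk>C \<in> Ch \<epsilon>; D \<in> Ch (flip \<epsilon>)\<rbrakk> \<Longrightarrow> cod \<epsilon> C D \<in> carrier W"
    and cod_inv: "\<lbrakk>C \<in> Ch \<epsilon>; D \<in> Ch (flip \<epsilon>)\<rbrakk> \<Longrightarrow> cod (flip \<epsilon>) D C = inv (cod \<epsilon> C D)"
    and cod_reduce: "\<lbrakk>C \<in> Ch \<epsilon>; D \<in> Ch (flip \<epsilon>); C' \<in> Ch \<epsilon>; \<delta> \<epsilon> C' C = gen s;
          len (gen s \<otimes> cod \<epsilon> C D) < len (cod \<epsilon> C D)\<rbrakk>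
        \<Longrightarrow> cod \<epsilon> C' D = gen s \<otimes> cod \<epsilon> C D"
    and cod_exists: "\<lbrakk>C \<in> Ch \<epsilon>; D \<in> Ch (flip \<epsilon>)\<rbrakk>
        \<Longrightarrow> \<exists>C'\<in>Ch \<epsilon>. \<delta> \<epsilon> C' C = gen s \<and> cod \<epsilon> C' D = gen s \<otimes> cod \<epsilon> C D"
begin

definition opposite :: "sign \<Rightarrow> 'c \<Rightarrow> 'c \<Rightarrow> bool" where
  "opposite \<epsilon> C D \<longleftrightarrow> cod \<epsilon> C D = \<one>"

text \<open>
  Simplices are residues, i.e. sets of chambers of the building; \<open>B\<close> is a face of \<open>A\<close> iff
  \<open>A \<subseteq> B\<close>, and a chamber \<open>C\<close> has \<open>A\<close> as a face iff \<open>C \<in> A\<close>. The residue of type \<open>UNIV\<close> is the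
  empty simplex.
\<close>

definition residue :: "sign \<Rightarrow> 's set \<Rightarrow> 'c \<Rightarrow> 'c set" where
  "residue \<epsilon> J C = {D \<in> Ch \<epsilon>. \<delta> \<epsilon> C D \<in> parabolic J}"

text \<open>The subcomplex consisting of all faces of a given set of chambers.\<close>

definition simplices :: "sign \<Rightarrow> 'c set \<Rightarrow> 'c set set" where
  "simplices \<epsilon> X = {residue \<epsilon> J C | J C. C \<in> X}"

definition spherical :: "sign \<Rightarrow> 'c set \<Rightarrow> bool" where
  "spherical \<epsilon> A \<longleftrightarrow> (\<exists>J. \<exists>C\<in>Ch \<epsilon>. A = residue \<epsilon> J C \<and> finite (parabolic J))"

text \<open>Apartments are the isometric images of \<open>W\<close> with its Weyl distance \<open>(u, v) \<mapsto> u\<^sup>-\<^sup>1v\<close>.\<close>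

definition apartment :: "sign \<Rightarrow> 'c set \<Rightarrow> bool" where
  "apartment \<epsilon> Y \<longleftrightarrow> Y \<subseteq> Ch \<epsilon> \<and>
    (\<exists>\<phi>. Y = \<phi> ` carrier W \<and>
      (\<forall>u\<in>carrier W. \<forall>v\<in>carrier W. \<delta> \<epsilon> (\<phi> u) (\<phi> v) = inv u \<otimes> v))"

text \<open>
  Roots (closed half-apartments) of an apartment \<open>Y\<close> are represented by their chambers; as
  subcomplexes they are \<open>simplices \<epsilon> \<alpha>\<close>. The opposite root of \<open>\<alpha>\<close> is \<open>Y - \<alpha>\<close>, and the wall
  bounding \<open>\<alpha>\<close> is \<open>simplices \<epsilon> \<alpha> \<inter> simplices \<epsilon> (Y - \<alpha>)\<close>.
\<close>

definition root :: "sign \<Rightarrow> 'c set \<Rightarrow> 'c set \<Rightarrow> bool" where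
  "root \<epsilon> Y \<alpha> \<longleftrightarrow> (\<exists>C\<in>Y. \<exists>C'\<in>Y. (\<exists>s. \<delta> \<epsilon> C C' = gen s) \<and>
    \<alpha> = {D \<in> Y. len (\<delta> \<epsilon> D C) < len (\<delta> \<epsilon> D C')})"

text \<open>The sign \<open>\<sigma>\<^sub>H(A)\<close> for the wall \<open>H\<close> bounding \<open>\<alpha>\<close>, with \<open>\<alpha>\<close> as positive side.\<close>

definition side :: "sign \<Rightarrow> 'c set \<Rightarrow> 'c set \<Rightarrow> 'c set \<Rightarrow> int" where
  "side \<epsilon> Y \<alpha> A =
    (if A \<in> simplices \<epsilon> \<alpha> \<inter> simplices \<epsilon> (Y - \<alpha>) then 0
     else if A \<in> simplices \<epsilon> \<alpha> then 1 else -1)"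

subsection \<open>Projections\<close>

text \<open>Projection within a component. The simplex does not depend on the apartment.\<close>

definition proj :: "sign \<Rightarrow> 'c set \<Rightarrow> 'c set \<Rightarrow> 'c set" where
  "proj \<epsilon> A B = (THE P. \<exists>Y. apartment \<epsilon> Y \<and>
     A \<in> simplices \<epsilon> Y \<and> B \<in> simplices \<epsilon> Y \<and> P \<in> simplices \<epsilon> Y \<and>
     (\<forall>\<alpha>. root \<epsilon> Y \<alpha> \<longrightarrow>
        side \<epsilon> Y \<alpha> P = (if side \<epsilon> Y \<alpha> A \<noteq> 0 then side \<epsilon> Y \<alpha> A else side \<epsilon> Y \<alpha> B)))"

text \<open>Projection between components, for spherical \<open>A\<close> in the component \<open>\<epsilon>\<close> and a chamber \<open>C\<close>,
  respectively a simplex \<open>B\<close>, in the component \<open>flip \<epsilon>\<close>.\<close>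

definition coproj_chamber :: "sign \<Rightarrow> 'c set \<Rightarrow> 'c \<Rightarrow> 'c" where
  "coproj_chamber \<epsilon> A C =
    (THE G. G \<in> A \<and> (\<forall>D\<in>A. len (cod \<epsilon> D C) \<le> len (cod \<epsilon> G C)))"

text \<open>The intersection of a set of chambers, viewed as simplices, is their largest common face, which
  is the smallest residue containing them.\<close>

definition coproj :: "sign \<Rightarrow> 'c set \<Rightarrow> 'c set \<Rightarrow> 'c set" where
  "coproj \<epsilon> A B = (THE P. P \<in> simplices \<epsilon> (Ch \<epsilon>) \<and> coproj_chamber \<epsilon> A ` B \<subseteq> P \<and>
     (\<forall>Q\<in>simplices \<epsilon> (Ch \<epsilon>). coproj_chamber \<epsilon> A ` B \<subseteq> Q \<longrightarrow> P \<subseteq> Q))"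

definition projection_closed :: "(sign \<Rightarrow> 'c set set) \<Rightarrow> bool" where
  "projection_closed K \<longleftrightarrow>
    (\<forall>\<epsilon>. \<forall>A\<in>K \<epsilon>. \<forall>B\<in>K \<epsilon>. proj \<epsilon> A B \<in> K \<epsilon>) \<and>
    (\<forall>\<epsilon>. \<forall>A\<in>K \<epsilon>. \<forall>B\<in>K (flip \<epsilon>). spherical \<epsilon> A \<longrightarrow> coproj \<epsilon> A B \<in> K \<epsilon>)"

end

section \<open>Twin apartments\<close>

locale twin_apartment = twin_building W gen Ch \<delta> cod
  for W :: "('w, 'b) monoid_scheme" (structure) and gen :: "'s::finite \<Rightarrow> 'w"
    and Ch :: "sign \<Rightarrow> 'c set"
    and \<delta> :: "sign \<Rightarrow> 'c \<Rightarrow> 'c \<Rightarrow> 'w"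
    and cod :: "sign \<Rightarrow> 'c \<Rightarrow> 'c \<Rightarrow> 'w" +
  fixes Apt :: "sign \<Rightarrow> 'c set"
  assumes apartments: "apartment \<epsilon> (Apt \<epsilon>)"
    and opposite_unique: "C \<in> Apt \<epsilon> \<Longrightarrow> \<exists>!D. D \<in> Apt (flip \<epsilon>) \<and> opposite \<epsilon> C D"
begin

definition op :: "sign \<Rightarrow> 'c \<Rightarrow> 'c" where
  "op \<epsilon> C = (THE D. D \<in> Apt (flip \<epsilon>) \<and> opposite \<epsilon> C D)"

definition op_simplex :: "sign \<Rightarrow> 'c set \<Rightarrow> 'c set" where
  "op_simplex \<epsilon> A = (THE B. B \<in> simplices (flip \<epsilon>) (Apt (flip \<epsilon>)) \<and>
     B \<inter> Apt (flip \<epsilon>) = op \<epsilon> ` (A \<inter> Apt \<epsilon>))"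

definition twin_root :: "(sign \<Rightarrow> 'c set) \<Rightarrow> bool" where
  "twin_root \<alpha> \<longleftrightarrow> (\<forall>\<epsilon>. root \<epsilon> (Apt \<epsilon>) (\<alpha> \<epsilon>)) \<and> \<alpha> Neg = op Pos ` (Apt Pos - \<alpha> Pos)"

definition subcomplex :: "sign \<Rightarrow> 'c set set \<Rightarrow> bool" where
  "subcomplex \<epsilon> K \<longleftrightarrow> K \<subseteq> simplices \<epsilon> (Apt \<epsilon>) \<and>
    (\<forall>A\<in>K. \<forall>B\<in>simplices \<epsilon> (Apt \<epsilon>). A \<subseteq> B \<longrightarrow> B \<in> K)"

text \<open>The intersection of the empty family is the twin apartment itself.\<close>

definition intersection_of_twin_roots :: "(sign \<Rightarrow> 'c set set) \<Rightarrow> bool" where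
  "intersection_of_twin_roots K \<longleftrightarrow> (\<exists>R. (\<forall>\<alpha>\<in>R. twin_root \<alpha>) \<and>
    (\<forall>\<epsilon>. K \<epsilon> = simplices \<epsilon> (Apt \<epsilon>) \<inter> (\<Inter>\<alpha>\<in>R. simplices \<epsilon> (\<alpha> \<epsilon>))))"

text \<open>
  The cells of the simplices, for the identification of the positive apartment with \<open>W\<close> that maps
  \<open>C\<close> to \<open>\<delta> Pos C\<^sub>0 C\<close>. In \<open>cell_pos\<close> all sets of the union coincide.
\<close>

definition cell_pos :: "'c \<Rightarrow> 'c set \<Rightarrow> (real ^ 's) set" where
  "cell_pos C\<^sub>0 A =
    \<Union>{dual_rep (\<delta> Pos C\<^sub>0 C) ` fund_face J | J C. C \<in> Apt Pos \<and> A = residue Pos J C}"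

fun cell :: "'c \<Rightarrow> sign \<Rightarrow> 'c set \<Rightarrow> (real ^ 's) set" where
  "cell C\<^sub>0 Pos A = cell_pos C\<^sub>0 A"
| "cell C\<^sub>0 Neg A = uminus ` cell_pos C\<^sub>0 (op_simplex Neg A)"

definition realization :: "'c \<Rightarrow> (sign \<Rightarrow> 'c set set) \<Rightarrow> (real ^ 's) set" where
  "realization C\<^sub>0 K = (\<Union>\<epsilon>. \<Union>A\<in>K \<epsilon>. cell C\<^sub>0 \<epsilon> A)"

definition convex_in_cone :: "(real ^ 's) set \<Rightarrow> bool" where
  "convex_in_cone X' \<longleftrightarrow>
    (\<forall>x\<in>X'. \<forall>y\<in>X'. closed_segment x y \<inter> twin_tits_cone \<subseteq> X')"

end

end

theory Submission
  imports Defs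
begin

text \<open>
  Fix a chamber of the positive apartment and label the chambers of both apartments by \<open>W\<close>, so
  that opposite chambers get the same label (\<open>ex_coordinates\<close>). A simplex of the positive
  apartment is then a cell \<open>wF\<close> of the Tits cone, and a simplex of the negative apartment is the
  negative of such a cell. Everything in the theorem depends only on the signs that the roots of
  the geometric representation take on cells. A half-apartment consists of the cells on which
  some root is nonnegative (\<open>root_iff_half\<close>, \<open>simplex_at_in_half\<close>), because multiplication by
  \<open>s\<close> lengthens \<open>w\<close> iff \<open>w\<close> maps the simple root \<open>e\<^sub>s\<close> to a nonnegative vector
  (\<open>len_less_mult_gen_iff\<close>); and the negative part of a twin root is given by the same
  inequality on the negative cells. Both kinds of projection are one operation on sign vectors:
  the zeros in the sign vector of the first cell are replaced by the signs of the second one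
  (\<open>proj_simplex_at\<close>, \<open>coproj_simplex_at\<close>). So the theorem is about a subset of the twin Tits
  cone (\<open>convexity_equivalence\<close>).

  A set cut out by inequalities \<open>0 \<le> \<beta> \<bullet> x\<close> is convex. A convex set is closed under composition
  of sign vectors, because a point of the segment from \<open>x\<close> to \<open>y\<close> that is close to \<open>x\<close> has the
  composed sign vector. Such a point lies in the Tits cone, either because the cone is convex,
  or, for \<open>y\<close> in the opposite half, because \<open>x\<close> is spherical and therefore an interior point. As
  \<open>W\<close> is infinite and irreducible, the two halves meet only in \<open>0\<close> (\<open>tits_cone_inter_uminus\<close>),
  so the point belongs to the correct half of the given set.

  Conversely, let the set be closed under composition and let \<open>x\<close> satisfy all inequalities that
  hold on the set. Then \<open>x\<close> lies in all walls that contain the set, and moving \<open>x\<close> slightly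
  towards a cell of maximal dimension one can assume that it lies in no other wall. Among the
  cells of maximal dimension in the set take one that is separated from \<open>x\<close> by as few walls as
  possible. If it is not the cell of \<open>x\<close> then one of its facets lies on a wall that separates it
  from \<open>x\<close>. The inequality of this wall fails somewhere on the set, and composing the facet with
  a point where it fails yields a cell of the set that is nearer to \<open>x\<close>, a contradiction
  (\<open>comp_closed_imp_cut_out\<close>).
\<close>

section \<open>Words and lengths\<close>

context coxeter_system
begin

lemma word_prod_Nil [simp]: "word_prod gen [] = \<one>"
  and word_prod_Cons [simp]: "word_prod gen (s # ws) = gen s \<otimes> word_prod gen ws"
  by (simp_all add: word_prod_def)

lemma gen_in_carrier [simp]: "gen s \<in> carrier W"
  by (rule gen_closed)

lemma gen_gen [simp]: "gen s \<otimes> gen s = \<one>"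
  by (rule gen_involution)

lemma word_prod_closed [simp]: "word_prod gen ws \<in> carrier W"
  by (induction ws) auto

lemma word_prod_append: "word_prod gen (us @ vs) = word_prod gen us \<otimes> word_prod gen vs"
  by (induction us) (auto simp: m_assoc)

lemma inv_gen [simp]: "inv (gen s) = gen s"
  by (rule inv_equality) auto

lemma gen_cancel [simp]: "w \<in> carrier W \<Longrightarrow> gen s \<otimes> (gen s \<otimes> w) = w"
  by (simp flip: m_assoc)

lemma gen_cancel_right [simp]: "w \<in> carrier W \<Longrightarrow> w \<otimes> gen s \<otimes> gen s = w"
  by (simp add: m_assoc)

lemma inv_mult_cancel [simp]:
  assumes "u \<in> carrier W" "x \<in> carrier W"
  shows "inv u \<otimes> (u \<otimes> x) = x" "u \<otimes> (inv u \<otimes> x) = x"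
  using assms by (simp_all flip: m_assoc)

lemma word_prod_rev: "word_prod gen (rev ws) = inv (word_prod gen ws)"
  by (induction ws) (auto simp: word_prod_append inv_mult_group)

lemma len_le_length: "len (word_prod gen ws) \<le> length ws"
  unfolding len_def by (rule Least_le) auto

lemma reduced_word:
  assumes "w \<in> carrier W"
  obtains ws where "word_prod gen ws = w" "length ws = len w"
proof -
  have "\<exists>n ws. length ws = n \<and> word_prod gen ws = w"
    using generated[OF assms] by auto
  then have "\<exists>ws. length ws = len w \<and> word_prod gen ws = w"
    unfolding len_def by (rule LeastI_ex)
  then show ?thesis using that by auto
qed

lemma len_one [simp]: "len \<one> = 0"
  using len_le_length[of "[]"] by simp

lemma len_eq_0_iff: "w \<in> carrier W \<Longrightarrow> len w = 0 \<longleftrightarrow> w = \<one>"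
  by (metis len_one length_0_conv reduced_word word_prod_Nil)

lemma len_mult_le:
  assumes "u \<in> carrier W" "v \<in> carrier W"
  shows "len (u \<otimes> v) \<le> len u + len v"
proof -
  obtain us where "word_prod gen us = u" "length us = len u"
    using reduced_word[OF assms(1)] .
  moreover obtain vs where "word_prod gen vs = v" "length vs = len v"
    using reduced_word[OF assms(2)] .
  ultimately show ?thesis
    using len_le_length[of "us @ vs"] by (simp add: word_prod_append)
qed

lemma len_inv [simp]:
  assumes "w \<in> carrier W"
  shows "len (inv w) = len w"
proof -
  have le: "len (inv v) \<le> len v" if "v \<in> carrier W" for v
  proof -
    obtain ws where "word_prod gen ws = v" "length ws = len v"
      using reduced_word[OF \<open>v \<in> carrier W\<close>] .
    then show ?thesis
      using len_le_length[of "rev ws"] by (simp add: word_prod_rev)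
  qed
  show ?thesis
    using le[OF assms] le[of "inv w"] assms by simp
qed

lemma len_gen_le: "len (gen s) \<le> 1"
  using len_le_length[of "[s]"] by simp

lemma len_mult_gen_le: "w \<in> carrier W \<Longrightarrow> len (w \<otimes> gen s) \<le> Suc (len w)"
  using len_mult_le[of w "gen s"] len_gen_le[of s] by simp

lemma len_le_mult_gen: "w \<in> carrier W \<Longrightarrow> len w \<le> Suc (len (w \<otimes> gen s))"
  using len_mult_gen_le[of "w \<otimes> gen s" s] by simp

text \<open>All relators have even length, so the parity of the length of a word depends only on its
  product. Hence multiplication by a generator always changes the length.\<close>

lemma cox_equiv_parity: "cox_equiv gen u v \<Longrightarrow> even (length u) \<longleftrightarrow> even (length v)"
  by (induction rule: cox_equiv.induct) (auto simp: length_concat sum_list_replicate)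

lemma len_mult_gen_neq:
  assumes "w \<in> carrier W"
  shows "len (w \<otimes> gen s) \<noteq> len w"
proof -
  obtain us where us: "word_prod gen us = w" "length us = len w"
    using reduced_word[OF assms] .
  have "w \<otimes> gen s \<in> carrier W" using assms by simp
  then obtain vs where vs: "word_prod gen vs = w \<otimes> gen s" "length vs = len (w \<otimes> gen s)"
    using reduced_word by blast
  have "word_prod gen (us @ [s]) = word_prod gen vs"
    using us vs by (simp add: word_prod_append)
  from cox_equiv_parity[OF presentation[OF this]] show ?thesis
    using us(2) vs(2) by auto
qed

lemma len_mult_gen_cases:
  assumes "w \<in> carrier W"
  shows "len (w \<otimes> gen s) = Suc (len w) \<or> len w = Suc (len (w \<otimes> gen s))"
  using len_mult_gen_neq[OF assms, of s] len_mult_gen_le[OF assms, of s] len_le_mult_gen[OF assms, of s]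
  by linarith

lemma len_gen_mult_inv: "w \<in> carrier W \<Longrightarrow> len (gen s \<otimes> w) = len (inv w \<otimes> gen s)"
  using len_inv[of "gen s \<otimes> w"] by (simp add: inv_mult_group)

lemma len_gen_mult_cases:
  assumes "w \<in> carrier W"
  shows "len (gen s \<otimes> w) = Suc (len w) \<or> len w = Suc (len (gen s \<otimes> w))"
  using len_mult_gen_cases[of "inv w" s] assms by (simp add: len_gen_mult_inv)

section \<open>The geometric representation\<close>

lemma cox_m_sym: "cox_m gen s t = cox_m gen t s"
proof -
  have "inv (gen s \<otimes> gen t) = gen t \<otimes> gen s" by (simp add: inv_mult_group)
  then show ?thesis unfolding cox_m_def
    by (metis gen_in_carrier m_closed ord_inv)
qed

lemma cox_m_self [simp]: "cox_m gen s s = 1"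
  by (simp add: cox_m_def ord_eq_1)

lemma cox_m_ge_2:
  assumes "s \<noteq> t" "cox_m gen s t \<noteq> 0"
  shows "2 \<le> cox_m gen s t"
proof -
  have "gen s \<otimes> gen t \<noteq> \<one>"
  proof
    assume "gen s \<otimes> gen t = \<one>"
    then have "gen s = gen t" using inv_equality[of "gen s" "gen t"] by simp
    then show False using assms(1) gen_inj by (auto dest: injD)
  qed
  then have "cox_m gen s t \<noteq> 1"
    using ord_eq_1[of "gen s \<otimes> gen t"] by (simp add: cox_m_def)
  then show ?thesis using assms by linarith
qed

lemma cox_form_sym: "cox_form s t = cox_form t s"
  by (simp add: cox_form_def cox_m_sym)

lemma cox_form_self [simp]: "cox_form s s = 1"
  by (simp add: cox_form_def)

definition pairing :: "'s \<Rightarrow> real ^ 's \<Rightarrow> real" where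
  "pairing s v = (\<Sum>t\<in>UNIV. cox_form s t * v $ t)"

definition bil :: "real ^ 's \<Rightarrow> real ^ 's \<Rightarrow> real" where
  "bil u v = (\<Sum>s\<in>UNIV. u $ s * pairing s v)"

abbreviation simple :: "'s \<Rightarrow> real ^ 's" where
  "simple s \<equiv> axis s 1"

lemma refl_gen_eq: "refl_gen s v = v - (2 * pairing s v) *\<^sub>R simple s"
  by (simp add: refl_gen_def pairing_def)

lemma pairing_add: "pairing s (u + v) = pairing s u + pairing s v"
  and pairing_diff: "pairing s (u - v) = pairing s u - pairing s v"
  and pairing_scale: "pairing s (c *\<^sub>R v) = c * pairing s v"
  by (simp_all add: pairing_def algebra_simps sum.distrib sum_subtractf sum_distrib_left)

lemma pairing_simple: "pairing s (simple t) = cox_form s t"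
  by (simp add: pairing_def axis_def if_distrib[of "\<lambda>x. _ * x"] cong: if_cong)

lemma bil_add_left: "bil (u + v) z = bil u z + bil v z"
  and bil_diff_left: "bil (u - v) z = bil u z - bil v z"
  and bil_scale_left: "bil (c *\<^sub>R u) z = c * bil u z"
  and bil_add_right: "bil z (u + v) = bil z u + bil z v"
  and bil_diff_right: "bil z (u - v) = bil z u - bil z v"
  and bil_scale_right: "bil z (c *\<^sub>R u) = c * bil z u"
  by (simp_all add: bil_def pairing_add pairing_diff pairing_scale algebra_simps
      sum.distrib sum_subtractf sum_distrib_left)

lemma bil_simple_left: "bil (simple s) v = pairing s v"
  by (simp add: bil_def axis_def if_distrib[of "\<lambda>x. x * _"] cong: if_cong)

lemma bil_sym: "bil u v = bil v u"
proof -
  have "bil u v = (\<Sum>s\<in>UNIV. \<Sum>t\<in>UNIV. u $ s * (cox_form s t * v $ t))"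
    by (simp add: bil_def pairing_def sum_distrib_left)
  also have "\<dots> = (\<Sum>t\<in>UNIV. \<Sum>s\<in>UNIV. u $ s * (cox_form s t * v $ t))"
    by (rule sum.swap)
  also have "\<dots> = (\<Sum>t\<in>UNIV. \<Sum>s\<in>UNIV. v $ t * (cox_form t s * u $ s))"
    by (rule sum.cong[OF HOL.refl])+ (metis cox_form_sym mult.commute mult.left_commute)
  also have "\<dots> = bil v u"
    by (simp add: bil_def pairing_def sum_distrib_left)
  finally show ?thesis .
qed

lemma bil_simple_right: "bil v (simple s) = pairing s v"
  by (simp add: bil_sym[of v] bil_simple_left)

lemmas bil_simps = bil_add_left bil_diff_left bil_scale_left bil_add_right bil_diff_right
  bil_scale_right bil_simple_left bil_simple_right pairing_add pairing_diff pairing_scale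
  pairing_simple

lemma refl_gen_bil [simp]: "bil (refl_gen s u) (refl_gen s v) = bil u v"
  by (simp add: refl_gen_eq bil_simps algebra_simps)

lemma refl_gen_refl_gen [simp]: "refl_gen s (refl_gen s v) = v"
  by (simp add: refl_gen_eq bil_simps algebra_simps)

lemma refl_gen_add: "refl_gen s (u + v) = refl_gen s u + refl_gen s v"
  by (simp add: refl_gen_eq bil_simps algebra_simps)

lemma refl_gen_scale: "refl_gen s (c *\<^sub>R u) = c *\<^sub>R refl_gen s u"
  by (simp add: refl_gen_eq bil_simps algebra_simps)

lemma linear_refl_gen: "linear (refl_gen s)"
  by (rule linearI) (simp_all add: refl_gen_add refl_gen_scale)

lemma linear_foldr_refl_gen: "linear (foldr refl_gen ws)"
proof (induction ws)
  case Nil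
  show ?case by (simp add: linear_id id_def linear_ident)
next
  case (Cons s ws)
  then show ?case
    using linear_compose[OF Cons linear_refl_gen[of s]] by (simp add: comp_def)
qed

subsection \<open>Dihedral words\<close>

text \<open>The matrix coefficients of the alternating products of two reflections are the Chebyshev
  polynomials of the second kind in \<open>a = - B(e\<^sub>s, e\<^sub>t)\<close>, shifted by one so that
  \<open>cheb (cos \<theta>) n = sin (n \<theta>) / sin \<theta>\<close>.\<close>

fun cheb :: "real \<Rightarrow> nat \<Rightarrow> real" where
  "cheb a 0 = 0"
| "cheb a (Suc 0) = 1"
| "cheb a (Suc (Suc n)) = 2 * a * cheb a (Suc n) - cheb a n"

lemma cheb_sin: "sin \<theta> * cheb (cos \<theta>) n = sin (real n * \<theta>)"
proof (induction "cos \<theta>" n rule: cheb.induct)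
  case (3 n)
  have "sin (real (Suc (Suc n)) * \<theta>) = sin (real (Suc n) * \<theta> + \<theta>)"
    and "sin (real n * \<theta>) = sin (real (Suc n) * \<theta> - \<theta>)"
    by (simp_all add: algebra_simps)
  then have "sin (real (Suc (Suc n)) * \<theta>) = 2 * cos \<theta> * sin (real (Suc n) * \<theta>) - sin (real n * \<theta>)"
    by (simp only: sin_add sin_diff) simp
  with 3 show ?case by (simp only: cheb.simps right_diff_distrib) (simp add: algebra_simps)
qed auto

lemma cheb_one: "cheb 1 n = real n"
  by (induction "1::real" n rule: cheb.induct) auto

text \<open>The last letter is \<open>s\<close>, as the last letter of a word acts first.\<close>

fun alt :: "nat \<Rightarrow> 's \<Rightarrow> 's \<Rightarrow> 's list" where
  "alt 0 s t = []"
| "alt (Suc k) s t = (if even k then s else t) # alt k s t"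

lemma length_alt [simp]: "length (alt k s t) = k"
  by (induction k) auto

lemma alt_Suc_snoc: "alt (Suc k) s t = alt k t s @ [s]"
  by (induction k) auto

lemma alt_split: "m \<le> k \<Longrightarrow> \<exists>us. alt k s t = us @ alt m s t \<and> length us = k - m"
proof (induction k)
  case (Suc k)
  then show ?case
  proof (cases "m = Suc k")
    case False
    with Suc obtain us where "alt k s t = us @ alt m s t" "length us = k - m" by auto
    then show ?thesis
      using Suc.prems False by (intro exI[of _ "(if even k then s else t) # us"]) auto
  qed simp
qed simp

lemma set_alt: "set (alt k s t) \<subseteq> {s, t}"
  by (induction k) auto

lemma concat_replicate_eq_alt: "concat (replicate m [s, t]) = alt (2 * m) t s"
  by (induction m) auto

lemma eq_alt:
  assumes "set us \<subseteq> {s, t}" "\<And>xs y ys. us \<noteq> xs @ [y, y] @ ys" "us \<noteq> [] \<Longrightarrow> last us = t"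
  shows "us = alt (length us) t s"
  using assms
proof (induction us)
  case (Cons a us)
  show ?case
  proof (cases us)
    case Nil
    then show ?thesis using Cons.prems by auto
  next
    case (Cons b vs)
    have "us = alt (length us) t s"
    proof (rule Cons.IH)
      show "us \<noteq> xs @ [y, y] @ ys" for xs y ys
        using Cons.prems(2)[of "a # xs" y ys] by auto
    qed (use Cons.prems(1,3) in auto)
    then have eq: "alt (length us) t s = us" by (rule HOL.sym)
    have "a \<noteq> b" using Cons.prems(2)[of "[]" a vs] local.Cons by auto
    moreover have "alt (length us) t s = b # vs" using eq local.Cons by (rule HOL.trans)
    then have "b = (if even (length vs) then t else s)"
      using local.Cons by simp
    ultimately have "a = (if even (length us) then t else s)"
      using Cons.prems(1) local.Cons by auto
    then show ?thesis by (simp add: eq)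
  qed
qed auto

lemma word_prod_concat_replicate:
  "word_prod gen (concat (replicate k [s, t])) = (gen s \<otimes> gen t) [^] k"
proof (induction k)
  case (Suc k)
  then show ?case using nat_pow_Suc2[of "gen s \<otimes> gen t" k] by (simp add: m_assoc)
qed simp

lemma concat_replicate_shift:
  "s # concat (replicate k [t, s]) @ [t] = concat (replicate (Suc k) [s, t])"
  by (induction k) auto

text \<open>This turns the relation \<open>(st)\<^sup>m = 1\<close> into the equality of the two alternating words of
  length \<open>m\<close>.\<close>

lemma alt_rev_alt:
  "alt k s t @ rev (alt k t s) = concat (replicate k (if odd k then [s, t] else [t, s]))"
proof (induction k)
  case (Suc k)
  then have "alt (Suc k) s t @ rev (alt (Suc k) t s)
    = (if even k then s else t) # concat (replicate k (if odd k then [s, t] else [t, s])) @ [if even k then t else s]"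
    by (simp flip: append_assoc)
  then show ?case
    by (simp only: if_distrib concat_replicate_shift split: if_split) (simp add: concat_replicate_shift)
qed auto

lemma braid_relation:
  "word_prod gen (alt (cox_m gen s t) s t) = word_prod gen (alt (cox_m gen s t) t s)"
proof -
  let ?m = "cox_m gen s t"
  have "(gen s \<otimes> gen t) [^] ?m = \<one>" "(gen t \<otimes> gen s) [^] ?m = \<one>"
    by (simp add: cox_m_def) (subst cox_m_sym, simp add: cox_m_def)
  then have "word_prod gen (alt ?m s t @ rev (alt ?m t s)) = \<one>"
    by (simp add: alt_rev_alt word_prod_concat_replicate)
  then have "word_prod gen (alt ?m s t) \<otimes> inv (word_prod gen (alt ?m t s)) = \<one>"
    by (simp add: word_prod_append word_prod_rev)
  then show ?thesis
    by (metis inv_closed inv_inv inv_equality word_prod_closed)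
qed

lemma foldr_refl_gen_alt:
  assumes "a = - cox_form s t"
  shows "foldr refl_gen (alt k t s) (simple s) =
    (if even k then cheb a (Suc k) *\<^sub>R simple s + cheb a k *\<^sub>R simple t
     else cheb a k *\<^sub>R simple s + cheb a (Suc k) *\<^sub>R simple t)"
proof (induction k)
  case (Suc k)
  have "cox_form t s = - a" "cox_form s t = - a"
    using assms by (simp_all add: cox_form_sym)
  with Suc show ?case
    by (simp only: alt.simps foldr_Cons comp_apply Suc)
      (auto simp: vec_eq_iff refl_gen_eq bil_simps algebra_simps)
qed auto

lemma sin_pi_div_pos: "2 \<le> m \<Longrightarrow> 0 < sin (pi / real m)"
  by (rule sin_gt_zero) (auto simp: field_simps)

text \<open>The value \<open>- cos (\<pi> / m)\<close> of the form makes the two reflections generate a dihedral group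
  of order \<open>2m\<close> on the plane spanned by \<open>e\<^sub>s\<close> and \<open>e\<^sub>t\<close>, on which the form is positive definite;
  its orthogonal complement is fixed.\<close>

lemma refl_gen_relation:
  assumes "s \<noteq> t"
  shows "foldr refl_gen (concat (replicate (cox_m gen s t) [s, t])) v = v"
proof (cases "cox_m gen s t = 0")
  case False
  define m where "m = cox_m gen s t"
  define \<theta> where "\<theta> = pi / real m"
  define a where "a = cos \<theta>"
  let ?f = "foldr refl_gen (alt (2 * m) t s)"
  have m2: "2 \<le> m" using cox_m_ge_2[OF assms] False m_def by simp
  have ast: "a = - cox_form s t" and ats: "a = - cox_form t s"
    using False by (simp_all add: a_def \<theta>_def m_def cox_form_def cox_m_sym[of t s])
  have sin0: "sin \<theta> > 0" using sin_pi_div_pos[OF m2] by (simp add: \<theta>_def)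
  have m\<theta>: "real m * \<theta> = pi" using m2 by (simp add: \<theta>_def)
  have "real (2 * m) * \<theta> = 2 * pi" using m\<theta> by simp
  then have "sin \<theta> * cheb a (2 * m) = 0"
    by (simp only: a_def cheb_sin) simp
  then have c0: "cheb a (2 * m) = 0" using sin0 by simp
  have "real (Suc (2 * m)) * \<theta> = \<theta> + 2 * pi" using m\<theta> by (simp add: algebra_simps)
  then have "sin \<theta> * cheb a (Suc (2 * m)) = sin \<theta>"
    by (simp only: a_def cheb_sin sin_periodic)
  then have c1: "cheb a (Suc (2 * m)) = 1" using sin0 by simp
  obtain n where n: "2 * m = Suc n" using m2 by (cases "2 * m") auto
  have "odd n" using n by (metis even_Suc even_mult_iff even_numeral)
  have cn: "cheb a n = -1" using c0 c1 n by simp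
  have es: "?f (simple s) = simple s"
    using c0 c1 by (simp add: foldr_refl_gen_alt[OF ast])
  have "?f (simple t) = foldr refl_gen (alt n s t) (refl_gen t (simple t))"
    by (simp only: n alt_Suc_snoc foldr_append) simp
  also have "refl_gen t (simple t) = (-1) *\<^sub>R simple t"
    by (simp add: vec_eq_iff refl_gen_eq bil_simps algebra_simps)
  also have "foldr refl_gen (alt n s t) \<dots> = (-1) *\<^sub>R foldr refl_gen (alt n s t) (simple t)"
    by (rule linear_scale[OF linear_foldr_refl_gen])
  also have "foldr refl_gen (alt n s t) (simple t) = - simple t"
    using \<open>odd n\<close> cn c0 n by (simp add: foldr_refl_gen_alt[OF ats])
  finally have et: "?f (simple t) = simple t" by simp
  have det: "1 - a\<^sup>2 \<noteq> 0"
    using sin0 by (simp add: a_def sin_squared_eq[symmetric])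
  define p where "p = (pairing s v + a * pairing t v) / (1 - a\<^sup>2)"
  define q where "q = (pairing t v + a * pairing s v) / (1 - a\<^sup>2)"
  define v' where "v' = v - (p *\<^sub>R simple s + q *\<^sub>R simple t)"
  have "(x + a * y) / (1 - a\<^sup>2) - a * ((y + a * x) / (1 - a\<^sup>2)) = x" for x y
  proof -
    have "(x + a * y) / (1 - a\<^sup>2) - a * ((y + a * x) / (1 - a\<^sup>2)) = (x * (1 - a\<^sup>2)) / (1 - a\<^sup>2)"
      by (simp add: diff_divide_distrib[symmetric] algebra_simps power2_eq_square)
    then show ?thesis using det by simp
  qed
  then have pq: "p - a * q = pairing s v" "q - a * p = pairing t v"
    unfolding p_def q_def by auto
  have "cox_form s t = - a" "cox_form t s = - a" using ast ats by auto
  then have "pairing s v' = 0" "pairing t v' = 0"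
    using pq by (simp_all add: v'_def bil_simps algebra_simps)
  then have fixed: "foldr refl_gen us v' = v'" if "set us \<subseteq> {s, t}" for us
    using that by (induction us) (auto simp: refl_gen_eq)
  have "v = p *\<^sub>R simple s + q *\<^sub>R simple t + v'" by (simp add: v'_def)
  then have "?f v = ?f (p *\<^sub>R simple s + q *\<^sub>R simple t + v')" by (rule arg_cong)
  also have "\<dots> = p *\<^sub>R ?f (simple s) + q *\<^sub>R ?f (simple t) + ?f v'"
    using linear_foldr_refl_gen[of "alt (2 * m) t s"] by (simp add: linear_add linear_scale)
  also have "\<dots> = v" using es et fixed[of "alt (2 * m) t s"] set_alt[of "2 * m" t s]
    by (simp add: v'_def insert_commute)
  finally show ?thesis by (simp only: concat_replicate_eq_alt m_def)
qed simp

text \<open>Every relator acts trivially, so the representation is well defined on \<open>W\<close>.\<close>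

lemma cox_equiv_refl_gen: "cox_equiv gen u v \<Longrightarrow> foldr refl_gen u = foldr refl_gen v"
proof (induction rule: cox_equiv.induct)
  case (relator u s t v)
  have "foldr refl_gen (concat (replicate (cox_m gen s t) [s, t])) = id"
  proof (cases "s = t")
    case False
    then show ?thesis using refl_gen_relation by (auto simp: fun_eq_iff)
  qed (auto simp: fun_eq_iff)
  then show ?case by (simp add: fun_eq_iff)
qed auto

lemma refl_rep_word_prod: "refl_rep (word_prod gen ws) = foldr refl_gen ws"
proof -
  have "word_prod gen (SOME us. word_prod gen us = word_prod gen ws) = word_prod gen ws"
    by (rule someI) (rule HOL.refl)
  then show ?thesis
    unfolding refl_rep_def by (rule cox_equiv_refl_gen[OF presentation])
qed

lemma refl_rep_one [simp]: "refl_rep \<one> v = v"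
  using refl_rep_word_prod[of "[]"] by simp

lemma refl_rep_gen [simp]: "refl_rep (gen s) v = refl_gen s v"
  using refl_rep_word_prod[of "[s]"] by simp

lemma refl_rep_mult:
  assumes "u \<in> carrier W" "v \<in> carrier W"
  shows "refl_rep (u \<otimes> v) x = refl_rep u (refl_rep v x)"
proof -
  obtain us where us: "u = word_prod gen us" using generated assms(1) by blast
  obtain vs where vs: "v = word_prod gen vs" using generated assms(2) by blast
  have "u \<otimes> v = word_prod gen (us @ vs)" by (simp add: us vs word_prod_append)
  then show ?thesis by (simp add: us vs refl_rep_word_prod)
qed

lemma linear_refl_rep: "w \<in> carrier W \<Longrightarrow> linear (refl_rep w)"
  using generated[of w] linear_foldr_refl_gen by (auto simp: refl_rep_word_prod)

lemma refl_rep_inv [simp]: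
  "w \<in> carrier W \<Longrightarrow> refl_rep (inv w) (refl_rep w x) = x"
  "w \<in> carrier W \<Longrightarrow> refl_rep w (refl_rep (inv w) x) = x"
  by (simp_all flip: refl_rep_mult)

lemma refl_rep_bil:
  assumes "w \<in> carrier W"
  shows "bil (refl_rep w u) (refl_rep w v) = bil u v"
proof -
  obtain ws where "w = word_prod gen ws" using generated assms by blast
  moreover have "bil (foldr refl_gen ws u) (foldr refl_gen ws v) = bil u v"
    by (induction ws) auto
  ultimately show ?thesis by (simp add: refl_rep_word_prod)
qed

lemma cheb_nonneg:
  assumes "s \<noteq> t" "cox_m gen s t \<noteq> 0 \<Longrightarrow> k \<le> cox_m gen s t"
  shows "0 \<le> cheb (- cox_form s t) k"
proof (cases "cox_m gen s t = 0")
  case True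
  then show ?thesis by (simp add: cox_form_def cheb_one)
next
  case False
  define m where "m = cox_m gen s t"
  have m2: "2 \<le> m" using cox_m_ge_2[OF assms(1)] False m_def by simp
  have "k \<le> m" using assms False m_def by simp
  then have "0 \<le> sin (real k * (pi / real m))"
    using m2 by (intro sin_ge_zero) (auto simp: field_simps)
  then have "0 \<le> sin (pi / real m) * cheb (cos (pi / real m)) k"
    by (simp add: cheb_sin)
  then have "0 \<le> cheb (cos (pi / real m)) k"
    using sin_pi_div_pos[OF m2] by (simp add: zero_le_mult_iff)
  then show ?thesis using False by (simp add: cox_form_def m_def)
qed

lemma linear_nonneg_comb:
  fixes f :: "real ^ 's \<Rightarrow> real ^ 's"
  assumes "linear f" "0 \<le> f u" "0 \<le> f v" "0 \<le> p" "0 \<le> q"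
  shows "0 \<le> f (p *\<^sub>R u + q *\<^sub>R v)"
  using assms by (simp add: linear_add linear_scale less_eq_vec_def)

text \<open>The proof is by induction on \<open>len w\<close>. Let \<open>t\<close> be the last letter of a reduced word of \<open>w\<close>.
  Write \<open>w\<close> as \<open>v\<close> times a word in \<open>s\<close> and \<open>t\<close>, with additive lengths and \<open>v\<close> as short as
  possible. Then \<open>v\<close> is shorter than \<open>w\<close> and is lengthened by both letters, so by induction it
  sends \<open>e\<^sub>s\<close> and \<open>e\<^sub>t\<close> to nonnegative vectors. As \<open>s\<close> lengthens \<open>w\<close>, the word is the
  alternating word ending in \<open>t\<close> and is shorter than the order of \<open>st\<close>; so it sends \<open>e\<^sub>s\<close> to a
  nonnegative combination of \<open>e\<^sub>s\<close> and \<open>e\<^sub>t\<close>.\<close>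

theorem root_nonneg_if_longer:
  assumes "w \<in> carrier W" "len w < len (w \<otimes> gen s)"
  shows "0 \<le> refl_rep w (simple s)"
  using assms
proof (induction "len w" arbitrary: w s rule: less_induct)
  case less
  show ?case
  proof (cases "len w = 0")
    case True
    then show ?thesis using less.prems by (auto simp: len_eq_0_iff less_eq_vec_def axis_def)
  next
    case False
    obtain ws where ws: "word_prod gen ws = w" "length ws = len w"
      using reduced_word[OF less.prems(1)] .
    with False obtain ws' t where wst: "ws = ws' @ [t]"
      by (cases ws rule: rev_cases) auto
    define w' where "w' = word_prod gen ws'"
    have w': "w' \<in> carrier W" "w = w' \<otimes> gen t"
      using ws wst by (auto simp: w'_def word_prod_append)
    have "len w' \<le> length ws'" by (simp add: w'_def len_le_length)
    then have lw': "len w = Suc (len w')"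
      using len_mult_gen_le[OF w'(1), of t] ws wst w' by simp
    have "s \<noteq> t" using less.prems lw' w' by auto
    define P where "P v us \<longleftrightarrow> v \<in> carrier W \<and> set us \<subseteq> {s, t} \<and> w = v \<otimes> word_prod gen us
      \<and> len w = len v + length us" for v us
    have "\<exists>us. P w' us" using w' lw' by (intro exI[of _ "[t]"]) (auto simp: P_def)
    then obtain v where v: "\<exists>us. P v us" "\<And>u. \<exists>us. P u us \<Longrightarrow> len v \<le> len u"
      using ex_has_least_nat[of "\<lambda>v. \<exists>us. P v us" w' len] by blast
    then obtain us where us: "v \<in> carrier W" "set us \<subseteq> {s, t}" "w = v \<otimes> word_prod gen us"
      "len w = len v + length us" by (auto simp: P_def)
    have "len v \<le> len w'" using v(2) \<open>\<exists>us. P w' us\<close> by blast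
    then have vw: "len v < len w" using lw' by simp
    have longer: "len v < len (v \<otimes> gen r)" if "r \<in> {s, t}" for r
    proof (rule ccontr)
      assume "\<not> len v < len (v \<otimes> gen r)"
      then have "len v = Suc (len (v \<otimes> gen r))" using len_mult_gen_cases[OF us(1), of r] by auto
      then have "P (v \<otimes> gen r) (r # us)"
        using us that by (auto simp: P_def m_assoc)
      then have "len v \<le> len (v \<otimes> gen r)" using v(2) by blast
      then show False using \<open>len v = _\<close> by simp
    qed
    have vs: "0 \<le> refl_rep v (simple s)" and vt: "0 \<le> refl_rep v (simple t)"
      using less.hyps[OF vw us(1)] longer by auto
    \<comment> \<open>A word of at most the same length ending in \<open>s\<close> would make \<open>w \<otimes> gen s\<close> shorter than \<open>w\<close>.\<close>
    have not_s: "word_prod gen us \<noteq> word_prod gen (vs @ [s])" if "length vs < length us" for vs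
    proof
      assume "word_prod gen us = word_prod gen (vs @ [s])"
      then have "w = v \<otimes> word_prod gen vs \<otimes> gen s"
        using us by (simp add: word_prod_append m_assoc)
      then have "w \<otimes> gen s = v \<otimes> word_prod gen vs" using us(1) by simp
      then have "len (w \<otimes> gen s) \<le> len v + length vs"
        using len_mult_le[OF us(1), of "word_prod gen vs"] len_le_length[of vs] by simp
      then show False using less.prems us that by simp
    qed
    have "us = alt (length us) t s"
    proof (rule eq_alt[OF us(2)])
      show "us \<noteq> xs @ [y, y] @ ys" for xs y ys
      proof
        assume a: "us = xs @ [y, y] @ ys"
        then have "word_prod gen us = word_prod gen (xs @ ys)" by (simp add: word_prod_append)
        then have "len w \<le> len v + length (xs @ ys)"
          using us len_mult_le[OF us(1), of "word_prod gen us"] len_le_length[of "xs @ ys"] by simp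
        then show False using us a by simp
      qed
      show "last us = t" if "us \<noteq> []"
      proof (rule ccontr)
        assume "last us \<noteq> t"
        then have "us = butlast us @ [s]" using us(2) that
          by (metis append_butlast_last_id insert_iff last_in_set singletonD subset_iff)
        then show False using not_s[of "butlast us"] that by simp
      qed
    qed
    then obtain k where k: "us = alt k t s" by blast
    \<comment> \<open>Otherwise the braid relation replaces the last letter \<open>t\<close> by \<open>s\<close>.\<close>
    have km: "k < cox_m gen s t" if "cox_m gen s t \<noteq> 0"
    proof (rule ccontr)
      let ?m = "cox_m gen s t"
      assume "\<not> k < ?m"
      then obtain xs where xs: "alt k t s = xs @ alt ?m t s" "length xs = k - ?m"
        using alt_split[of ?m k t s] by (meson not_less)
      define m' where "m' = ?m - 1"
      have m': "?m = Suc m'" using that by (simp add: m'_def)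
      have "word_prod gen us = word_prod gen (xs @ alt ?m s t)"
        using k xs braid_relation[of s t] by (simp add: word_prod_append)
      also have "alt ?m s t = alt m' t s @ [s]" using m' alt_Suc_snoc by simp
      finally have "word_prod gen us = word_prod gen ((xs @ alt m' t s) @ [s])"
        by (simp only: append_assoc)
      moreover have "length (xs @ alt m' t s) < length us"
        using xs(2) m' \<open>\<not> k < ?m\<close> by (simp add: k)
      ultimately show False using not_s by blast
    qed
    define a where "a = - cox_form s t"
    have "0 \<le> cheb a j" if "j \<le> Suc k" for j
      unfolding a_def using km that by (intro cheb_nonneg[OF \<open>s \<noteq> t\<close>]) linarith
    then have c: "0 \<le> cheb a k" "0 \<le> cheb a (Suc k)" by simp_all
    have "refl_rep w (simple s) = refl_rep v (foldr refl_gen (alt k t s) (simple s))"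
      using us k by (simp add: refl_rep_mult refl_rep_word_prod)
    also have "\<dots> = refl_rep v (if even k then cheb a (Suc k) *\<^sub>R simple s + cheb a k *\<^sub>R simple t
        else cheb a k *\<^sub>R simple s + cheb a (Suc k) *\<^sub>R simple t)"
      by (simp only: foldr_refl_gen_alt[OF a_def])
    also have "0 \<le> \<dots>"
      using linear_nonneg_comb[OF linear_refl_rep[OF us(1)] vs vt] c by (cases "even k") simp_all
    finally show ?thesis .
  qed
qed


section \<open>Roots\<close>

lemma vec_nonneg_iff: "0 \<le> (v :: real ^ 's) \<longleftrightarrow> (\<forall>s. 0 \<le> v $ s)"
  by (simp add: less_eq_vec_def)

lemma vec_nonpos_iff: "(v :: real ^ 's) \<le> 0 \<longleftrightarrow> (\<forall>s. v $ s \<le> 0)"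
  by (simp add: less_eq_vec_def)

lemma simple_nonneg [simp]: "0 \<le> simple s"
  by (simp add: vec_nonneg_iff axis_def)

definition roots :: "(real ^ 's) set" where
  "roots = {refl_rep w (simple s) | w s. w \<in> carrier W}"

lemma refl_rep_simple_root [simp]: "w \<in> carrier W \<Longrightarrow> refl_rep w (simple s) \<in> roots"
  by (auto simp: roots_def)

lemma simple_root [simp]: "simple s \<in> roots"
  using refl_rep_simple_root[of \<one> s] by simp

lemma refl_rep_root [simp]:
  assumes "\<beta> \<in> roots" "w \<in> carrier W"
  shows "refl_rep w \<beta> \<in> roots"
proof -
  obtain u s where "\<beta> = refl_rep u (simple s)" "u \<in> carrier W"
    using assms(1) by (auto simp: roots_def)
  then show ?thesis using assms(2) refl_rep_simple_root[of "w \<otimes> u" s] by (simp add: refl_rep_mult)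
qed

lemma refl_gen_root [simp]: "\<beta> \<in> roots \<Longrightarrow> refl_gen s \<beta> \<in> roots"
  using refl_rep_root[of \<beta> "gen s"] by simp

lemma refl_gen_simple [simp]: "refl_gen s (simple s) = - simple s"
  by (simp add: vec_eq_iff refl_gen_eq bil_simps)

lemma refl_rep_scale: "w \<in> carrier W \<Longrightarrow> refl_rep w (c *\<^sub>R v) = c *\<^sub>R refl_rep w v"
  by (rule linear_scale[OF linear_refl_rep])

lemma refl_rep_uminus: "w \<in> carrier W \<Longrightarrow> refl_rep w (- v) = - refl_rep w v"
  by (rule linear_neg[OF linear_refl_rep])

lemma uminus_root [simp]:
  assumes "\<beta> \<in> roots"
  shows "- \<beta> \<in> roots"
proof -
  obtain u s where "\<beta> = refl_rep u (simple s)" "u \<in> carrier W"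
    using assms by (auto simp: roots_def)
  then show ?thesis using refl_rep_simple_root[of "u \<otimes> gen s" s]
    by (simp add: refl_rep_mult refl_rep_uminus)
qed

lemma root_bil_self: "\<beta> \<in> roots \<Longrightarrow> bil \<beta> \<beta> = 1"
  by (auto simp: roots_def refl_rep_bil bil_simps)

lemma root_nonzero: "\<beta> \<in> roots \<Longrightarrow> \<beta> \<noteq> 0"
  using root_bil_self[of \<beta>] by (auto simp: bil_def)

text \<open>One of \<open>w\<close> and \<open>ws\<close> is lengthened by \<open>s\<close>, and these two send \<open>e\<^sub>s\<close> to opposite vectors.\<close>

lemma root_sign:
  assumes "\<beta> \<in> roots"
  shows "0 \<le> \<beta> \<or> \<beta> \<le> 0"
proof -
  obtain w s where w: "\<beta> = refl_rep w (simple s)" "w \<in> carrier W"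
    using assms by (auto simp: roots_def)
  from len_mult_gen_cases[OF w(2), of s] show ?thesis
  proof
    assume "len (w \<otimes> gen s) = Suc (len w)"
    then show ?thesis using root_nonneg_if_longer[OF w(2), of s] w by simp
  next
    assume "len w = Suc (len (w \<otimes> gen s))"
    then have "0 \<le> refl_rep (w \<otimes> gen s) (simple s)"
      using root_nonneg_if_longer[of "w \<otimes> gen s" s] w by simp
    then show ?thesis using w by (simp add: refl_rep_mult refl_rep_uminus)
  qed
qed

lemma root_not_both: "\<beta> \<in> roots \<Longrightarrow> 0 \<le> \<beta> \<Longrightarrow> \<beta> \<le> 0 \<Longrightarrow> False"
  using root_nonzero[of \<beta>] by auto

lemma root_neg_iff: "\<beta> \<in> roots \<Longrightarrow> \<not> 0 \<le> \<beta> \<longleftrightarrow> \<beta> \<le> 0"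
  using root_sign root_not_both by blast

lemma len_less_mult_gen_iff:
  assumes "w \<in> carrier W"
  shows "len w < len (w \<otimes> gen s) \<longleftrightarrow> 0 \<le> refl_rep w (simple s)"
proof
  show "len w < len (w \<otimes> gen s)" if "0 \<le> refl_rep w (simple s)"
  proof (rule ccontr)
    assume "\<not> len w < len (w \<otimes> gen s)"
    then have "len (w \<otimes> gen s) < len (w \<otimes> gen s \<otimes> gen s)"
      using len_mult_gen_cases[OF assms, of s] assms by auto
    then have "0 \<le> refl_rep (w \<otimes> gen s) (simple s)"
      using assms by (intro root_nonneg_if_longer) auto
    then have "refl_rep w (simple s) \<le> 0"
      using assms by (simp add: refl_rep_mult refl_rep_uminus)
    then show False using root_not_both[OF refl_rep_simple_root[OF assms] that] by blast
  qed
qed (use root_nonneg_if_longer assms in auto)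

lemma len_less_gen_mult_iff:
  assumes "w \<in> carrier W"
  shows "len w < len (gen s \<otimes> w) \<longleftrightarrow> 0 \<le> refl_rep (inv w) (simple s)"
  using len_less_mult_gen_iff[of "inv w" s] assms by (simp add: len_gen_mult_inv)

lemma len_gen_mult_less_iff:
  assumes "w \<in> carrier W"
  shows "len (gen s \<otimes> w) < len w \<longleftrightarrow> refl_rep (inv w) (simple s) \<le> 0"
  using len_less_gen_mult_iff[OF assms, of s] len_gen_mult_cases[OF assms, of s]
    root_neg_iff[of "refl_rep (inv w) (simple s)"] assms by auto

lemma refl_gen_nth: "t \<noteq> s \<Longrightarrow> refl_gen s v $ t = v $ t"
  by (simp add: refl_gen_eq axis_def)

text \<open>Roots have norm \<open>1\<close>, so \<open>e\<^sub>s\<close> is its only positive multiple that is a root. A reflection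
  changes only one coordinate, hence it can make only this positive root negative.\<close>

lemma root_eq_simple:
  assumes "\<beta> \<in> roots" "0 \<le> \<beta>" "\<And>t. t \<noteq> s \<Longrightarrow> \<beta> $ t = 0"
  shows "\<beta> = simple s"
proof -
  have b: "\<beta> = (\<beta> $ s) *\<^sub>R simple s"
    using assms(3) by (auto simp: vec_eq_iff axis_def)
  have "bil \<beta> \<beta> = (\<beta> $ s)\<^sup>2"
    by (subst b, subst (2) b) (simp add: bil_simps power2_eq_square)
  then have "(\<beta> $ s)\<^sup>2 = 1" using root_bil_self[OF assms(1)] by simp
  moreover have "0 \<le> \<beta> $ s" using assms(2) by (simp add: vec_nonneg_iff)
  ultimately have "\<beta> $ s = 1" by (simp add: power2_eq_1_iff)
  then show ?thesis using b by simp
qed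

lemma refl_gen_nonneg:
  assumes "\<beta> \<in> roots" "0 \<le> \<beta>" "\<beta> \<noteq> simple s"
  shows "0 \<le> refl_gen s \<beta>"
proof (rule ccontr)
  assume "\<not> 0 \<le> refl_gen s \<beta>"
  then have "refl_gen s \<beta> \<le> 0" using assms(1) by (simp add: root_neg_iff)
  then have "\<beta> $ t = 0" if "t \<noteq> s" for t
    using assms(2) refl_gen_nth[OF that, of \<beta>] by (metis antisym vec_nonneg_iff vec_nonpos_iff)
  then show False using root_eq_simple assms by blast
qed

definition inversions :: "'w \<Rightarrow> (real ^ 's) set" where
  "inversions w = {\<beta> \<in> roots. 0 \<le> \<beta> \<and> refl_rep w \<beta> \<le> 0}"

text \<open>Prepending a letter \<open>s\<close> to a word adds at most one inversion, the root that the word sends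
  to \<open>e\<^sub>s\<close>.\<close>

lemma finite_inversions:
  assumes "w \<in> carrier W"
  shows "finite (inversions w)"
proof -
  have "finite (inversions (word_prod gen ws))" for ws
  proof (induction ws)
    case Nil
    have "inversions \<one> = {}" using root_not_both by (auto simp: inversions_def)
    then show ?case by simp
  next
    case (Cons s ws)
    let ?w = "word_prod gen ws"
    have "inversions (word_prod gen (s # ws)) \<subseteq> insert (refl_rep (inv ?w) (simple s)) (inversions ?w)"
    proof
      fix \<beta> assume "\<beta> \<in> inversions (word_prod gen (s # ws))"
      then have b: "\<beta> \<in> roots" "0 \<le> \<beta>" "refl_gen s (refl_rep ?w \<beta>) \<le> 0"
        by (auto simp: inversions_def refl_rep_mult)
      have "refl_rep ?w \<beta> \<le> 0 \<or> refl_rep ?w \<beta> = simple s"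
      proof (rule ccontr)
        assume a: "\<not> ?thesis"
        then have "0 \<le> refl_rep ?w \<beta>" using b root_sign[of "refl_rep ?w \<beta>"] by auto
        then have "0 \<le> refl_gen s (refl_rep ?w \<beta>)" using a b refl_gen_nonneg by auto
        moreover have "refl_gen s (refl_rep ?w \<beta>) \<in> roots" using b by simp
        ultimately show False using b(3) root_not_both by blast
      qed
      then show "\<beta> \<in> insert (refl_rep (inv ?w) (simple s)) (inversions ?w)"
        using b by (auto simp: inversions_def dest: arg_cong[of _ _ "refl_rep (inv ?w)"])
    qed
    then show ?case using Cons by (rule finite_subset[OF _ finite.insertI])
  qed
  then show ?thesis using generated[OF assms] by auto
qed

lemma eq_one_if_simple_nonneg:
  assumes "w \<in> carrier W" "\<And>s. 0 \<le> refl_rep w (simple s)"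
  shows "w = \<one>"
proof (rule ccontr)
  assume "w \<noteq> \<one>"
  obtain ws where ws: "word_prod gen ws = w" "length ws = len w"
    using reduced_word[OF assms(1)] .
  with \<open>w \<noteq> \<one>\<close> obtain vs s where s: "ws = vs @ [s]"
    by (cases ws rule: rev_cases) auto
  then have "w \<otimes> gen s = word_prod gen vs"
    using ws by (auto simp: word_prod_append)
  then have "len (w \<otimes> gen s) < len w"
    using len_le_length[of vs] ws s by simp
  then show False using len_less_mult_gen_iff[OF assms(1), of s] assms(2)[of s] by simp
qed

text \<open>If \<open>u\<close> and \<open>v\<close> have the same inversions then \<open>u v\<^sup>-\<^sup>1\<close> keeps all simple roots positive,
  hence is not shortened by any generator.\<close>

lemma inversions_inj: "inj_on inversions (carrier W)"
proof (rule inj_onI)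
  fix u v assume uv: "u \<in> carrier W" "v \<in> carrier W" "inversions u = inversions v"
  have "0 \<le> refl_rep (u \<otimes> inv v) (simple s)" for s
  proof -
    let ?\<gamma> = "refl_rep (inv v) (simple s)"
    have g: "?\<gamma> \<in> roots" "refl_rep v ?\<gamma> = simple s" using uv by simp_all
    have "0 \<le> refl_rep u ?\<gamma>"
    proof (cases "0 \<le> ?\<gamma>")
      case True
      then have "?\<gamma> \<notin> inversions v" using root_not_both[of "simple s"] g by (auto simp: inversions_def)
      then have "?\<gamma> \<notin> inversions u" using uv(3) by simp
      then show ?thesis
        using True g(1) uv(1) root_sign[of "refl_rep u ?\<gamma>"] by (auto simp: inversions_def)
    next
      case False
      then have "?\<gamma> \<le> 0" using g by (simp add: root_neg_iff)
      then have "- ?\<gamma> \<in> inversions v"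
        using g uv(2) by (simp add: inversions_def refl_rep_uminus)
      then have "- ?\<gamma> \<in> inversions u" using uv(3) by simp
      then show ?thesis using uv(1) by (simp add: inversions_def refl_rep_uminus)
    qed
    then show ?thesis using uv by (simp add: refl_rep_mult)
  qed
  then have "u \<otimes> inv v = \<one>" using uv by (intro eq_one_if_simple_nonneg) auto
  then show "u = v" using uv by (metis inv_closed inv_equality inv_inv)
qed

lemma finite_carrier_if_finite_roots:
  assumes "finite roots"
  shows "finite (carrier W)"
proof -
  have "inversions ` carrier W \<subseteq> Pow roots" by (auto simp: inversions_def)
  then have "finite (inversions ` carrier W)"
    by (rule finite_subset) (use assms in simp)
  then show ?thesis using inversions_inj by (rule finite_imageD)
qed

lemma root_reflection:
  assumes "\<beta> \<in> roots"
  obtains r where "r \<in> carrier W" "inv r = r" "\<And>v. refl_rep r v = v - (2 * bil \<beta> v) *\<^sub>R \<beta>"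
proof -
  obtain u s where u: "\<beta> = refl_rep u (simple s)" "u \<in> carrier W"
    using assms by (auto simp: roots_def)
  let ?r = "u \<otimes> (gen s \<otimes> inv u)"
  show ?thesis
  proof
    show "?r \<in> carrier W" using u by simp
    show "inv ?r = ?r" using u by (simp add: inv_mult_group m_assoc)
    fix v
    have "pairing s (refl_rep (inv u) v) = bil (refl_rep u (simple s)) v"
      using refl_rep_bil[of u "simple s" "refl_rep (inv u) v"] u by (simp add: bil_simps)
    then show "refl_rep ?r v = v - (2 * bil \<beta> v) *\<^sub>R \<beta>"
      using u by (simp add: refl_rep_mult refl_gen_eq refl_rep_scale linear_diff[OF linear_refl_rep])
  qed
qed

section \<open>The dual representation and the fundamental domain\<close>

lemma dual_rep_inner:
  assumes "w \<in> carrier W"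
  shows "v \<bullet> dual_rep w x = refl_rep (inv w) v \<bullet> x"
  unfolding dual_rep_def using assms by (intro adjoint_works linear_refl_rep) simp

lemma simple_inner [simp]: "simple s \<bullet> x = x $ s"
  by (simp add: inner_axis inner_commute)

lemma dual_rep_nth:
  "w \<in> carrier W \<Longrightarrow> dual_rep w x $ s = refl_rep (inv w) (simple s) \<bullet> x"
  using dual_rep_inner[of w "simple s" x] by simp

lemma linear_dual_rep: "w \<in> carrier W \<Longrightarrow> linear (dual_rep w)"
  unfolding dual_rep_def by (intro adjoint_linear linear_refl_rep) simp

lemma dual_rep_mult:
  "u \<in> carrier W \<Longrightarrow> v \<in> carrier W \<Longrightarrow> dual_rep (u \<otimes> v) x = dual_rep u (dual_rep v x)"
  by (simp add: vec_eq_iff dual_rep_nth inv_mult_group refl_rep_mult dual_rep_inner)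

lemma dual_rep_one [simp]: "dual_rep \<one> x = x"
  by (simp add: vec_eq_iff dual_rep_nth)

lemma dual_rep_inv [simp]:
  "w \<in> carrier W \<Longrightarrow> dual_rep (inv w) (dual_rep w x) = x"
  "w \<in> carrier W \<Longrightarrow> dual_rep w (dual_rep (inv w) x) = x"
  by (simp_all flip: dual_rep_mult)

lemma refl_rep_dual_rep_inner:
  "w \<in> carrier W \<Longrightarrow> refl_rep w v \<bullet> dual_rep w x = v \<bullet> x"
  by (simp add: dual_rep_inner)

lemma dual_rep_gen_fixed: "x $ s = 0 \<Longrightarrow> dual_rep (gen s) x = x"
  by (simp add: vec_eq_iff dual_rep_nth refl_gen_eq inner_diff_left)

lemma dual_rep_gen_nth_self [simp]: "dual_rep (gen s) x $ s = - x $ s"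
  by (simp add: dual_rep_nth)

lemma nonneg_inner:
  fixes v x :: "real ^ 's"
  assumes "0 \<le> v" "0 \<le> x"
  shows "0 \<le> v \<bullet> x"
  using assms by (auto simp: inner_vec_def vec_nonneg_iff intro!: sum_nonneg)

lemma nonpos_inner:
  fixes v x :: "real ^ 's"
  assumes "v \<le> 0" "0 \<le> x"
  shows "v \<bullet> x \<le> 0"
  using nonneg_inner[of "- v" x] assms by simp

lemma root_inner_pos: "\<beta> \<in> roots \<Longrightarrow> 0 \<le> x \<Longrightarrow> 0 < \<beta> \<bullet> x \<Longrightarrow> 0 \<le> \<beta>"
  using root_sign[of \<beta>] nonpos_inner[of \<beta> x] by auto

lemma root_inner_neg: "\<beta> \<in> roots \<Longrightarrow> 0 \<le> x \<Longrightarrow> \<beta> \<bullet> x < 0 \<Longrightarrow> \<beta> \<le> 0"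
  using root_sign[of \<beta>] nonneg_inner[of \<beta> x] by auto

lemma nonneg_inner_zero:
  fixes v x :: "real ^ 's"
  assumes "0 \<le> v" "0 \<le> x" "v \<bullet> x = 0"
  shows "v $ s * x $ s = 0"
proof -
  have "(\<Sum>s\<in>UNIV. v $ s * x $ s) = 0" using assms(3) by (simp add: inner_vec_def)
  moreover have "0 \<le> v $ s * x $ s" for s using assms by (simp add: vec_nonneg_iff)
  ultimately show ?thesis by (simp add: sum_nonneg_eq_0_iff)
qed

definition zero_type :: "real ^ 's \<Rightarrow> 's set" where
  "zero_type x = {s. x $ s = 0}"

lemma fund_face_eq: "fund_face J = {x. 0 \<le> x \<and> zero_type x = J}"
proof (intro Set.set_eqI iffI)
  fix x assume "x \<in> {x. 0 \<le> x \<and> zero_type x = J}"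
  then have "0 \<le> x $ s" "x $ s = 0 \<longleftrightarrow> s \<in> J" for s
    by (auto simp: zero_type_def vec_nonneg_iff)
  then show "x \<in> fund_face J" by (auto simp: fund_face_def less_le)
next
  fix x assume "x \<in> fund_face J"
  then have z: "\<And>s. s \<in> J \<Longrightarrow> x $ s = 0" and p: "\<And>s. s \<notin> J \<Longrightarrow> 0 < x $ s"
    by (auto simp: fund_face_def)
  have "0 \<le> x $ s" for s using z p by (cases "s \<in> J") (auto simp: less_imp_le)
  moreover have "x $ s = 0 \<longleftrightarrow> s \<in> J" for s using z p[of s] by (cases "s \<in> J") auto
  ultimately show "x \<in> {x. 0 \<le> x \<and> zero_type x = J}"
    by (auto simp: zero_type_def vec_nonneg_iff)
qed

text \<open>If a reduced word of \<open>w\<close> starts with \<open>s\<close> then \<open>w\<^sup>-\<^sup>1\<close> makes \<open>e\<^sub>s\<close> negative, so the image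
  of \<open>x\<close> under \<open>w\<close> lies on the wall of \<open>s\<close>. Hence the letter \<open>s\<close> can be dropped.\<close>

theorem fundamental_domain:
  assumes "w \<in> carrier W" "0 \<le> x" "0 \<le> dual_rep w x"
  shows "dual_rep w x = x \<and>
    (\<exists>ws. set ws \<subseteq> zero_type x \<and> word_prod gen ws = w \<and> length ws = len w)"
  using assms
proof (induction "len w" arbitrary: w rule: less_induct)
  case less
  show ?case
  proof (cases "w = \<one>")
    case True
    then show ?thesis by (auto intro: exI[of _ "[]"])
  next
    case False
    obtain ws where ws: "word_prod gen ws = w" "length ws = len w"
      using reduced_word[OF less.prems(1)] .
    with False obtain s vs where s: "ws = s # vs" by (cases ws) auto
    define v where "v = word_prod gen vs"
    have v: "v \<in> carrier W" "w = gen s \<otimes> v" using ws s by (auto simp: v_def)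
    have sw: "gen s \<otimes> w = v" using v by simp
    have "len v \<le> length vs" by (simp add: v_def len_le_length)
    then have lv: "len v < len w" using ws s by simp
    then have "refl_rep (inv w) (simple s) \<le> 0"
      using len_gen_mult_less_iff[OF less.prems(1), of s] sw by simp
    then have "dual_rep w x $ s \<le> 0"
      using less.prems by (simp add: dual_rep_nth nonpos_inner)
    then have ys: "dual_rep w x $ s = 0"
      using less.prems by (simp add: vec_nonneg_iff antisym)
    have "dual_rep v x = dual_rep (gen s) (dual_rep w x)"
      using sw less.prems by (simp flip: dual_rep_mult)
    then have vx: "dual_rep v x = dual_rep w x"
      using dual_rep_gen_fixed[OF ys] by simp
    then obtain us where us: "dual_rep v x = x" "set us \<subseteq> zero_type x" "word_prod gen us = v"
      "length us = len v"
      using less.hyps[OF lv v(1)] less.prems by auto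
    have "s \<in> zero_type x" using ys vx us by (simp add: zero_type_def)
    moreover have "len w = Suc (len v)"
      using len_gen_mult_cases[OF v(1), of s] lv v by simp
    ultimately show ?thesis
      using us v vx by (intro conjI exI[of _ "s # us"]) auto
  qed
qed

lemma parabolic_iff: "w \<in> parabolic J \<longleftrightarrow> (\<exists>ws. set ws \<subseteq> J \<and> word_prod gen ws = w)"
proof
  assume "w \<in> parabolic J"
  then have "w \<in> generate W (gen ` J)" by (simp add: parabolic_def)
  then show "\<exists>ws. set ws \<subseteq> J \<and> word_prod gen ws = w"
  proof (induction rule: generate.induct)
    case one
    show ?case by (intro exI[of _ "[]"]) simp
  next
    case (incl h)
    then obtain s where "s \<in> J" "h = gen s" by auto
    then show ?case by (intro exI[of _ "[s]"]) simp
  next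
    case (inv h)
    then obtain s where "s \<in> J" "h = gen s" by auto
    then show ?case by (intro exI[of _ "[s]"]) simp
  next
    case (eng h1 h2)
    then obtain us vs where "set us \<subseteq> J" "word_prod gen us = h1"
      "set vs \<subseteq> J" "word_prod gen vs = h2" by auto
    then show ?case by (intro exI[of _ "us @ vs"]) (simp add: word_prod_append)
  qed
next
  assume "\<exists>ws. set ws \<subseteq> J \<and> word_prod gen ws = w"
  then obtain ws where "set ws \<subseteq> J" "word_prod gen ws = w" by blast
  then show "w \<in> parabolic J"
  proof (induction ws arbitrary: w)
    case Nil
    then show ?case by (auto simp: parabolic_def intro: generate.one)
  next
    case (Cons s ws)
    then have "gen s \<in> parabolic J" "word_prod gen ws \<in> parabolic J"
      by (auto simp: parabolic_def intro: generate.incl)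
    then show ?case using Cons.prems by (auto simp: parabolic_def intro: generate.eng)
  qed
qed

lemma word_prod_parabolic: "set ws \<subseteq> J \<Longrightarrow> word_prod gen ws \<in> parabolic J"
  by (auto simp: parabolic_iff)

lemma parabolic_closed: "w \<in> parabolic J \<Longrightarrow> w \<in> carrier W"
  by (auto simp: parabolic_iff)

lemma parabolic_subgroup: "subgroup (parabolic J) W"
  unfolding parabolic_def by (rule generate_is_subgroup) auto

lemma parabolic_one [simp]: "\<one> \<in> parabolic J"
  and parabolic_mult: "u \<in> parabolic J \<Longrightarrow> v \<in> parabolic J \<Longrightarrow> u \<otimes> v \<in> parabolic J"
  and parabolic_inv: "u \<in> parabolic J \<Longrightarrow> inv u \<in> parabolic J"
  using parabolic_subgroup by (auto simp: subgroup.one_closed subgroup.m_closed subgroup.m_inv_closed)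

lemma parabolic_gen: "s \<in> J \<Longrightarrow> gen s \<in> parabolic J"
  using word_prod_parabolic[of "[s]" J] by simp

lemma parabolic_fixes:
  assumes "w \<in> parabolic J" "J \<subseteq> zero_type x"
  shows "dual_rep w x = x"
proof -
  obtain ws where "set ws \<subseteq> J" "word_prod gen ws = w" using assms(1) by (auto simp: parabolic_iff)
  then show ?thesis
  proof (induction ws arbitrary: w)
    case (Cons s ws)
    then have "dual_rep (word_prod gen ws) x = x" by auto
    moreover have "dual_rep (gen s) x = x"
      using Cons.prems assms(2) by (intro dual_rep_gen_fixed) (auto simp: zero_type_def)
    ultimately show ?case using Cons.prems by (auto simp: dual_rep_mult)
  qed simp
qed

lemma parabolic_if_nonneg:
  assumes "w \<in> carrier W" "0 \<le> x" "0 \<le> dual_rep w x"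
  shows "w \<in> parabolic (zero_type x)"
  using fundamental_domain[OF assms] by (auto simp: parabolic_iff)

definition base_point :: "'s set \<Rightarrow> real ^ 's" where
  "base_point J = (\<chi> s. if s \<in> J then 0 else 1)"

lemma base_point_nonneg [simp]: "0 \<le> base_point J"
  and zero_type_base_point [simp]: "zero_type (base_point J) = J"
  by (auto simp: base_point_def vec_nonneg_iff zero_type_def)

text \<open>Elements of a parabolic subgroup fix a point with this stabilizer, so the reduced words
  found in the fundamental domain argument use only letters from \<open>J\<close>.\<close>

lemma parabolic_reduced_word:
  assumes "w \<in> parabolic J"
  obtains ws where "set ws \<subseteq> J" "word_prod gen ws = w" "length ws = len w"
proof -
  have "dual_rep w (base_point J) = base_point J"
    using assms by (rule parabolic_fixes) simp
  then show ?thesis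
    using fundamental_domain[of w "base_point J"] assms that parabolic_closed by auto
qed

lemma refl_rep_parabolic_nth:
  assumes "w \<in> parabolic J" "s \<notin> J"
  shows "refl_rep w v $ s = v $ s"
proof -
  obtain ws where "set ws \<subseteq> J" "word_prod gen ws = w" using assms(1) by (auto simp: parabolic_iff)
  then show ?thesis using assms(2)
  proof (induction ws arbitrary: w)
    case (Cons r ws)
    then have "refl_rep (word_prod gen ws) v $ s = v $ s" "s \<noteq> r" by auto
    then show ?case using Cons.prems by (auto simp: refl_rep_mult refl_gen_nth)
  qed auto
qed

definition zero_roots :: "real ^ 's \<Rightarrow> (real ^ 's) set" where
  "zero_roots x = {\<beta> \<in> roots. \<beta> \<bullet> x = 0}"

lemma root_reflection_fixes:
  assumes "r \<in> carrier W" "inv r = r" "\<And>v. refl_rep r v = v - (2 * bil \<beta> v) *\<^sub>R \<beta>" "\<beta> \<bullet> x = 0"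
  shows "dual_rep r x = x"
  unfolding vec_eq_iff dual_rep_nth[OF assms(1)] assms(2) assms(3)
  using assms(4) by (simp add: inner_diff_left)

text \<open>Sphericity can be tested on roots: the elements of a parabolic subgroup are determined by
  their inversions, which vanish on \<open>x\<close>; and the roots vanishing on \<open>x\<close> are determined up to
  sign by their reflections, which fix \<open>x\<close>.\<close>

lemma finite_parabolic_iff:
  assumes "0 \<le> x"
  shows "finite (parabolic (zero_type x)) \<longleftrightarrow> finite (zero_roots x)"
proof
  assume fin: "finite (zero_roots x)"
  have "inversions ` parabolic (zero_type x) \<subseteq> Pow (zero_roots x)"
  proof clarsimp
    fix w \<beta> assume w: "w \<in> parabolic (zero_type x)" "\<beta> \<in> inversions w"
    then have b: "\<beta> \<in> roots" "0 \<le> \<beta>" "refl_rep w \<beta> \<le> 0" by (auto simp: inversions_def)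
    have "\<beta> $ s * x $ s = 0" for s
    proof (cases "s \<in> zero_type x")
      case False
      then have "\<beta> $ s \<le> 0"
        using refl_rep_parabolic_nth[OF w(1) False, of \<beta>] b(3) by (metis vec_nonpos_iff)
      then have "\<beta> $ s = 0" using b(2) by (simp add: vec_nonneg_iff antisym)
      then show ?thesis by simp
    qed (simp add: zero_type_def)
    then have "\<beta> \<bullet> x = 0" unfolding inner_vec_def by (intro sum.neutral) simp
    then show "\<beta> \<in> zero_roots x" using b by (simp add: zero_roots_def)
  qed
  then have "finite (inversions ` parabolic (zero_type x))"
    by (rule finite_subset) (use fin in simp)
  moreover have "inj_on inversions (parabolic (zero_type x))"
    using inversions_inj by (rule inj_on_subset) (auto dest: parabolic_closed)
  ultimately show "finite (parabolic (zero_type x))"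
    by (rule finite_imageD)
next
  assume fin: "finite (parabolic (zero_type x))"
  define r where "r \<beta> = (SOME r. r \<in> carrier W \<and> inv r = r \<and>
    (\<forall>v. refl_rep r v = v - (2 * bil \<beta> v) *\<^sub>R \<beta>))" for \<beta>
  have r: "r \<beta> \<in> carrier W \<and> inv (r \<beta>) = r \<beta> \<and>
    (\<forall>v. refl_rep (r \<beta>) v = v - (2 * bil \<beta> v) *\<^sub>R \<beta>)" if "\<beta> \<in> roots" for \<beta>
    unfolding r_def by (rule someI_ex) (metis root_reflection that)
  let ?f = "\<lambda>\<beta>. (r \<beta>, (0::real^'s) \<le> \<beta>)"
  have "?f ` zero_roots x \<subseteq> parabolic (zero_type x) \<times> UNIV"
  proof clarsimp
    fix \<beta> assume "\<beta> \<in> zero_roots x"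
    then have b: "\<beta> \<in> roots" "\<beta> \<bullet> x = 0" by (auto simp: zero_roots_def)
    have "dual_rep (r \<beta>) x = x" using r[OF b(1)] b(2) root_reflection_fixes by blast
    then show "r \<beta> \<in> parabolic (zero_type x)"
      using parabolic_if_nonneg r[OF b(1)] assms by simp
  qed
  then have "finite (?f ` zero_roots x)"
    by (rule finite_subset) (use fin in simp)
  moreover have "inj_on ?f (zero_roots x)"
  proof (rule inj_onI)
    fix \<beta> \<gamma> assume "\<beta> \<in> zero_roots x" "\<gamma> \<in> zero_roots x" and eq: "?f \<beta> = ?f \<gamma>"
    then have b: "\<beta> \<in> roots" "\<gamma> \<in> roots" by (auto simp: zero_roots_def)
    define c where "c = bil \<gamma> \<beta>"
    have "refl_rep (r \<beta>) \<beta> = refl_rep (r \<gamma>) \<beta>" using eq by simp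
    then have "\<beta> - (2 * bil \<beta> \<beta>) *\<^sub>R \<beta> = \<beta> - (2 * bil \<gamma> \<beta>) *\<^sub>R \<gamma>" using r b by simp
    then have "2 *\<^sub>R \<beta> = 2 *\<^sub>R (c *\<^sub>R \<gamma>)" using root_bil_self[OF b(1)] by (simp add: c_def)
    then have bc: "\<beta> = c *\<^sub>R \<gamma>" by (simp only: scaleR_cancel_left) simp
    then have "c * c = 1"
      using root_bil_self[OF b(1)] root_bil_self[OF b(2)] by (simp add: bil_simps)
    then have "c = 1 \<or> c = -1" by (simp add: square_eq_1_iff)
    moreover have "c \<noteq> -1"
    proof
      assume "c = -1"
      then have "\<beta> = - \<gamma>" using bc by simp
      then show False using eq b root_sign[of \<gamma>] root_not_both[of \<gamma>] by auto
    qed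
    ultimately show "\<beta> = \<gamma>" using bc by auto
  qed
  ultimately show "finite (zero_roots x)"
    by (rule finite_imageD)
qed

lemma zero_roots_dual_rep:
  assumes "w \<in> carrier W"
  shows "zero_roots (dual_rep w x) = refl_rep w ` zero_roots x"
proof (intro Set.set_eqI iffI)
  fix \<beta> assume "\<beta> \<in> zero_roots (dual_rep w x)"
  then have "refl_rep (inv w) \<beta> \<in> zero_roots x"
    using assms by (simp add: zero_roots_def dual_rep_inner)
  then have "refl_rep w (refl_rep (inv w) \<beta>) \<in> refl_rep w ` zero_roots x" by (rule imageI)
  then show "\<beta> \<in> refl_rep w ` zero_roots x" using assms by simp
qed (use assms in \<open>auto simp: zero_roots_def refl_rep_dual_rep_inner\<close>)


section \<open>The Tits cone\<close>

text \<open>The chambers \<open>wC\<close> of the Coxeter complex whose closure contains \<open>x\<close>.\<close>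

definition chm :: "real ^ 's \<Rightarrow> 'w set" where
  "chm x = {w \<in> carrier W. 0 \<le> dual_rep (inv w) x}"

lemma chm_closed: "w \<in> chm x \<Longrightarrow> w \<in> carrier W"
  and chm_nonneg: "w \<in> chm x \<Longrightarrow> 0 \<le> dual_rep (inv w) x"
  by (auto simp: chm_def)

lemma tits_cone_iff: "x \<in> tits_cone \<longleftrightarrow> chm x \<noteq> {}"
proof
  assume "x \<in> tits_cone"
  then obtain w c where "w \<in> carrier W" "0 \<le> c" "x = dual_rep w c"
    by (auto simp: tits_cone_def fund_face_eq)
  then show "chm x \<noteq> {}" by (auto simp: chm_def)
next
  assume "chm x \<noteq> {}"
  then obtain w where w: "w \<in> carrier W" "0 \<le> dual_rep (inv w) x" by (auto simp: chm_def)
  then have "dual_rep w (dual_rep (inv w) x) \<in> tits_cone"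
    unfolding tits_cone_def fund_face_eq by blast
  then show "x \<in> tits_cone" using w by simp
qed

lemma tits_cone_obtain:
  assumes "x \<in> tits_cone"
  obtains w where "w \<in> chm x" "w \<in> carrier W" "0 \<le> dual_rep (inv w) x"
  using assms by (auto simp: tits_cone_iff chm_def)

lemma dual_rep_in_tits_cone: "w \<in> carrier W \<Longrightarrow> 0 \<le> c \<Longrightarrow> dual_rep w c \<in> tits_cone"
  by (auto simp: tits_cone_iff chm_def)

definition negative_roots :: "real ^ 's \<Rightarrow> (real ^ 's) set" where
  "negative_roots x = {\<beta> \<in> roots. 0 \<le> \<beta> \<and> \<beta> \<bullet> x < 0}"

text \<open>The positive roots that are negative on a point of \<open>wC\<close> are inversions of \<open>w\<^sup>-\<^sup>1\<close>.\<close>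

lemma finite_negative_roots:
  assumes "x \<in> tits_cone"
  shows "finite (negative_roots x)"
proof -
  obtain w where w: "w \<in> carrier W" "0 \<le> dual_rep (inv w) x"
    using tits_cone_obtain[OF assms] .
  have "negative_roots x \<subseteq> inversions (inv w)"
  proof
    fix \<beta> assume "\<beta> \<in> negative_roots x"
    then have b: "\<beta> \<in> roots" "0 \<le> \<beta>" "\<beta> \<bullet> x < 0" by (auto simp: negative_roots_def)
    have "refl_rep (inv w) \<beta> \<bullet> dual_rep (inv w) x < 0"
      using b w refl_rep_dual_rep_inner[of "inv w" \<beta> x] by simp
    then have "refl_rep (inv w) \<beta> \<le> 0" using root_inner_neg b w by simp
    then show "\<beta> \<in> inversions (inv w)" using b by (simp add: inversions_def)
  qed
  then show ?thesis using finite_inversions[of "inv w"] w by (simp add: finite_subset)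
qed

text \<open>The reflection in \<open>e\<^sub>s\<close> permutes the positive roots other than \<open>e\<^sub>s\<close>, and \<open>e\<^sub>s\<close> changes
  from negative on \<open>y\<close> to positive on the reflected point. With \<open>Z\<close> the set of all roots this
  moves points into the fundamental cone; with \<open>Z\<close> the roots vanishing on \<open>x\<close> it moves points
  near \<open>x\<close> to the positive side of the walls through \<open>x\<close>.\<close>

lemma card_negative_reflect:
  assumes Z: "Z \<subseteq> roots" "\<And>\<beta>. \<beta> \<in> Z \<Longrightarrow> refl_gen s \<beta> \<in> Z" "simple s \<in> Z"
    and y: "y $ s < 0" "finite {\<beta> \<in> Z. 0 \<le> \<beta> \<and> \<beta> \<bullet> y < 0}"
  shows "finite {\<beta> \<in> Z. 0 \<le> \<beta> \<and> \<beta> \<bullet> dual_rep (gen s) y < 0}"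
    and "card {\<beta> \<in> Z. 0 \<le> \<beta> \<and> \<beta> \<bullet> dual_rep (gen s) y < 0} < card {\<beta> \<in> Z. 0 \<le> \<beta> \<and> \<beta> \<bullet> y < 0}"
proof -
  let ?N = "{\<beta> \<in> Z. 0 \<le> \<beta> \<and> \<beta> \<bullet> y < 0}"
    and ?M = "{\<beta> \<in> Z. 0 \<le> \<beta> \<and> \<beta> \<bullet> dual_rep (gen s) y < 0}"
  have "refl_gen s ` ?M \<subseteq> ?N - {simple s}"
  proof
    fix \<gamma> assume "\<gamma> \<in> refl_gen s ` ?M"
    then obtain \<beta> where b: "\<beta> \<in> Z" "0 \<le> \<beta>" "\<beta> \<bullet> dual_rep (gen s) y < 0" and g: "\<gamma> = refl_gen s \<beta>"
      by auto
    have r: "\<beta> \<in> roots" using b(1) Z(1) by auto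
    have "\<beta> \<noteq> simple s" using b(3) y(1) by auto
    then have "0 \<le> \<gamma>" using refl_gen_nonneg r b(2) g by blast
    moreover have "\<gamma> \<bullet> y < 0" using b(3) g by (simp add: dual_rep_inner)
    moreover have "\<gamma> \<noteq> simple s"
    proof
      assume "\<gamma> = simple s"
      then have "refl_gen s \<gamma> = - simple s" by simp
      then have "\<beta> = - simple s" using g by simp
      then show False using b(2) root_not_both[of "simple s"] by simp
    qed
    ultimately show "\<gamma> \<in> ?N - {simple s}" using Z(2)[OF b(1)] g by simp
  qed
  moreover have "inj_on (refl_gen s) ?M"
    by (rule inj_on_inverseI[where g = "refl_gen s"]) simp
  ultimately show "finite ?M" and "card ?M < card ?N"
    using y Z(3) inj_on_finite[of "refl_gen s" ?M "?N - {simple s}"]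
      card_inj_on_le[of "refl_gen s" ?M "?N - {simple s}"] card_Diff1_less[of ?N "simple s"]
    by auto
qed

text \<open>Reflecting in simple roots that are negative on \<open>x\<close> lowers the number of negative roots
  until the fundamental cone is reached. Convexity of the cone follows, as a root that is
  negative at a point of a segment is negative at one of its ends.\<close>

lemma tits_cone_if_finite:
  assumes "finite (negative_roots x)"
  shows "x \<in> tits_cone"
  using assms
proof (induction "card (negative_roots x)" arbitrary: x rule: less_induct)
  case less
  show ?case
  proof (cases "0 \<le> x")
    case True
    then show ?thesis using dual_rep_in_tits_cone[of \<one> x] by simp
  next
    case False
    then obtain s where s: "x $ s < 0" by (auto simp: vec_nonneg_iff not_le)
    let ?y = "dual_rep (gen s) x"
    have "finite (negative_roots ?y)" "card (negative_roots ?y) < card (negative_roots x)"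
      using card_negative_reflect[of roots s x] s less.prems by (auto simp: negative_roots_def)
    then have "?y \<in> tits_cone" using less.hyps by blast
    then obtain w where w: "w \<in> carrier W" "0 \<le> dual_rep (inv w) ?y"
      using tits_cone_obtain by metis
    then have "gen s \<otimes> w \<in> chm x" by (simp add: chm_def inv_mult_group dual_rep_mult)
    then show ?thesis by (auto simp: tits_cone_iff)
  qed
qed

lemma tits_cone_segment:
  assumes "x \<in> tits_cone" "y \<in> tits_cone" "z \<in> closed_segment x y"
  shows "z \<in> tits_cone"
proof -
  obtain u where u: "0 \<le> u" "u \<le> 1" "z = (1 - u) *\<^sub>R x + u *\<^sub>R y"
    using assms(3) by (auto simp: in_segment)
  have "negative_roots z \<subseteq> negative_roots x \<union> negative_roots y"
  proof
    fix \<beta> assume b: "\<beta> \<in> negative_roots z"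
    then have "(1 - u) * (\<beta> \<bullet> x) + u * (\<beta> \<bullet> y) < 0"
      by (simp add: negative_roots_def u inner_add_right)
    then have "\<beta> \<bullet> x < 0 \<or> \<beta> \<bullet> y < 0"
      using u by (metis add_nonneg_nonneg diff_ge_0_iff_ge mult_nonneg_nonneg not_le)
    then show "\<beta> \<in> negative_roots x \<union> negative_roots y"
      using b by (auto simp: negative_roots_def)
  qed
  then have "finite (negative_roots z)"
    using finite_negative_roots assms by (meson finite_UnI finite_subset)
  then show ?thesis by (rule tits_cone_if_finite)
qed

lemma tits_cone_dual_rep:
  assumes "x \<in> tits_cone" "w \<in> carrier W"
  shows "dual_rep w x \<in> tits_cone"
proof -
  obtain v where v: "v \<in> carrier W" "0 \<le> dual_rep (inv v) x"
    using tits_cone_obtain[OF assms(1)] .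
  then have "w \<otimes> v \<in> chm (dual_rep w x)"
    using assms(2) by (simp add: chm_def inv_mult_group dual_rep_mult)
  then show ?thesis by (auto simp: tits_cone_iff)
qed

lemma finite_separating_roots:
  assumes "x \<in> tits_cone" "y \<in> tits_cone"
  shows "finite {\<beta> \<in> roots. (\<beta> \<bullet> x) * (\<beta> \<bullet> y) < 0}"
proof -
  let ?N = "negative_roots x \<union> negative_roots y"
  have "{\<beta> \<in> roots. (\<beta> \<bullet> x) * (\<beta> \<bullet> y) < 0} \<subseteq> ?N \<union> uminus ` ?N"
  proof clarify
    fix \<beta> assume b: "\<beta> \<in> roots" "(\<beta> \<bullet> x) * (\<beta> \<bullet> y) < 0" "\<beta> \<notin> uminus ` ?N"
      "\<beta> \<notin> negative_roots y"
    have "0 \<le> \<beta>"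
    proof (rule ccontr)
      assume "\<not> 0 \<le> \<beta>"
      then have "0 \<le> - \<beta>" "- \<beta> \<in> roots" using b root_neg_iff by auto
      moreover have "- \<beta> \<bullet> x < 0 \<or> - \<beta> \<bullet> y < 0" using b(2) by (auto simp: mult_less_0_iff)
      ultimately have "- \<beta> \<in> ?N" by (auto simp: negative_roots_def)
      then have "- (- \<beta>) \<in> uminus ` ?N" by (rule imageI)
      then show False using b(3) by simp
    qed
    then show "\<beta> \<in> negative_roots x"
      using b by (auto simp: negative_roots_def mult_less_0_iff)
  qed
  moreover have "finite ?N" using finite_negative_roots assms by simp
  ultimately show ?thesis by (meson finite_UnI finite_imageI finite_subset)
qed

subsection \<open>Composition of sign vectors\<close>

text \<open>The sign vector of \<open>x\<close> records on which side of each wall \<open>x\<close> lies. \<open>sign_comp x y z\<close> says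
  that the signs of \<open>z\<close> are obtained from those of \<open>x\<close> by replacing every \<open>0\<close> by the sign of
  \<open>y\<close>, the rule that defines projections.\<close>

definition sign_comp :: "real ^ 's \<Rightarrow> real ^ 's \<Rightarrow> real ^ 's \<Rightarrow> bool" where
  "sign_comp x y z \<longleftrightarrow>
    (\<forall>\<beta>\<in>roots. sgn (\<beta> \<bullet> z) = (if \<beta> \<bullet> x = 0 then sgn (\<beta> \<bullet> y) else sgn (\<beta> \<bullet> x)))"

lemma zero_roots_sign_comp:
  assumes "sign_comp x y z"
  shows "zero_roots z = zero_roots x \<inter> zero_roots y"
proof -
  have "\<beta> \<bullet> z = 0 \<longleftrightarrow> \<beta> \<bullet> x = 0 \<and> \<beta> \<bullet> y = 0" if "\<beta> \<in> roots" for \<beta>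
    using assms that unfolding sign_comp_def by (metis sgn_zero_iff)
  then show ?thesis by (auto simp: zero_roots_def)
qed

text \<open>If \<open>a\<close> and \<open>b\<close> have opposite signs then the linear function from \<open>a\<close> at \<open>0\<close> to \<open>b\<close> at \<open>1\<close>
  vanishes at \<open>\<bar>a\<bar> / (\<bar>a\<bar> + \<bar>b\<bar>)\<close>; otherwise it keeps its sign between \<open>0\<close> and \<open>1\<close>.\<close>

lemma sgn_perturb:
  fixes a b t :: real
  assumes "0 < t" "t < 1" "a * b < 0 \<Longrightarrow> t < \<bar>a\<bar> / (\<bar>a\<bar> + \<bar>b\<bar>)"
  shows "sgn ((1 - t) * a + t * b) = (if a = 0 then sgn b else sgn a)"
proof (cases "a = 0")
  case True
  then show ?thesis using assms by (simp add: sgn_mult)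
next
  case False
  have pos: "0 < (1 - t) * c + t * d" if c: "0 < c" and "c * d < 0 \<Longrightarrow> t < \<bar>c\<bar> / (\<bar>c\<bar> + \<bar>d\<bar>)" for c d
  proof (cases "0 \<le> d")
    case True
    then show ?thesis using assms c by (simp add: add_pos_nonneg)
  next
    case False
    then have "c * d < 0" using c by (simp add: mult_pos_neg)
    then have "t < c / (c - d)" using that(2) c False by simp
    then have "t * (c - d) < c" using c False by (simp add: field_simps)
    then show ?thesis by (simp add: algebra_simps)
  qed
  show ?thesis
  proof (cases "0 < a")
    case True
    then show ?thesis using pos[of a b] assms(3) by simp
  next
    case neg: False
    then have "0 < (1 - t) * (- a) + t * (- b)"
      using pos[of "- a" "- b"] assms(3) False by simp
    then have "(1 - t) * a + t * b < 0" by (simp add: algebra_simps)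
    then show ?thesis using neg False by simp
  qed
qed

lemma sign_comp_if_finite_separating:
  assumes "finite {\<beta> \<in> roots. (\<beta> \<bullet> x) * (\<beta> \<bullet> y) < 0}"
  shows "\<exists>z \<in> closed_segment x y. sign_comp x y z"
proof -
  let ?F = "{\<beta> \<in> roots. (\<beta> \<bullet> x) * (\<beta> \<bullet> y) < 0}"
  let ?q = "\<lambda>\<beta>. \<bar>\<beta> \<bullet> x\<bar> / (\<bar>\<beta> \<bullet> x\<bar> + \<bar>\<beta> \<bullet> y\<bar>)"
  have "\<forall>\<^sub>F t in at_right (0::real). \<forall>\<beta>\<in>?F. t < ?q \<beta>"
  proof (rule eventually_ball_finite[OF assms], rule ballI)
    fix \<beta> assume "\<beta> \<in> ?F"
    then have "\<beta> \<bullet> x \<noteq> 0" by auto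
    then have "0 < ?q \<beta>" by (intro divide_pos_pos) auto
    then show "\<forall>\<^sub>F t in at_right 0. t < ?q \<beta>"
      using eventually_at_right_real[of 0 "?q \<beta>"] by (auto elim: eventually_mono)
  qed
  moreover have "\<forall>\<^sub>F t in at_right (0::real). t \<in> {0<..<1}"
    by (rule eventually_at_right_real) simp
  ultimately have "\<forall>\<^sub>F t in at_right (0::real). (\<forall>\<beta>\<in>?F. t < ?q \<beta>) \<and> t \<in> {0<..<1}"
    by (rule eventually_conj)
  then obtain t :: real where t: "\<And>\<beta>. \<beta> \<in> ?F \<Longrightarrow> t < ?q \<beta>" "0 < t" "t < 1"
    using eventually_happens'[OF trivial_limit_at_right_real] by (metis (no_types, lifting) greaterThanLessThan_iff)
  let ?z = "(1 - t) *\<^sub>R x + t *\<^sub>R y"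
  have "?z \<in> closed_segment x y" using t by (auto simp: in_segment intro!: exI[of _ t])
  moreover have "sign_comp x y ?z"
    unfolding sign_comp_def using t sgn_perturb by (auto simp: inner_add_right)
  ultimately show ?thesis by blast
qed

lemma sign_comp_in_tits_cone:
  assumes "x \<in> tits_cone" "y \<in> tits_cone"
  obtains z where "z \<in> tits_cone" "z \<in> closed_segment x y" "sign_comp x y z"
  using sign_comp_if_finite_separating[OF finite_separating_roots[OF assms]]
    tits_cone_segment[OF assms] by blast

text \<open>Points with finite stabilizer are interior points of the Tits cone: near such a point \<open>x\<close>
  only the walls through \<open>x\<close> matter, and the finite stabilizer of \<open>x\<close> can move every nearby
  point to the positive side of all of them.\<close>

lemma interior_step:
  assumes "0 \<le> x" "finite (zero_roots x)"
  shows "\<exists>t. 0 < t \<and> t < 1 \<and> x + t *\<^sub>R (y - x) \<in> tits_cone"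
proof -
  let ?J = "zero_type x"
  have fin: "finite (parabolic ?J)" using assms finite_parabolic_iff by blast
  let ?I = "parabolic ?J \<times> (- ?J)"
  \<comment> \<open>Near \<open>x\<close> the coordinates outside \<open>?J\<close> stay positive under the finite stabilizer of \<open>x\<close>.\<close>
  have "\<forall>\<^sub>F t in at_right (0::real). \<forall>i\<in>?I. case i of (w, s) \<Rightarrow> 0 < x $ s + t * (dual_rep w (y - x) $ s)"
  proof (rule eventually_ball_finite, use fin in simp, rule ballI)
    fix i assume "i \<in> ?I"
    then obtain w s where i: "i = (w, s)" "s \<notin> ?J" by auto
    then have "0 < x $ s" using assms(1) by (auto simp: zero_type_def vec_nonneg_iff less_le)
    moreover have "((\<lambda>t. x $ s + t * (dual_rep w (y - x) $ s)) \<longlongrightarrow> x $ s + 0 * (dual_rep w (y - x) $ s)) (at_right 0)"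
      by (intro tendsto_intros)
    ultimately show "\<forall>\<^sub>F t in at_right (0::real). case i of (w, s) \<Rightarrow> 0 < x $ s + t * (dual_rep w (y - x) $ s)"
      using i by (auto intro: order_tendstoD(1))
  qed
  moreover have "\<forall>\<^sub>F t in at_right (0::real). t \<in> {0<..<1}"
    by (rule eventually_at_right_real) simp
  ultimately have "\<forall>\<^sub>F t in at_right (0::real).
      (\<forall>i\<in>?I. case i of (w, s) \<Rightarrow> 0 < x $ s + t * (dual_rep w (y - x) $ s)) \<and> t \<in> {0<..<1}"
    by (rule eventually_conj)
  then obtain t :: real where t: "\<And>i. i \<in> ?I \<Longrightarrow> case i of (w, s) \<Rightarrow> 0 < x $ s + t * (dual_rep w (y - x) $ s)"
    and t01: "0 < t" "t < 1"
    using eventually_happens'[OF trivial_limit_at_right_real] by (metis (no_types, lifting) greaterThanLessThan_iff)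
  define z where "z = x + t *\<^sub>R (y - x)"
  have outside: "0 < dual_rep w z $ s" if "w \<in> parabolic ?J" "s \<notin> ?J" for w s
  proof -
    have "dual_rep w z = dual_rep w x + t *\<^sub>R dual_rep w (y - x)"
      using linear_dual_rep[OF parabolic_closed[OF that(1)]]
      by (simp add: z_def linear_add linear_scale)
    then show ?thesis using t[of "(w, s)"] that parabolic_fixes[OF that(1)] by simp
  qed
  \<comment> \<open>The stabilizer element that leaves the fewest roots negative moves \<open>z\<close> into the fundamental cone.\<close>
  define N where "N w = {\<beta> \<in> zero_roots x. 0 \<le> \<beta> \<and> \<beta> \<bullet> dual_rep w z < 0}" for w
  have finN: "finite (N w)" for w using assms(2) by (simp add: N_def)
  obtain w where w: "w \<in> parabolic ?J" "\<And>u. u \<in> parabolic ?J \<Longrightarrow> card (N w) \<le> card (N u)"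
    using ex_has_least_nat[of "\<lambda>w. w \<in> parabolic ?J" \<one> "\<lambda>w. card (N w)"] parabolic_one by blast
  have wc: "w \<in> carrier W" using w parabolic_closed by blast
  have "0 \<le> dual_rep w z $ s" for s
  proof (rule ccontr)
    assume "\<not> 0 \<le> dual_rep w z $ s"
    then have neg: "dual_rep w z $ s < 0" by simp
    then have sJ: "s \<in> ?J" using outside[OF w(1), of s] by fastforce
    then have xs: "x $ s = 0" by (simp add: zero_type_def)
    let ?u = "gen s \<otimes> w"
    have u: "?u \<in> parabolic ?J" using w sJ by (intro parabolic_mult parabolic_gen)
    have zs: "simple s \<in> zero_roots x" using xs by (simp add: zero_roots_def)
    have zr: "refl_gen s \<beta> \<in> zero_roots x" if "\<beta> \<in> zero_roots x" for \<beta>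
    proof -
      have "refl_gen s \<beta> \<bullet> x = 0"
        using that xs by (simp add: zero_roots_def refl_gen_eq inner_diff_left)
      then show ?thesis using that by (simp add: zero_roots_def)
    qed
    have "card (N ?u) < card (N w)"
      using card_negative_reflect(2)[of "zero_roots x" s "dual_rep w z"] zs zr neg finN[of w] wc
      by (auto simp: N_def zero_roots_def dual_rep_mult)
    then show False using w(2)[OF u] by simp
  qed
  then have "0 \<le> dual_rep w z" by (simp add: vec_nonneg_iff)
  then have "inv w \<in> chm z" using wc by (simp add: chm_def)
  then show ?thesis using t01 by (auto simp: z_def tits_cone_iff)
qed

text \<open>A first step from \<open>x\<close> towards \<open>y\<close> stays in the cone, and its end point has the signs of
  \<open>y\<close> on all walls through \<open>x\<close>; so it can play the role of \<open>y\<close> in the convex case.\<close>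

lemma sign_comp_spherical:
  assumes "x \<in> tits_cone" "finite (zero_roots x)"
  obtains z where "z \<in> tits_cone" "z \<in> closed_segment x y" "sign_comp x y z"
proof -
  obtain v where v: "v \<in> carrier W" "0 \<le> dual_rep (inv v) x"
    using tits_cone_obtain[OF assms(1)] .
  have "finite (zero_roots (dual_rep (inv v) x))"
    using assms(2) v by (simp add: zero_roots_dual_rep)
  then obtain t where t: "0 < t" "t < 1"
    "dual_rep (inv v) x + t *\<^sub>R (dual_rep (inv v) y - dual_rep (inv v) x) \<in> tits_cone"
    using interior_step v by blast
  define z1 where "z1 = (1 - t) *\<^sub>R x + t *\<^sub>R y"
  have z1: "z1 = x + t *\<^sub>R (y - x)" by (simp add: z1_def algebra_simps)
  have "dual_rep (inv v) z1 = dual_rep (inv v) x + t *\<^sub>R (dual_rep (inv v) y - dual_rep (inv v) x)"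
    using linear_dual_rep[of "inv v"] v(1) by (simp add: z1 linear_add linear_scale linear_diff)
  then have "dual_rep v (dual_rep (inv v) z1) \<in> tits_cone"
    using t v tits_cone_dual_rep by simp
  then have z1c: "z1 \<in> tits_cone" using v by simp
  obtain z where z: "z \<in> tits_cone" "z \<in> closed_segment x z1" "sign_comp x z1 z"
    using sign_comp_in_tits_cone[OF assms(1) z1c] .
  have "z1 \<in> closed_segment x y" using t by (auto simp: z1_def in_segment intro!: exI[of _ t])
  then have "z \<in> closed_segment x y"
    using z(2) subset_closed_segment[of x z1 x y] by auto
  moreover have "sgn (\<beta> \<bullet> z1) = sgn (\<beta> \<bullet> y)" if "\<beta> \<bullet> x = 0" for \<beta>
    using that t by (simp add: z1_def inner_add_right sgn_mult)
  then have "sign_comp x y z"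
    using z(3) by (simp add: sign_comp_def)
  ultimately show ?thesis using that z(1) by blast
qed

subsection \<open>The two halves of the twin Tits cone\<close>

lemma finite_by_reflection:
  assumes "finite A" "\<And>\<beta>. \<beta> \<in> B \<Longrightarrow> \<beta> \<notin> A \<Longrightarrow> refl_gen s \<beta> \<in> A"
  shows "finite B"
proof -
  have "B \<subseteq> A \<union> refl_gen s ` A"
  proof
    fix \<beta> assume "\<beta> \<in> B"
    then show "\<beta> \<in> A \<union> refl_gen s ` A"
      using assms(2)[of \<beta>] imageI[of "refl_gen s \<beta>" A "refl_gen s"] by auto
  qed
  then show ?thesis using assms(1) by (meson finite_UnI finite_imageI finite_subset)
qed

text \<open>Let \<open>N s\<close> be the set of roots that are not orthogonal to \<open>e\<^sub>s\<close>. If only finitely many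
  roots take a nonzero value on \<open>x\<close> then \<open>N s\<close> is finite for every \<open>s\<close> with \<open>x\<^sub>s \<noteq> 0\<close>, because
  reflecting in \<open>e\<^sub>s\<close> makes a root of \<open>N s\<close> that vanishes on \<open>x\<close> nonzero there. The same trick
  shows that finiteness of \<open>N s\<close> spreads along the edges of the Coxeter diagram.\<close>

lemma zero_if_finite_nonzero_roots:
  assumes "infinite (carrier W)" "irreducible" "finite {\<beta> \<in> roots. \<beta> \<bullet> x \<noteq> 0}"
  shows "x = 0"
proof (rule ccontr)
  assume "x \<noteq> 0"
  define N where "N s = {\<beta> \<in> roots. pairing s \<beta> \<noteq> 0}" for s
  define L where "L = {s. finite (N s)}"
  obtain s0 where s0: "x $ s0 \<noteq> 0" using \<open>x \<noteq> 0\<close> by (auto simp: vec_eq_iff)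
  have "finite (N s0)"
    using assms(3)
  proof (rule finite_by_reflection)
    fix \<beta> assume "\<beta> \<in> N s0" "\<beta> \<notin> {\<beta> \<in> roots. \<beta> \<bullet> x \<noteq> 0}"
    then have b: "\<beta> \<in> roots" "pairing s0 \<beta> \<noteq> 0" "\<beta> \<bullet> x = 0" by (auto simp: N_def)
    then have "refl_gen s0 \<beta> \<bullet> x \<noteq> 0" using s0 by (simp add: refl_gen_eq inner_diff_left)
    then show "refl_gen s0 \<beta> \<in> {\<beta> \<in> roots. \<beta> \<bullet> x \<noteq> 0}" using b(1) by simp
  qed
  then have "L \<noteq> {}" by (auto simp: L_def)
  have "L = UNIV"
  proof (rule ccontr)
    assume "L \<noteq> UNIV"
    then obtain s t where st: "s \<in> L" "t \<notin> L" "cox_m gen s t \<noteq> 2"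
      using assms(2) \<open>L \<noteq> {}\<close> unfolding irreducible_def by (meson ComplD)
    then have "s \<noteq> t" by auto
    have "cox_form s t \<noteq> 0"
    proof (cases "cox_m gen s t = 0")
      case False
      then have "3 \<le> cox_m gen s t" using cox_m_ge_2[OF \<open>s \<noteq> t\<close>] st(3) by fastforce
      then have "pi / real (cox_m gen s t) < pi / 2" "0 < pi / real (cox_m gen s t)"
        by (auto simp: field_simps)
      then have "0 < cos (pi / real (cox_m gen s t))" by (intro cos_gt_zero)
      then show ?thesis using False by (simp add: cox_form_def)
    qed (simp add: cox_form_def)
    have "finite (N s)" using st(1) by (simp add: L_def)
    then have "finite (N t)"
    proof (rule finite_by_reflection)
      fix \<beta> assume "\<beta> \<in> N t" "\<beta> \<notin> N s"
      then have "\<beta> \<in> roots" "pairing t \<beta> \<noteq> 0" "pairing s \<beta> = 0" by (auto simp: N_def)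
      moreover from this have "pairing s (refl_gen t \<beta>) \<noteq> 0"
        using \<open>cox_form s t \<noteq> 0\<close> by (simp add: refl_gen_eq bil_simps)
      ultimately show "refl_gen t \<beta> \<in> N s" by (simp add: N_def)
    qed
    then show False using st(2) by (simp add: L_def)
  qed
  have "roots \<subseteq> (\<Union>s. N s)"
  proof
    fix \<beta> assume b: "\<beta> \<in> roots"
    have "\<exists>s. pairing s \<beta> \<noteq> 0"
    proof (rule ccontr)
      assume "\<nexists>s. pairing s \<beta> \<noteq> 0"
      then have "bil \<beta> \<beta> = 0" by (simp add: bil_def)
      then show False using root_bil_self[OF b] by simp
    qed
    then show "\<beta> \<in> (\<Union>s. N s)" using b by (auto simp: N_def)
  qed
  moreover have "finite (\<Union>s. N s)" using \<open>L = UNIV\<close> by (auto simp: L_def)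
  ultimately have "finite roots" by (rule finite_subset)
  then show False using finite_carrier_if_finite_roots assms(1) by blast
qed

text \<open>Every root that does not vanish on \<open>x\<close> separates \<open>x\<close> from \<open>- x\<close>, and only finitely many
  roots separate two points of the cone.\<close>

lemma tits_cone_inter_uminus:
  assumes "infinite (carrier W)" "irreducible" "x \<in> tits_cone" "- x \<in> tits_cone"
  shows "x = 0"
proof (rule zero_if_finite_nonzero_roots[OF assms(1,2)])
  have "{\<beta> \<in> roots. (\<beta> \<bullet> x) * (\<beta> \<bullet> (- x)) < 0} = {\<beta> \<in> roots. \<beta> \<bullet> x \<noteq> 0}"
    by (auto simp: zero_less_mult_iff) 
  then show "finite {\<beta> \<in> roots. \<beta> \<bullet> x \<noteq> 0}"
    using finite_separating_roots[OF assms(3,4)] by simp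
qed


section \<open>Convex families of cells\<close>

fun sg :: "sign \<Rightarrow> real" where
  "sg Pos = 1"
| "sg Neg = -1"

lemma sg_sg [simp]: "sg \<epsilon> * sg \<epsilon> = 1"
  and sg_nonzero [simp]: "sg \<epsilon> \<noteq> 0"
  and sg_flip [simp]: "sg (flip \<epsilon>) = - sg \<epsilon>"
  by (cases \<epsilon>; simp)+

lemma sg_scale_scale [simp]: "sg \<epsilon> *\<^sub>R sg \<epsilon> *\<^sub>R x = (x :: real ^ 's)"
  by simp

lemma sg_cases: "\<eta> = \<epsilon> \<or> \<eta> = flip \<epsilon>"
  by (cases \<epsilon>; cases \<eta>; simp)

lemma twin_tits_cone_eq: "twin_tits_cone = {sg \<epsilon> *\<^sub>R x | \<epsilon> x. x \<in> tits_cone}"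
proof (intro Set.set_eqI iffI)
  fix p assume "p \<in> twin_tits_cone"
  then consider "p \<in> tits_cone" | x where "x \<in> tits_cone" "p = - x"
    by (auto simp: twin_tits_cone_def)
  then show "p \<in> {sg \<epsilon> *\<^sub>R x | \<epsilon> x. x \<in> tits_cone}"
  proof cases
    case 1
    then show ?thesis by (intro CollectI exI[of _ Pos] exI[of _ p]) simp
  next
    case 2
    then show ?thesis by (intro CollectI exI[of _ Neg] exI[of _ x]) simp
  qed
next
  fix p assume "p \<in> {sg \<epsilon> *\<^sub>R x | \<epsilon> x. x \<in> tits_cone}"
  then obtain \<epsilon> x where "p = sg \<epsilon> *\<^sub>R x" "x \<in> tits_cone" by auto
  then show "p \<in> twin_tits_cone" by (cases \<epsilon>) (auto simp: twin_tits_cone_def)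
qed

text \<open>The sign vector of \<open>x\<close> arises from that of \<open>y\<close> by setting some signs to \<open>0\<close>: the cell of
  \<open>x\<close> is a face of the cell of \<open>y\<close>.\<close>

definition sign_face :: "real ^ 's \<Rightarrow> real ^ 's \<Rightarrow> bool" where
  "sign_face x y \<longleftrightarrow> (\<forall>\<beta>\<in>roots. \<beta> \<bullet> x \<noteq> 0 \<longrightarrow> sgn (\<beta> \<bullet> y) = sgn (\<beta> \<bullet> x))"

lemma sign_face_sign_comp: "sign_comp x y z \<Longrightarrow> sign_face x z"
  by (simp add: sign_comp_def sign_face_def)

lemma sign_face_sign_comp_unique: "sign_comp x y z \<Longrightarrow> sign_comp x y z' \<Longrightarrow> sign_face z z'"
  by (simp add: sign_comp_def sign_face_def)

text \<open>A pair of subcomplexes of the twin apartment is represented by a family \<open>L\<close> of sets of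
  points. Negative cells are listed by their opposites, so that \<open>L Pos\<close> and \<open>L Neg\<close> are both
  unions of cells of the Tits cone; the true position of a point \<open>y\<close> of \<open>L Neg\<close> in the twin Tits
  cone is \<open>- y\<close>. This is why \<open>- y\<close> occurs in the composition of cells of different sign.\<close>

definition realized :: "(sign \<Rightarrow> (real ^ 's) set) \<Rightarrow> (real ^ 's) set" where
  "realized L = {sg \<epsilon> *\<^sub>R x | \<epsilon> x. x \<in> L \<epsilon>}"

definition comp_closed :: "(sign \<Rightarrow> (real ^ 's) set) \<Rightarrow> bool" where
  "comp_closed L \<longleftrightarrow>
    (\<forall>\<epsilon>. \<forall>x\<in>L \<epsilon>. \<forall>y\<in>L \<epsilon>. \<forall>z\<in>tits_cone. sign_comp x y z \<longrightarrow> z \<in> L \<epsilon>) \<and>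
    (\<forall>\<epsilon>. \<forall>x\<in>L \<epsilon>. \<forall>y\<in>L (flip \<epsilon>). \<forall>z\<in>tits_cone.
      finite (zero_roots x) \<longrightarrow> sign_comp x (- y) z \<longrightarrow> z \<in> L \<epsilon>)"

definition cut_out :: "(sign \<Rightarrow> (real ^ 's) set) \<Rightarrow> bool" where
  "cut_out L \<longleftrightarrow> (\<exists>R\<subseteq>roots. \<forall>\<epsilon>. L \<epsilon> = {x \<in> tits_cone. \<forall>\<beta>\<in>R. 0 \<le> sg \<epsilon> * (\<beta> \<bullet> x)})"

definition twin_convex :: "(sign \<Rightarrow> (real ^ 's) set) \<Rightarrow> bool" where
  "twin_convex L \<longleftrightarrow> (\<forall>x\<in>realized L. \<forall>y\<in>realized L.
    closed_segment x y \<inter> twin_tits_cone \<subseteq> realized L)"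

text \<open>Both members are subcomplexes, that is, closed under passing to faces, and contain a
  spherical simplex.\<close>

definition closed_twin_family :: "(sign \<Rightarrow> (real ^ 's) set) \<Rightarrow> bool" where
  "closed_twin_family L \<longleftrightarrow>
    (\<forall>\<epsilon>. L \<epsilon> \<subseteq> tits_cone \<and> (\<forall>x\<in>tits_cone. \<forall>y\<in>L \<epsilon>. sign_face x y \<longrightarrow> x \<in> L \<epsilon>) \<and>
      (\<exists>x\<in>L \<epsilon>. finite (zero_roots x)))"

lemma cut_out_imp_twin_convex:
  assumes "cut_out L"
  shows "twin_convex L"
proof -
  obtain R where R: "R \<subseteq> roots" "\<And>\<epsilon>. L \<epsilon> = {x \<in> tits_cone. \<forall>\<beta>\<in>R. 0 \<le> sg \<epsilon> * (\<beta> \<bullet> x)}"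
    using assms by (auto simp: cut_out_def)
  have eq: "realized L = {p \<in> twin_tits_cone. \<forall>\<beta>\<in>R. 0 \<le> \<beta> \<bullet> p}"
    unfolding realized_def twin_tits_cone_eq R(2) by auto blast
  show ?thesis
    unfolding twin_convex_def
  proof (intro ballI subsetI)
    fix p q z assume p: "p \<in> realized L" "q \<in> realized L" "z \<in> closed_segment p q \<inter> twin_tits_cone"
    then obtain u where u: "0 \<le> u" "u \<le> 1" "z = (1 - u) *\<^sub>R p + u *\<^sub>R q"
      by (auto simp: in_segment)
    have "0 \<le> \<beta> \<bullet> z" if "\<beta> \<in> R" for \<beta>
      using p u that by (simp add: eq inner_add_right)
    then show "z \<in> realized L" using p by (simp add: eq)
  qed
qed

lemma zero_in_closed_family:
  assumes "closed_twin_family L"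
  shows "0 \<in> L \<epsilon>"
proof -
  have "0 \<in> tits_cone" using dual_rep_in_tits_cone[of \<one> 0] by simp
  moreover obtain y where "y \<in> L \<epsilon>" using assms unfolding closed_twin_family_def by blast
  moreover have "sign_face 0 y" by (simp add: sign_face_def)
  ultimately show ?thesis using assms unfolding closed_twin_family_def by blast
qed

text \<open>A point near \<open>x\<close> on a segment that starts at \<open>x\<close> has the composed sign vector. It belongs
  to the part of \<open>L\<close> with the sign of the half of the cone in which it lies, as the halves meet
  only in \<open>0\<close>, which is in both parts.\<close>

lemma twin_convex_imp_comp_closed:
  assumes W: "infinite (carrier W)" "irreducible"
    and L: "closed_twin_family L" and convex: "twin_convex L"
  shows "comp_closed L"
proof -
  have step: "z \<in> L \<epsilon>" if x: "x \<in> L \<epsilon>" and p: "p \<in> realized L"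
    and z: "z \<in> closed_segment x (sg \<epsilon> *\<^sub>R p)" "z \<in> tits_cone" for x p z \<epsilon>
  proof -
    obtain u where u: "0 \<le> u" "u \<le> 1" "z = (1 - u) *\<^sub>R x + u *\<^sub>R sg \<epsilon> *\<^sub>R p"
      using z(1) by (auto simp: in_segment)
    have "sg \<epsilon> *\<^sub>R z = (1 - u) *\<^sub>R sg \<epsilon> *\<^sub>R x + u *\<^sub>R p"
      using u(3) by (cases \<epsilon>) auto
    then have "sg \<epsilon> *\<^sub>R z \<in> closed_segment (sg \<epsilon> *\<^sub>R x) p"
      using u by (auto simp: in_segment)
    moreover have "sg \<epsilon> *\<^sub>R z \<in> twin_tits_cone" using z(2) by (auto simp: twin_tits_cone_eq)
    moreover have "sg \<epsilon> *\<^sub>R x \<in> realized L" using x by (auto simp: realized_def)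
    ultimately have "sg \<epsilon> *\<^sub>R z \<in> realized L" using convex p by (auto simp: twin_convex_def)
    then obtain \<eta> q where q: "sg \<epsilon> *\<^sub>R z = sg \<eta> *\<^sub>R q" "q \<in> L \<eta>" by (auto simp: realized_def)
    show ?thesis
    proof (cases "\<eta> = \<epsilon>")
      case True
      then show ?thesis using q by simp
    next
      case False
      then have "\<eta> = flip \<epsilon>" using sg_cases by blast
      then have "q = - z" using q(1) by (cases \<epsilon>) auto
      moreover have "q \<in> tits_cone" using q(2) L by (auto simp: closed_twin_family_def)
      ultimately have "z = 0" using tits_cone_inter_uminus[OF W z(2)] by simp
      then show ?thesis using zero_in_closed_family[OF L] by simp
    qed
  qed
  have sat: "z' \<in> L \<epsilon>" if "z \<in> L \<epsilon>" "z' \<in> tits_cone" "sign_comp x y z" "sign_comp x y z'" for x y z z' \<epsilon>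
    using L that sign_face_sign_comp_unique[OF that(4,3)] by (auto simp: closed_twin_family_def)
  show ?thesis
    unfolding comp_closed_def
  proof (intro conjI allI ballI impI)
    fix \<epsilon> x y z assume a: "x \<in> L \<epsilon>" "y \<in> L \<epsilon>" "z \<in> tits_cone" "sign_comp x y z"
    then have "x \<in> tits_cone" "y \<in> tits_cone" using L by (auto simp: closed_twin_family_def)
    then obtain z' where z': "z' \<in> tits_cone" "z' \<in> closed_segment x y" "sign_comp x y z'"
      by (rule sign_comp_in_tits_cone)
    have "sg \<epsilon> *\<^sub>R y \<in> realized L" using a by (auto simp: realized_def)
    then have "z' \<in> L \<epsilon>" using step[OF a(1), of "sg \<epsilon> *\<^sub>R y" z'] z' by simp
    then show "z \<in> L \<epsilon>" using sat a z' by blast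
  next
    fix \<epsilon> x y z assume a: "x \<in> L \<epsilon>" "y \<in> L (flip \<epsilon>)" "z \<in> tits_cone" "finite (zero_roots x)"
      "sign_comp x (- y) z"
    then have "x \<in> tits_cone" using L by (auto simp: closed_twin_family_def)
    then obtain z' where z': "z' \<in> tits_cone" "z' \<in> closed_segment x (- y)" "sign_comp x (- y) z'"
      using a(4) by (rule sign_comp_spherical)
    have "sg (flip \<epsilon>) *\<^sub>R y \<in> realized L" using a unfolding realized_def by blast
    then have "z' \<in> L \<epsilon>" using step[OF a(1), of "sg (flip \<epsilon>) *\<^sub>R y" z'] z' by simp
    then show "z \<in> L \<epsilon>" using sat a z' by blast
  qed
qed

lemma sgn_inner_mono_type:
  assumes "\<gamma> \<in> roots" "0 \<le> x" "0 \<le> y" "zero_type y \<subseteq> zero_type x" "\<gamma> \<bullet> x \<noteq> 0"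
  shows "sgn (\<gamma> \<bullet> y) = sgn (\<gamma> \<bullet> x)"
proof -
  have pos: "0 < \<delta> \<bullet> y" if "\<delta> \<in> roots" "0 < \<delta> \<bullet> x" for \<delta>
  proof -
    have d: "0 \<le> \<delta>" using root_inner_pos that assms(2) by blast
    have "\<delta> \<bullet> y \<noteq> 0"
    proof
      assume "\<delta> \<bullet> y = 0"
      then have "\<delta> $ s * y $ s = 0" for s using nonneg_inner_zero d assms(3) by blast
      then have "\<delta> $ s * x $ s = 0" for s using assms(4) by (auto simp: zero_type_def)
      then have "\<delta> \<bullet> x = 0" unfolding inner_vec_def by (intro sum.neutral) simp
      then show False using that by simp
    qed
    then show ?thesis using nonneg_inner[OF d assms(3)] by simp
  qed
  show ?thesis
  proof (cases "0 < \<gamma> \<bullet> x")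
    case True
    then show ?thesis using pos[OF assms(1)] by simp
  next
    case False
    then have "\<gamma> \<bullet> x < 0" using assms(5) by simp
    then show ?thesis using pos[of "- \<gamma>"] assms(1) by simp
  qed
qed

lemma sign_face_mono_type:
  assumes "v \<in> carrier W" "0 \<le> dual_rep (inv v) x" "0 \<le> dual_rep (inv v) y"
    "zero_type (dual_rep (inv v) y) \<subseteq> zero_type (dual_rep (inv v) x)"
  shows "sign_face x y"
  unfolding sign_face_def
proof (intro ballI impI)
  fix \<beta> assume b: "\<beta> \<in> roots" "\<beta> \<bullet> x \<noteq> 0"
  have e: "\<beta> \<bullet> z = refl_rep (inv v) \<beta> \<bullet> dual_rep (inv v) z" for z
    using assms(1) by (simp add: refl_rep_dual_rep_inner)
  show "sgn (\<beta> \<bullet> y) = sgn (\<beta> \<bullet> x)"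
    using b assms unfolding e by (intro sgn_inner_mono_type) auto
qed

text \<open>A root that vanishes on the point \<open>r\<close> of the fundamental cone has zero coordinates
  wherever \<open>r\<close> is positive. If \<open>r\<close> lies on a facet of a face of the fundamental cone then every
  root vanishing on \<open>r\<close> is a multiple of a single coordinate on the span of that face, so all
  walls through the facet that do not contain the face cut this span in the same hyperplane.\<close>

lemma inner_eq_single:
  assumes "\<gamma> \<in> roots" "0 \<le> r" "\<gamma> \<bullet> r = 0" "\<And>t. t \<noteq> s \<Longrightarrow> r $ t = 0 \<Longrightarrow> y $ t = 0"
  shows "\<gamma> \<bullet> y = \<gamma> $ s * y $ s"
proof -
  have "\<gamma> $ t * r $ t = 0" for t
    using root_sign[OF assms(1)] nonneg_inner_zero[of \<gamma> r t] nonneg_inner_zero[of "- \<gamma>" r t] assms by auto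
  then have "\<gamma> $ t * y $ t = 0" if "t \<noteq> s" for t using assms(4)[OF that] by auto
  then have "\<gamma> \<bullet> y = (\<Sum>t\<in>UNIV. if t = s then \<gamma> $ s * y $ s else 0)"
    unfolding inner_vec_def by (intro sum.cong) auto
  then show ?thesis by simp
qed

text \<open>The cells of maximal dimension in \<open>L\<close> have a common support: the intersection of the walls
  that contain \<open>L\<close>, whose roots form the set \<open>Z\<close>. Let \<open>y\<close> be a point that satisfies the
  inequalities \<open>R\<close> valid on \<open>L\<close>, without loss of generality generic in this support, and let \<open>N\<close>
  be a point in a cell of \<open>L\<close> of maximal dimension, separated from \<open>y\<close> by as few walls as
  possible. If \<open>y\<close> is not in the cell of \<open>N\<close> then some facet of this cell, with a point \<open>r\<close>,
  lies on a wall \<open>\<beta>0\<close> that separates \<open>N\<close> from \<open>y\<close>. As \<open>y\<close> satisfies \<open>R\<close>, some point \<open>p\<close> of \<open>L\<close>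
  is on the same side of \<open>\<beta>0\<close> as \<open>y\<close>. The composition of \<open>r\<close> and \<open>p\<close> is the cell of \<open>L\<close> across
  the facet, which is nearer to \<open>y\<close>. This composition is available even if \<open>p\<close> lies in the
  opposite half of the cone, because \<open>r\<close> is spherical: every wall that contains \<open>r\<close> but not the
  support separates \<open>N\<close> from \<open>y\<close>.\<close>

lemma comp_closed_imp_cut_out:
  assumes L: "closed_twin_family L" and closed: "comp_closed L"
  shows "cut_out L"
proof -
  have sub: "L \<epsilon> \<subseteq> tits_cone" for \<epsilon> using L by (auto simp: closed_twin_family_def)
  have faces: "y \<in> L \<epsilon> \<Longrightarrow> x \<in> tits_cone \<Longrightarrow> sign_face x y \<Longrightarrow> x \<in> L \<epsilon>" for x y \<epsilon>
    using L by (auto simp: closed_twin_family_def)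
  have closed1: "x \<in> L \<epsilon> \<Longrightarrow> y \<in> L \<epsilon> \<Longrightarrow> z \<in> tits_cone \<Longrightarrow> sign_comp x y z \<Longrightarrow> z \<in> L \<epsilon>"
    and closed2: "x \<in> L \<epsilon> \<Longrightarrow> y \<in> L (flip \<epsilon>) \<Longrightarrow> z \<in> tits_cone \<Longrightarrow> finite (zero_roots x) \<Longrightarrow>
      sign_comp x (- y) z \<Longrightarrow> z \<in> L \<epsilon>" for x y z \<epsilon>
    using closed unfolding comp_closed_def by blast+
  have comp: "z \<in> L \<epsilon>" if c: "x \<in> L \<epsilon>" "p \<in> realized L" "finite (zero_roots x)" "z \<in> tits_cone"
    "sign_comp x (sg \<epsilon> *\<^sub>R p) z" for x p z \<epsilon>
  proof -
    obtain \<eta> q where q: "p = sg \<eta> *\<^sub>R q" "q \<in> L \<eta>" using c(2) unfolding realized_def by blast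
    from sg_cases[of \<eta> \<epsilon>] show ?thesis
    proof
      assume "\<eta> = \<epsilon>"
      then have "q \<in> L \<epsilon>" "sg \<epsilon> *\<^sub>R p = q" using q by simp_all
      then show ?thesis using closed1[OF c(1) _ c(4)] c(5) by simp
    next
      assume "\<eta> = flip \<epsilon>"
      then have "q \<in> L (flip \<epsilon>)" "sg \<epsilon> *\<^sub>R p = - q" using q by simp_all
      then show ?thesis using closed2[OF c(1) _ c(4) c(3)] c(5) by simp
    qed
  qed
  have in_realized: "sg \<epsilon> *\<^sub>R x \<in> realized L" if "x \<in> L \<epsilon>" for x \<epsilon>
    using that by (auto simp: realized_def)
  have zero_sg: "zero_roots (sg \<epsilon> *\<^sub>R p) = zero_roots p" for \<epsilon> p
    by (auto simp: zero_roots_def)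
  \<comment> \<open>Composing a cell with fewest zero roots with any \<open>p\<close> in \<open>L\<close> cannot remove a zero root.\<close>
  have "\<exists>M\<in>L \<epsilon>. finite (zero_roots M) \<and> (\<forall>p\<in>realized L. zero_roots M \<subseteq> zero_roots p)" for \<epsilon>
  proof -
    define P where "P x \<longleftrightarrow> x \<in> L \<epsilon> \<and> finite (zero_roots x)" for x
    obtain x0 where "P x0" using L unfolding P_def closed_twin_family_def by blast
    then obtain M where "P M" "\<forall>y. P y \<longrightarrow> card (zero_roots M) \<le> card (zero_roots y)"
      using ex_has_least_nat[of P x0 "\<lambda>x. card (zero_roots x)"] by blast
    then have M: "M \<in> L \<epsilon>" "finite (zero_roots M)"
      "\<And>y. y \<in> L \<epsilon> \<Longrightarrow> finite (zero_roots y) \<Longrightarrow> card (zero_roots M) \<le> card (zero_roots y)"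
      by (simp_all add: P_def)
    have "zero_roots M \<subseteq> zero_roots p" if p: "p \<in> realized L" for p
    proof -
      have "M \<in> tits_cone" using M(1) sub by blast
      then obtain z where z: "z \<in> tits_cone" "sign_comp M (sg \<epsilon> *\<^sub>R p) z"
        using M(2) by (rule sign_comp_spherical)
      then have "z \<in> L \<epsilon>" using comp M p by blast
      moreover have zr: "zero_roots z = zero_roots M \<inter> zero_roots p"
        using zero_roots_sign_comp[OF z(2)] zero_sg by simp
      ultimately have "card (zero_roots M) \<le> card (zero_roots M \<inter> zero_roots p)"
        using M(3)[of z] M(2) by simp
      then have "zero_roots M \<inter> zero_roots p = zero_roots M"
        using M(2) by (intro card_seteq) auto
      then show ?thesis by blast
    qed
    then show ?thesis using M by blast
  qed
  then have ex_M: "\<And>\<epsilon>. \<exists>M\<in>L \<epsilon>. finite (zero_roots M) \<and> (\<forall>p\<in>realized L. zero_roots M \<subseteq> zero_roots p)"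
    by blast
  define R where "R = {\<beta> \<in> roots. \<forall>p\<in>realized L. 0 \<le> \<beta> \<bullet> p}"
  have inside: "x0 \<in> L \<epsilon>" if x0: "x0 \<in> tits_cone" "\<And>\<beta>. \<beta> \<in> R \<Longrightarrow> 0 \<le> sg \<epsilon> * (\<beta> \<bullet> x0)" for x0 \<epsilon>
  proof (rule ccontr)
    assume x0L: "x0 \<notin> L \<epsilon>"
    \<comment> \<open>\<open>M\<close> is used to move \<open>x0\<close> to the generic point \<open>y\<close>.\<close>
    obtain M where M: "M \<in> L \<epsilon>" "finite (zero_roots M)"
      "\<And>p. p \<in> realized L \<Longrightarrow> zero_roots M \<subseteq> zero_roots p"
      using ex_M by blast
    define Z where "Z = zero_roots M"
    have Z: "finite Z" "\<And>p. p \<in> realized L \<Longrightarrow> Z \<subseteq> zero_roots p" using M by (auto simp: Z_def)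
    have "Z \<subseteq> zero_roots x0"
    proof
      fix \<beta> assume b: "\<beta> \<in> Z"
      then have br: "\<beta> \<in> roots" by (auto simp: Z_def zero_roots_def)
      have "\<beta> \<bullet> p = 0" if "p \<in> realized L" for p
        using Z(2)[OF that] b by (auto simp: zero_roots_def)
      then have "\<beta> \<in> R" "- \<beta> \<in> R" using br by (auto simp: R_def)
      then have "0 \<le> sg \<epsilon> * (\<beta> \<bullet> x0)" "0 \<le> sg \<epsilon> * ((- \<beta>) \<bullet> x0)" using x0(2) by blast+
      then have "sg \<epsilon> * (\<beta> \<bullet> x0) = 0" by simp
      then show "\<beta> \<in> zero_roots x0" using br by (simp add: zero_roots_def)
    qed
    have "M \<in> tits_cone" using M(1) sub by blast
    with x0(1) obtain y where y: "y \<in> tits_cone" "sign_comp x0 M y"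
      by (rule sign_comp_in_tits_cone)
    have zy: "zero_roots y = Z"
      using zero_roots_sign_comp[OF y(2)] \<open>Z \<subseteq> zero_roots x0\<close> by (auto simp: Z_def)
    have yL: "y \<notin> L \<epsilon>" using faces[OF _ x0(1) sign_face_sign_comp[OF y(2)]] x0L by blast
    have yR: "0 \<le> sg \<epsilon> * (\<beta> \<bullet> y)" if "\<beta> \<in> R" for \<beta>
    proof -
      have "0 \<le> sg \<epsilon> * (\<beta> \<bullet> M)" using that in_realized[OF M(1)] by (auto simp: R_def)
      moreover have "0 \<le> sg \<epsilon> * (\<beta> \<bullet> x0)" using x0(2) that by blast
      moreover have "\<beta> \<in> roots" using that by (simp add: R_def)
      then have "sgn (\<beta> \<bullet> y) = (if \<beta> \<bullet> x0 = 0 then sgn (\<beta> \<bullet> M) else sgn (\<beta> \<bullet> x0))"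
        using y(2) by (auto simp: sign_comp_def)
      ultimately show ?thesis by (cases \<epsilon>) (auto simp: sgn_if split: if_splits)
    qed
    define Sep where "Sep N = {\<beta> \<in> roots. 0 < \<beta> \<bullet> N \<and> \<beta> \<bullet> y < 0}" for N
    have finite_Sep: "finite (Sep N)" if "N \<in> L \<epsilon>" for N
    proof (rule finite_subset[OF _ finite_separating_roots[OF _ y(1)]])
      show "N \<in> tits_cone" using that sub by auto
      show "Sep N \<subseteq> {\<beta> \<in> roots. (\<beta> \<bullet> N) * (\<beta> \<bullet> y) < 0}" by (auto simp: Sep_def mult_pos_neg)
    qed
    define P where "P n \<longleftrightarrow> n \<in> L \<epsilon> \<and> zero_roots n = Z" for n
    have "P M" using M(1) by (simp add: P_def Z_def)
    then obtain N where "P N" "\<forall>n. P n \<longrightarrow> card (Sep N) \<le> card (Sep n)"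
      using ex_has_least_nat[of P M "\<lambda>n. card (Sep n)"] by blast
    then have N: "N \<in> L \<epsilon>" "zero_roots N = Z"
      "\<And>n. n \<in> L \<epsilon> \<Longrightarrow> zero_roots n = Z \<Longrightarrow> card (Sep N) \<le> card (Sep n)"
      by (simp_all add: P_def)
    have "N \<in> tits_cone" using N(1) sub by blast
    then obtain v where v: "v \<in> carrier W" "0 \<le> dual_rep (inv v) N"
      by (rule tits_cone_obtain)
    let ?c = "dual_rep (inv v) N" and ?y = "dual_rep (inv v) y"
    have e: "\<beta> \<bullet> z = refl_rep (inv v) \<beta> \<bullet> dual_rep (inv v) z" for \<beta> z
      using v(1) by (simp add: refl_rep_dual_rep_inner)
    have nth: "dual_rep (inv v) z $ s = refl_rep v (simple s) \<bullet> z" for z s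
      using v(1) by (simp add: dual_rep_nth)
    have wall_in_Z: "refl_rep v (simple s) \<in> Z \<longleftrightarrow> ?c $ s = 0" for s
      using v(1) by (simp add: N(2)[symmetric] zero_roots_def nth)
    have same_type: "?y $ s = 0 \<longleftrightarrow> ?c $ s = 0" for s
      using v(1) wall_in_Z[of s] by (simp add: zy[symmetric] zero_roots_def nth)
    have "\<not> 0 \<le> ?y"
    proof
      assume "0 \<le> ?y"
      then have "sign_face y N"
        using v same_type by (intro sign_face_mono_type[of v]) (auto simp: zero_type_def)
      then show False using faces[OF N(1) y(1)] yL by blast
    qed
    then obtain s where s: "?y $ s < 0" by (auto simp: vec_nonneg_iff not_le)
    then have cs: "0 < ?c $ s" using same_type[of s] v(2) by (simp add: vec_nonneg_iff less_le)
    \<comment> \<open>A point of the facet of the cell of \<open>N\<close> on the wall \<open>s\<close>, moved to the fundamental cone.\<close>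
    define r0 where "r0 = (\<chi> t. if t = s then 0 else ?c $ t)"
    define r where "r = dual_rep v r0"
    have r0: "0 \<le> r0" "r0 $ s = 0" "\<And>t. t \<noteq> s \<Longrightarrow> r0 $ t = ?c $ t"
      using v(2) by (auto simp: r0_def vec_nonneg_iff)
    have vr: "dual_rep (inv v) r = r0" using v(1) by (simp add: r_def)
    have r_face: "sign_face r N"
      using v vr r0 by (intro sign_face_mono_type[of v]) (auto simp: r0_def zero_type_def)
    have "r \<in> tits_cone" unfolding r_def using v(1) r0(1) by (rule dual_rep_in_tits_cone)
    then have rL: "r \<in> L \<epsilon>" using faces[OF N(1) _ r_face] by blast
    \<comment> \<open>On the support of \<open>L\<close>, the roots through the facet are multiples of one coordinate.\<close>
    have single: "\<beta> \<bullet> z = refl_rep (inv v) \<beta> $ s * dual_rep (inv v) z $ s"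
      if "\<beta> \<in> zero_roots r" "Z \<subseteq> zero_roots z" for \<beta> z
    proof -
      have *: "dual_rep (inv v) z $ t = 0" if "t \<noteq> s" "r0 $ t = 0" for t
        using that \<open>Z \<subseteq> zero_roots z\<close> wall_in_Z[of t] r0(3) by (auto simp: zero_roots_def nth)
      then show ?thesis
        using that(1) v(1) r0 unfolding e[of \<beta> z]
        by (intro inner_eq_single[of _ r0]) (auto simp: zero_roots_def e[of \<beta> r] vr)
    qed
    have off_Z: "refl_rep (inv v) \<beta> $ s \<noteq> 0" if "\<beta> \<in> zero_roots r" "\<beta> \<notin> Z" for \<beta>
      using that single[of \<beta> N] N(2) by (auto simp: zero_roots_def)
    have "zero_roots r \<subseteq> Z \<union> {\<beta> \<in> roots. (\<beta> \<bullet> N) * (\<beta> \<bullet> y) < 0}"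
    proof
      fix \<beta> assume b: "\<beta> \<in> zero_roots r"
      show "\<beta> \<in> Z \<union> {\<beta> \<in> roots. (\<beta> \<bullet> N) * (\<beta> \<bullet> y) < 0}"
      proof (cases "\<beta> \<in> Z")
        case False
        let ?g = "refl_rep (inv v) \<beta> $ s"
        have "(\<beta> \<bullet> N) * (\<beta> \<bullet> y) = (?g * ?g) * (?c $ s * ?y $ s)"
          using single[OF b, of N] single[OF b, of y] N(2) zy by simp
        moreover have "0 < ?g * ?g" using off_Z[OF b False] by (auto simp: zero_less_mult_iff)
        ultimately have "(\<beta> \<bullet> N) * (\<beta> \<bullet> y) < 0"
          using cs s by (simp add: mult_pos_neg)
        then show ?thesis using b by (auto simp: zero_roots_def)
      qed simp
    qed
    moreover have "finite {\<beta> \<in> roots. (\<beta> \<bullet> N) * (\<beta> \<bullet> y) < 0}"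
      using finite_separating_roots N(1) sub y(1) by blast
    ultimately have r_fin: "finite (zero_roots r)" using Z(1) by (meson finite_UnI finite_subset)
    define \<beta>0 where "\<beta>0 = refl_rep v (simple s)"
    have b0: "\<beta>0 \<in> roots" "\<beta>0 \<bullet> y < 0" "0 < \<beta>0 \<bullet> N" "\<beta>0 \<bullet> r = 0"
      using v(1) s cs r0(2) by (simp_all add: \<beta>0_def vr flip: nth)
    have "sg \<epsilon> *\<^sub>R \<beta>0 \<notin> R"
    proof
      assume "sg \<epsilon> *\<^sub>R \<beta>0 \<in> R"
      then have "0 \<le> sg \<epsilon> * ((sg \<epsilon> *\<^sub>R \<beta>0) \<bullet> y)" by (rule yR)
      then show False using b0(2) by (cases \<epsilon>) auto
    qed
    moreover have "sg \<epsilon> *\<^sub>R \<beta>0 \<in> roots" using b0(1) by (cases \<epsilon>) auto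
    ultimately obtain p where p: "p \<in> realized L" "(sg \<epsilon> *\<^sub>R \<beta>0) \<bullet> p < 0"
      by (auto simp: R_def not_le)
    define q where "q = sg \<epsilon> *\<^sub>R p"
    have q: "\<beta>0 \<bullet> q < 0" "Z \<subseteq> zero_roots q" using p Z(2) zero_sg by (auto simp: q_def)
    obtain n where n: "n \<in> tits_cone" "sign_comp r q n"
      using \<open>r \<in> tits_cone\<close> r_fin by (rule sign_comp_spherical)
    have nL: "n \<in> L \<epsilon>" using comp[OF rL p(1) r_fin n(1)] n(2) by (simp add: q_def)
    have qs: "dual_rep (inv v) q $ s < 0" using q(1) by (simp add: nth \<beta>0_def)
    have "zero_roots n = Z"
    proof
      show "zero_roots n \<subseteq> Z"
      proof
        fix \<beta> assume "\<beta> \<in> zero_roots n"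
        then have b: "\<beta> \<in> zero_roots r" "\<beta> \<bullet> q = 0"
          using zero_roots_sign_comp[OF n(2)] by (auto simp: zero_roots_def)
        then show "\<beta> \<in> Z" using off_Z[OF b(1)] single[OF b(1) q(2)] qs by auto
      qed
      have "Z \<subseteq> zero_roots r"
        using r_face unfolding N(2)[symmetric] by (auto simp: zero_roots_def sign_face_def) (metis sgn_zero_iff)
      then show "Z \<subseteq> zero_roots n" using q(2) zero_roots_sign_comp[OF n(2)] by auto
    qed
    \<comment> \<open>A root through the facet has the same sign on \<open>n\<close> as on \<open>y\<close>.\<close>
    have sep: "0 < \<beta> \<bullet> r" if "\<beta> \<in> Sep n" for \<beta>
    proof -
      have b: "\<beta> \<in> roots" "0 < \<beta> \<bullet> n" "\<beta> \<bullet> y < 0" using that by (auto simp: Sep_def)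
      have sgn_n: "sgn (\<beta> \<bullet> n) = (if \<beta> \<bullet> r = 0 then sgn (\<beta> \<bullet> q) else sgn (\<beta> \<bullet> r))"
        using n(2) b(1) by (auto simp: sign_comp_def)
      have "\<beta> \<bullet> r \<noteq> 0"
      proof
        assume r: "\<beta> \<bullet> r = 0"
        then have br: "\<beta> \<in> zero_roots r" using b(1) by (simp add: zero_roots_def)
        have "0 < refl_rep (inv v) \<beta> $ s"
          using single[OF br, of y] zy b(3) s by (simp add: mult_less_0_iff)
        then have "\<beta> \<bullet> q < 0" using single[OF br q(2)] qs by (simp add: mult_pos_neg)
        then show False using sgn_n r b(2) by simp
      qed
      then show ?thesis using sgn_n b(2) by (simp add: sgn_if split: if_splits)
    qed
    have "Sep n \<subset> Sep N"
    proof
      show "Sep n \<subseteq> Sep N"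
      proof
        fix \<beta> assume b: "\<beta> \<in> Sep n"
        have "\<beta> \<in> roots" using b by (simp add: Sep_def)
        then have "sgn (\<beta> \<bullet> N) = sgn (\<beta> \<bullet> r)" using r_face sep[OF b] by (simp add: sign_face_def)
        then have "0 < \<beta> \<bullet> N" using sep[OF b] by (simp add: sgn_if split: if_splits)
        then show "\<beta> \<in> Sep N" using b by (simp add: Sep_def)
      qed
      have "\<beta>0 \<in> Sep N" using b0 by (simp add: Sep_def)
      moreover have "\<beta>0 \<notin> Sep n" using sep b0(4) by fastforce
      ultimately show "Sep n \<noteq> Sep N" by blast
    qed
    then have "card (Sep n) < card (Sep N)" using finite_Sep[OF N(1)] by (simp add: psubset_card_mono)
    then show False using N(3)[OF nL \<open>zero_roots n = Z\<close>] by simp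
  qed
  have "0 \<le> sg \<epsilon> * (\<beta> \<bullet> x)" if "x \<in> L \<epsilon>" "\<beta> \<in> R" for x \<epsilon> \<beta>
    using in_realized[OF that(1)] that(2) by (auto simp: R_def)
  then have "L \<epsilon> = {x \<in> tits_cone. \<forall>\<beta>\<in>R. 0 \<le> sg \<epsilon> * (\<beta> \<bullet> x)}" for \<epsilon>
    using sub inside by blast
  moreover have "R \<subseteq> roots" by (auto simp: R_def)
  ultimately show ?thesis unfolding cut_out_def by blast
qed

theorem convexity_equivalence:
  assumes "infinite (carrier W)" "irreducible" "closed_twin_family L"
  shows "comp_closed L \<longleftrightarrow> cut_out L" "cut_out L \<longleftrightarrow> twin_convex L"
  using assms cut_out_imp_twin_convex twin_convex_imp_comp_closed comp_closed_imp_cut_out by blast+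


section \<open>Reduced coset representatives\<close>

lemma refl_rep_expand:
  assumes "w \<in> carrier W"
  shows "refl_rep w v = (\<Sum>t\<in>UNIV. v $ t *\<^sub>R refl_rep w (simple t))"
proof -
  have "v = (\<Sum>t\<in>UNIV. v $ t *\<^sub>R simple t)"
    by (simp add: vec_eq_iff axis_def if_distrib[of "\<lambda>x. _ * x"] cong: if_cong)
  then have "refl_rep w v = refl_rep w (\<Sum>t\<in>UNIV. v $ t *\<^sub>R simple t)" by (rule arg_cong)
  also have "\<dots> = (\<Sum>t\<in>UNIV. v $ t *\<^sub>R refl_rep w (simple t))"
    using assms by (simp add: linear_sum[OF linear_refl_rep] refl_rep_scale)
  finally show ?thesis .
qed

lemma refl_rep_nonneg_comb:
  assumes "w \<in> carrier W" "0 \<le> v" "\<And>t. v $ t \<noteq> 0 \<Longrightarrow> 0 \<le> refl_rep w (simple t)"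
  shows "0 \<le> refl_rep w v"
proof -
  have "0 \<le> v $ t * refl_rep w (simple t) $ r" for t r
    using assms(2) assms(3)[of t] by (cases "v $ t = 0") (simp_all add: vec_nonneg_iff)
  then show ?thesis
    unfolding refl_rep_expand[OF assms(1), of v] by (simp add: vec_nonneg_iff sum_nonneg)
qed

lemma refl_rep_nonpos_comb:
  assumes "w \<in> carrier W" "0 \<le> v" "\<And>t. v $ t \<noteq> 0 \<Longrightarrow> refl_rep w (simple t) \<le> 0"
  shows "refl_rep w v \<le> 0"
proof -
  have "v $ t * refl_rep w (simple t) $ r \<le> 0" for t r
    using assms(2) assms(3)[of t]
    by (cases "v $ t = 0") (simp_all add: vec_nonneg_iff vec_nonpos_iff mult_nonneg_nonpos)
  then show ?thesis
    unfolding refl_rep_expand[OF assms(1), of v] by (simp add: vec_nonpos_iff sum_nonpos)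
qed

lemma refl_rep_parabolic_supp:
  assumes "w \<in> parabolic J" "s \<in> J" "refl_rep w (simple s) $ t \<noteq> 0"
  shows "t \<in> J"
proof (rule ccontr)
  assume "t \<notin> J"
  then have "refl_rep w (simple s) $ t = simple s $ t" using refl_rep_parabolic_nth assms(1) by blast
  moreover have "t \<noteq> s" using assms(2) \<open>t \<notin> J\<close> by auto
  ultimately show False using assms(3) by (simp add: axis_def)
qed

text \<open>If no letter of \<open>K\<close> shortens \<open>w\<close> then \<open>w\<close> keeps every positive root supported on \<open>K\<close>
  positive; so each letter of a reduced word in \<open>K\<close> lengthens the product by one. The same
  argument with \<open>w\<close> inverted and negative roots applies when all letters shorten \<open>w\<close>.\<close>

lemma len_mult_parabolic:
  assumes "w \<in> carrier W" "\<And>t. t \<in> K \<Longrightarrow> 0 \<le> refl_rep w (simple t)" "k \<in> parabolic K"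
  shows "len (w \<otimes> k) = len w + len k"
proof -
  obtain ws where ws: "set ws \<subseteq> K" "word_prod gen ws = k" "length ws = len k"
    using parabolic_reduced_word[OF assms(3)] .
  have "set ws \<subseteq> K \<Longrightarrow> length ws = len (word_prod gen ws) \<Longrightarrow>
    len (w \<otimes> word_prod gen ws) = len w + length ws" for ws
  proof (induction ws rule: rev_induct)
    case (snoc t ws)
    let ?k = "word_prod gen ws"
    have "length ws = len ?k"
      using snoc.prems(2) len_le_length[of ws] len_mult_gen_le[of ?k t] by (simp add: word_prod_append)
    then have IH: "len (w \<otimes> ?k) = len w + length ws" and lt: "len ?k < len (?k \<otimes> gen t)"
      using snoc by (simp_all add: word_prod_append)
    have K: "?k \<in> parabolic K" "t \<in> K" using snoc.prems(1) by (auto intro: word_prod_parabolic)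
    have "0 \<le> refl_rep ?k (simple t)" using root_nonneg_if_longer lt by simp
    then have "0 \<le> refl_rep w (refl_rep ?k (simple t))"
      by (rule refl_rep_nonneg_comb[OF assms(1)]) (use refl_rep_parabolic_supp[OF K] assms(2) in blast)
    then have "len (w \<otimes> ?k) < len (w \<otimes> ?k \<otimes> gen t)"
      using assms(1) by (simp add: len_less_mult_gen_iff refl_rep_mult)
    then have "len (w \<otimes> ?k \<otimes> gen t) = Suc (len (w \<otimes> ?k))"
      using len_mult_gen_cases[of "w \<otimes> ?k" t] assms(1) by auto
    then show ?case using IH assms(1) by (simp add: word_prod_append m_assoc)
  qed (use assms(1) in simp)
  then show ?thesis using ws by auto
qed

lemma len_mult_parabolic_left:
  assumes "w \<in> carrier W" "\<And>s. s \<in> J \<Longrightarrow> 0 \<le> refl_rep (inv w) (simple s)" "j \<in> parabolic J"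
  shows "len (j \<otimes> w) = len j + len w"
proof -
  have j: "j \<in> carrier W" using assms(3) parabolic_closed by blast
  have "len (inv w \<otimes> inv j) = len (inv w) + len (inv j)"
    using assms by (intro len_mult_parabolic[of _ J]) (auto intro: parabolic_inv)
  then show ?thesis using len_inv[of "j \<otimes> w"] assms(1) j by (simp add: inv_mult_group)
qed

lemma len_parabolic_mult_longest:
  assumes "w \<in> carrier W" "\<And>s. s \<in> J \<Longrightarrow> refl_rep (inv w) (simple s) \<le> 0" "j \<in> parabolic J"
  shows "len (j \<otimes> w) + len j = len w"
proof -
  obtain ws where ws: "set ws \<subseteq> J" "word_prod gen ws = j" "length ws = len j"
    using parabolic_reduced_word[OF assms(3)] .
  have "set ws \<subseteq> J \<Longrightarrow> length ws = len (word_prod gen ws) \<Longrightarrow>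
    len (word_prod gen ws \<otimes> w) + length ws = len w" for ws
  proof (induction ws)
    case (Cons s ws)
    let ?j = "word_prod gen ws"
    have "length ws = len ?j"
      using Cons.prems(2) len_le_length[of ws] len_gen_mult_cases[of ?j s] by auto
    then have IH: "len (?j \<otimes> w) + length ws = len w" and lt: "len ?j < len (gen s \<otimes> ?j)"
      using Cons by simp_all
    have J: "?j \<in> parabolic J" "s \<in> J" using Cons.prems(1) by (auto intro: word_prod_parabolic)
    have "0 \<le> refl_rep (inv ?j) (simple s)" using len_less_gen_mult_iff lt by simp
    then have "refl_rep (inv w) (refl_rep (inv ?j) (simple s)) \<le> 0"
      by (rule refl_rep_nonpos_comb[rotated])
        (use refl_rep_parabolic_supp[OF parabolic_inv[OF J(1)] J(2)] assms(1,2) in auto)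
    then have "len (gen s \<otimes> (?j \<otimes> w)) < len (?j \<otimes> w)"
      using assms(1) by (simp add: len_gen_mult_less_iff inv_mult_group refl_rep_mult)
    then have "Suc (len (gen s \<otimes> (?j \<otimes> w))) = len (?j \<otimes> w)"
      using len_gen_mult_cases[of "?j \<otimes> w" s] assms(1) by auto
    then show ?case using IH assms(1) by (simp add: m_assoc)
  qed (use assms(1) in simp)
  then show ?thesis using ws by auto
qed

lemma ex_right_reduced:
  assumes "b \<in> carrier W"
  obtains k where "k \<in> parabolic K" "\<And>t. t \<in> K \<Longrightarrow> 0 \<le> refl_rep (b \<otimes> k) (simple t)"
proof -
  define P where "P k \<longleftrightarrow> k \<in> parabolic K" for k
  have "P \<one>" by (simp add: P_def)
  then obtain k where k: "P k" "\<forall>j. P j \<longrightarrow> len (b \<otimes> k) \<le> len (b \<otimes> j)"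
    using ex_has_least_nat[of P \<one> "\<lambda>k. len (b \<otimes> k)"] by blast
  have kc: "k \<in> carrier W" using k(1) parabolic_closed by (simp add: P_def)
  have "0 \<le> refl_rep (b \<otimes> k) (simple t)" if "t \<in> K" for t
  proof -
    have "P (k \<otimes> gen t)" using k(1) that by (simp add: P_def parabolic_mult parabolic_gen)
    then have "len (b \<otimes> k) \<le> len (b \<otimes> k \<otimes> gen t)" using k(2) assms kc by (simp add: m_assoc)
    then have "len (b \<otimes> k) < len (b \<otimes> k \<otimes> gen t)"
      using len_mult_gen_neq[of "b \<otimes> k" t] assms kc by simp
    then show ?thesis using root_nonneg_if_longer assms kc by simp
  qed
  then show ?thesis using that k(1) by (simp add: P_def)
qed

lemma ex_longest:
  assumes "finite (parabolic I)"
  obtains m where "m \<in> parabolic I" "\<And>s. s \<in> I \<Longrightarrow> refl_rep m (simple s) \<le> 0"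
proof -
  define M where "M = Max (len ` parabolic I)"
  have "M \<in> len ` parabolic I"
    unfolding M_def
  proof (rule Max_in)
    show "len ` parabolic I \<noteq> {}" using parabolic_one[of I] by blast
  qed (use assms in simp)
  then obtain m where m: "m \<in> parabolic I" "len m = M" by auto
  have mc: "m \<in> carrier W" using m(1) parabolic_closed by blast
  have "refl_rep m (simple s) \<le> 0" if "s \<in> I" for s
  proof (rule ccontr)
    assume "\<not> refl_rep m (simple s) \<le> 0"
    then have "0 \<le> refl_rep m (simple s)" using root_sign[of "refl_rep m (simple s)"] mc by auto
    then have "len m < len (m \<otimes> gen s)" using len_less_mult_gen_iff[OF mc] by simp
    moreover have "m \<otimes> gen s \<in> parabolic I" using m(1) that by (intro parabolic_mult parabolic_gen)
    then have "len (m \<otimes> gen s) \<le> M" unfolding M_def using assms by (intro Max_ge) auto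
    ultimately show False using m(2) by simp
  qed
  then show ?thesis using that m(1) by blast
qed

text \<open>If \<open>w\<^sup>-\<^sup>1\<close> made \<open>e\<^sub>s\<close> negative, the resulting root would vanish on \<open>y\<close>, hence be supported
  on the zero coordinates of \<open>y\<close>, where \<open>w\<close> preserves signs.\<close>

lemma left_nonneg_if_right_reduced:
  assumes "w \<in> carrier W" "0 \<le> y" "\<And>t. t \<in> zero_type y \<Longrightarrow> 0 \<le> refl_rep w (simple t)"
    "0 \<le> dual_rep w y $ s"
  shows "0 \<le> refl_rep (inv w) (simple s)"
proof (rule ccontr)
  let ?g = "refl_rep (inv w) (simple s)"
  have g: "?g \<in> roots" using assms(1) by simp
  assume "\<not> 0 \<le> ?g"
  then have neg: "?g \<le> 0" using g root_neg_iff by blast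
  then have "?g \<bullet> y \<le> 0" using assms(2) nonpos_inner by blast
  moreover have "0 \<le> ?g \<bullet> y" using assms(1,4) by (simp add: dual_rep_nth)
  ultimately have g0: "(- ?g) \<bullet> y = 0" by simp
  have "0 \<le> refl_rep w (- ?g)"
  proof (rule refl_rep_nonneg_comb[OF assms(1)])
    show "0 \<le> - ?g" using neg by simp
    fix t assume "(- ?g) $ t \<noteq> 0"
    then have "y $ t = 0" using nonneg_inner_zero[of "- ?g" y t] neg assms(2) g0 by simp
    then show "0 \<le> refl_rep w (simple t)" using assms(3) by (simp add: zero_type_def)
  qed
  then have "simple s \<le> 0" using assms(1) by (simp add: refl_rep_uminus)
  then show False using root_not_both[of "simple s"] by simp
qed

lemma parabolic_subset_iff: "parabolic I \<subseteq> parabolic J \<longleftrightarrow> I \<subseteq> J"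
proof
  assume sub: "parabolic I \<subseteq> parabolic J"
  show "I \<subseteq> J"
  proof
    fix s assume "s \<in> I"
    then have "gen s \<in> parabolic J" using sub parabolic_gen by blast
    then have "dual_rep (gen s) (base_point J) = base_point J"
      by (rule parabolic_fixes) simp
    then have "dual_rep (gen s) (base_point J) $ s = base_point J $ s" by simp
    then have "base_point J $ s = 0" by simp
    then show "s \<in> J" by (auto simp: base_point_def split: if_splits)
  qed
next
  assume "I \<subseteq> J"
  then show "parabolic I \<subseteq> parabolic J" unfolding parabolic_def by (intro mono_generate) auto
qed

lemma parabolic_inj: "parabolic I = parabolic J \<Longrightarrow> I = J"
  using parabolic_subset_iff[of I J] parabolic_subset_iff[of J I] by auto

section \<open>Buildings\<close>

context
  fixes X :: "'c set" and d :: "'c \<Rightarrow> 'c \<Rightarrow> 'w"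
  assumes bld: "building X d"
begin

lemma dist_closed: "C \<in> X \<Longrightarrow> D \<in> X \<Longrightarrow> d C D \<in> carrier W"
  using bld unfolding building_def by blast

lemma dist_one_iff: "C \<in> X \<Longrightarrow> D \<in> X \<Longrightarrow> d C D = \<one> \<longleftrightarrow> C = D"
  using bld unfolding building_def by blast

lemma dist_step:
  assumes "C \<in> X" "D \<in> X" "C' \<in> X" "d C' C = gen s"
  shows "d C' D = gen s \<otimes> d C D \<or> d C' D = d C D"
proof -
  have "d C' D \<in> {gen s \<otimes> d C D, d C D}" using bld assms unfolding building_def by blast
  then show ?thesis by simp
qed

lemma dist_step_up:
  assumes "C \<in> X" "D \<in> X" "C' \<in> X" "d C' C = gen s" "len (gen s \<otimes> d C D) = Suc (len (d C D))"
  shows "d C' D = gen s \<otimes> d C D"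
proof -
  have "len (gen s \<otimes> d C D) = len (d C D) + 1" using assms(5) by simp
  then show ?thesis using bld assms(1-4) unfolding building_def by blast
qed

lemma dist_exists: "C \<in> X \<Longrightarrow> D \<in> X \<Longrightarrow> \<exists>C'\<in>X. d C' C = gen s \<and> d C' D = gen s \<otimes> d C D"
  using bld unfolding building_def by blast

lemma dist_gen_sym:
  assumes "C \<in> X" "C' \<in> X" "d C' C = gen s"
  shows "d C C' = gen s"
proof -
  have "d C C' \<noteq> \<one>" using assms dist_one_iff[of C C'] dist_one_iff[of C' C] gen_nontrivial by auto
  then have "gen s \<otimes> d C C' = \<one>"
    using dist_step[OF assms(1) assms(2) assms(2) assms(3)] dist_one_iff[of C' C'] assms(2) by auto
  then have "gen s \<otimes> (gen s \<otimes> d C C') = gen s" by simp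
  then show ?thesis using dist_closed assms by simp
qed

lemma gallery_induct:
  assumes "C \<in> X" "D \<in> X" "d C D = word_prod gen ws"
    and base: "P [] D"
    and step: "\<And>s us B B'. B \<in> X \<Longrightarrow> B' \<in> X \<Longrightarrow> d B B' = gen s \<Longrightarrow> d B' B = gen s \<Longrightarrow>
      P us B' \<Longrightarrow> P (s # us) B"
  shows "P ws C"
  using assms(1,3)
proof (induction ws arbitrary: C)
  case Nil
  then show ?case using base dist_one_iff assms(2) by auto
next
  case (Cons s ws)
  obtain C' where C': "C' \<in> X" "d C' C = gen s" "d C' D = gen s \<otimes> d C D"
    using dist_exists[OF Cons.prems(1) assms(2)] by blast
  then have "d C' D = word_prod gen ws" using Cons.prems by simp
  then show ?case using Cons.IH C' dist_gen_sym[OF Cons.prems(1) C'(1,2)] step Cons.prems(1) by blast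
qed

text \<open>A gallery from \<open>C\<close> to \<open>D\<close> is traversed while watching the distance to \<open>E\<close>. If the final
  length is as large as possible then it increases in every step, where the axioms determine the
  new distance. For \<open>E = C\<close> this shows that the distance from \<open>D\<close> to \<open>C\<close> is the inverse one.\<close>

lemma dist_transport:
  assumes "C \<in> X" "D \<in> X" "E \<in> X" "d C D = word_prod gen ws"
    "len (inv (word_prod gen ws) \<otimes> d C E) = length ws + len (d C E)"
  shows "d D E = inv (word_prod gen ws) \<otimes> d C E"
proof -
  have "len (inv (word_prod gen ws) \<otimes> d C E) = length ws + len (d C E) \<longrightarrow>
    d D E = inv (word_prod gen ws) \<otimes> d C E"
    using assms(1,2,4)
  proof (rule gallery_induct)
    show "len (inv (word_prod gen []) \<otimes> d D E) = length [] + len (d D E) \<longrightarrow>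
      d D E = inv (word_prod gen []) \<otimes> d D E"
      using dist_closed assms by simp
  next
    fix s us B B'
    assume B: "B \<in> X" "B' \<in> X" "d B' B = gen s"
      and IH: "len (inv (word_prod gen us) \<otimes> d B' E) = length us + len (d B' E) \<longrightarrow>
        d D E = inv (word_prod gen us) \<otimes> d B' E"
    show "len (inv (word_prod gen (s # us)) \<otimes> d B E) = length (s # us) + len (d B E) \<longrightarrow>
        d D E = inv (word_prod gen (s # us)) \<otimes> d B E"
    proof
      let ?u = "inv (word_prod gen us)"
      have c: "d B E \<in> carrier W" using dist_closed B assms by blast
      have eq: "inv (word_prod gen (s # us)) \<otimes> d B E = ?u \<otimes> (gen s \<otimes> d B E)"
        using c by (simp add: inv_mult_group m_assoc)
      assume "len (inv (word_prod gen (s # us)) \<otimes> d B E) = length (s # us) + len (d B E)"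
      then have l: "len (?u \<otimes> (gen s \<otimes> d B E)) = Suc (length us + len (d B E))"
        unfolding eq by simp
      have "len (?u \<otimes> (gen s \<otimes> d B E)) \<le> length us + len (gen s \<otimes> d B E)"
        using len_mult_le[of ?u "gen s \<otimes> d B E"] len_le_length[of us] c by simp
      then have up: "len (gen s \<otimes> d B E) = Suc (len (d B E))"
        using l len_gen_mult_cases[OF c, of s] by auto
      then have "d B' E = gen s \<otimes> d B E" using dist_step_up[of B E B' s] B assms by blast
      then show "d D E = inv (word_prod gen (s # us)) \<otimes> d B E" using IH l up unfolding eq by simp
    qed
  qed
  then show ?thesis using assms(5) by blast
qed

lemma dist_sym:
  assumes "C \<in> X" "D \<in> X"
  shows "d D C = inv (d C D)"
proof -
  obtain ws where ws: "word_prod gen ws = d C D" "length ws = len (d C D)"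
    using reduced_word[OF dist_closed[OF assms]] .
  have "d C C = \<one>" using dist_one_iff assms by blast
  then show ?thesis
    using dist_transport[of C D C ws] ws assms dist_closed by simp
qed

lemma dist_add:
  assumes "C \<in> X" "D \<in> X" "E \<in> X" "len (d C D \<otimes> d D E) = len (d C D) + len (d D E)"
  shows "d C E = d C D \<otimes> d D E"
proof -
  have c: "d C D \<in> carrier W" using dist_closed assms by blast
  have "d D C \<in> carrier W" using dist_closed assms by blast
  then obtain ws where ws: "word_prod gen ws = d D C" "length ws = len (d D C)"
    by (rule reduced_word)
  have "inv (d D C) = d C D" using dist_sym[OF assms(2,1)] by simp
  moreover have "len (d D C) = len (d C D)" using dist_sym[OF assms(1,2)] c by simp
  ultimately show ?thesis using dist_transport[of D C E ws] ws assms by simp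
qed

lemma dist_exists_any:
  assumes "C \<in> X" "w \<in> carrier W"
  shows "\<exists>D\<in>X. d C D = w"
proof -
  have "\<exists>D\<in>X. d D C = word_prod gen ws" for ws
  proof (induction ws)
    case Nil
    then show ?case using assms dist_one_iff by auto
  next
    case (Cons s ws)
    then obtain D where "D \<in> X" "d D C = word_prod gen ws" by blast
    then show ?case using dist_exists[of D C s] assms by auto
  qed
  moreover obtain ws where "word_prod gen ws = inv w" using generated[of "inv w"] assms by auto
  ultimately obtain D where "D \<in> X" "d D C = inv w" by metis
  then show ?thesis using dist_sym[of D C] assms by auto
qed

lemma gallery_parabolic:
  assumes "C \<in> X" "D \<in> X" "d C D \<in> parabolic J" and f: "f D \<in> carrier W"
    and step: "\<And>B B' s. B \<in> X \<Longrightarrow> B' \<in> X \<Longrightarrow> d B B' = gen s \<Longrightarrow>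
      f B = gen s \<otimes> f B' \<or> f B = f B'"
  shows "\<exists>u\<in>parabolic J. f C = u \<otimes> f D"
proof -
  obtain ws where ws: "set ws \<subseteq> J" "word_prod gen ws = d C D"
    using assms(3) by (auto simp: parabolic_iff)
  have "set ws \<subseteq> J \<longrightarrow> (\<exists>u\<in>parabolic J. f C = u \<otimes> f D)"
    using assms(1,2) ws(2)[symmetric]
  proof (rule gallery_induct)
    show "set [] \<subseteq> J \<longrightarrow> (\<exists>u\<in>parabolic J. f D = u \<otimes> f D)"
      using f by (intro impI bexI[of _ \<one>]) simp_all
  next
    fix s us B B'
    assume B: "B \<in> X" "B' \<in> X" "d B B' = gen s"
      and IH: "set us \<subseteq> J \<longrightarrow> (\<exists>u\<in>parabolic J. f B' = u \<otimes> f D)"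
    show "set (s # us) \<subseteq> J \<longrightarrow> (\<exists>u\<in>parabolic J. f B = u \<otimes> f D)"
    proof
      assume J: "set (s # us) \<subseteq> J"
      then obtain u where u: "u \<in> parabolic J" "f B' = u \<otimes> f D" using IH by auto
      from step[OF B] show "\<exists>u\<in>parabolic J. f B = u \<otimes> f D"
      proof
        assume "f B = gen s \<otimes> f B'"
        then have "f B = (gen s \<otimes> u) \<otimes> f D" using u f parabolic_closed[OF u(1)] by (simp add: m_assoc)
        moreover have "gen s \<otimes> u \<in> parabolic J" using u J by (auto intro: parabolic_mult parabolic_gen)
        ultimately show ?thesis by blast
      qed (use u in auto)
    qed
  qed
  then show ?thesis using ws(1) by blast
qed

lemma dist_parabolic_left:
  assumes "C \<in> X" "D \<in> X" "E \<in> X" "d C D \<in> parabolic J"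
  shows "\<exists>u\<in>parabolic J. d C E = u \<otimes> d D E"
  using assms(1,2,4)
proof (rule gallery_parabolic)
  show "d B E = gen s \<otimes> d B' E \<or> d B E = d B' E" if "B \<in> X" "B' \<in> X" "d B B' = gen s" for B B' s
    using dist_step[OF that(2) assms(3) that(1,3)] .
qed (use dist_closed assms in blast)

lemma dist_parabolic_trans:
  assumes "C \<in> X" "D \<in> X" "E \<in> X" "d C D \<in> parabolic J" "d D E \<in> parabolic J"
  shows "d C E \<in> parabolic J"
  using dist_parabolic_left[OF assms(1-4)] assms(5) parabolic_mult by auto

lemma dist_parabolic_sym:
  assumes "C \<in> X" "D \<in> X" "d C D \<in> parabolic J"
  shows "d D C \<in> parabolic J"
  using dist_sym[OF assms(1,2)] parabolic_inv assms(3) by simp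

end

end

section \<open>Twin buildings\<close>

lemma flip_flip [simp]: "flip (flip \<epsilon>) = \<epsilon>"
  by (cases \<epsilon>) simp_all

context twin_building
begin

lemmas dist_closed' = dist_closed[OF building]
  and dist_one_iff' = dist_one_iff[OF building]
  and dist_sym' = dist_sym[OF building]
  and dist_parabolic_trans' = dist_parabolic_trans[OF building]
  and dist_parabolic_sym' = dist_parabolic_sym[OF building]

lemma dist_self [simp]: "C \<in> Ch \<epsilon> \<Longrightarrow> \<delta> \<epsilon> C C = \<one>"
  using dist_one_iff' by blast

lemma cod_flip: "C \<in> Ch \<epsilon> \<Longrightarrow> D \<in> Ch (flip \<epsilon>) \<Longrightarrow> cod \<epsilon> C D = inv (cod (flip \<epsilon>) D C)"
  using cod_inv cod_closed by simp

text \<open>If \<open>s\<close> does not shorten the codistance then \<open>C'\<close> either is the chamber provided by the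
  existence axiom or is \<open>s\<close>-adjacent to it; in the second case the codistance is shortened
  again.\<close>

lemma cod_step:
  assumes "C \<in> Ch \<epsilon>" "C' \<in> Ch \<epsilon>" "D \<in> Ch (flip \<epsilon>)" "\<delta> \<epsilon> C' C = gen s"
  shows "cod \<epsilon> C' D = gen s \<otimes> cod \<epsilon> C D \<or> cod \<epsilon> C' D = cod \<epsilon> C D"
proof (cases "len (gen s \<otimes> cod \<epsilon> C D) < len (cod \<epsilon> C D)")
  case True
  then show ?thesis using cod_reduce assms by blast
next
  case False
  have c: "cod \<epsilon> C D \<in> carrier W" using cod_closed assms by blast
  obtain E where E: "E \<in> Ch \<epsilon>" "\<delta> \<epsilon> E C = gen s" "cod \<epsilon> E D = gen s \<otimes> cod \<epsilon> C D"
    using cod_exists[OF assms(1,3)] by blast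
  have "\<delta> \<epsilon> C E = gen s" using dist_gen_sym[OF building] E assms by blast
  then have "\<delta> \<epsilon> C' E = \<one> \<or> \<delta> \<epsilon> C' E = gen s"
    using dist_step[OF building, of C \<epsilon> E C' s] assms E by auto
  then show ?thesis
  proof
    assume "\<delta> \<epsilon> C' E = \<one>"
    then have "C' = E" using dist_one_iff' assms E by blast
    then show ?thesis using E by simp
  next
    assume ce: "\<delta> \<epsilon> C' E = gen s"
    have "len (gen s \<otimes> cod \<epsilon> E D) < len (cod \<epsilon> E D)"
      using E c False len_gen_mult_cases[OF c, of s] by auto
    then have "cod \<epsilon> C' D = gen s \<otimes> cod \<epsilon> E D"
      using cod_reduce[OF E(1) assms(3) assms(2) ce] by blast
    then show ?thesis using E c by simp
  qed
qed

lemma cod_parabolic_left: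
  assumes "C \<in> Ch \<epsilon>" "D \<in> Ch \<epsilon>" "E \<in> Ch (flip \<epsilon>)" "\<delta> \<epsilon> C D \<in> parabolic J"
  shows "\<exists>u\<in>parabolic J. cod \<epsilon> C E = u \<otimes> cod \<epsilon> D E"
  using building assms(1,2,4)
proof (rule gallery_parabolic)
  show "cod \<epsilon> B E = gen s \<otimes> cod \<epsilon> B' E \<or> cod \<epsilon> B E = cod \<epsilon> B' E"
    if "B \<in> Ch \<epsilon>" "B' \<in> Ch \<epsilon>" "\<delta> \<epsilon> B B' = gen s" for B B' s
    using cod_step[OF that(2,1) assms(3) that(3)] .
qed (use cod_closed assms in blast)

lemma cod_parabolic_right:
  assumes "C \<in> Ch \<epsilon>" "D \<in> Ch (flip \<epsilon>)" "E \<in> Ch (flip \<epsilon>)" "\<delta> (flip \<epsilon>) D E \<in> parabolic K"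
  shows "\<exists>k\<in>parabolic K. cod \<epsilon> C E = cod \<epsilon> C D \<otimes> k"
proof -
  have "\<delta> (flip \<epsilon>) E D \<in> parabolic K" using dist_parabolic_sym' assms by blast
  then obtain u where u: "u \<in> parabolic K" "cod (flip \<epsilon>) E C = u \<otimes> cod (flip \<epsilon>) D C"
    using cod_parabolic_left[of E "flip \<epsilon>" D C K] assms by auto
  have "u \<in> carrier W" "cod (flip \<epsilon>) D C \<in> carrier W"
    using u parabolic_closed cod_closed[of D "flip \<epsilon>" C] assms by auto
  then have "cod \<epsilon> C E = cod \<epsilon> C D \<otimes> inv u"
    using u cod_flip[of C \<epsilon>] assms by (simp add: inv_mult_group)
  then show ?thesis using u(1) parabolic_inv by blast
qed

text \<open>Along a gallery each of whose letters shortens the codistance, the axioms determine it.\<close>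

lemma cod_descend:
  assumes "G \<in> Ch \<epsilon>" "G' \<in> Ch \<epsilon>" "E \<in> Ch (flip \<epsilon>)"
    "len (\<delta> \<epsilon> G' G \<otimes> cod \<epsilon> G E) + len (\<delta> \<epsilon> G' G) = len (cod \<epsilon> G E)"
  shows "cod \<epsilon> G' E = \<delta> \<epsilon> G' G \<otimes> cod \<epsilon> G E"
proof -
  let ?w = "cod \<epsilon> G E"
  have w: "?w \<in> carrier W" using cod_closed assms by blast
  have "\<delta> \<epsilon> G' G \<in> carrier W" using dist_closed' assms by blast
  then obtain ws where ws: "word_prod gen ws = \<delta> \<epsilon> G' G" "length ws = len (\<delta> \<epsilon> G' G)"
    by (rule reduced_word)
  have "len (word_prod gen ws \<otimes> ?w) + length ws = len ?w \<longrightarrow> cod \<epsilon> G' E = word_prod gen ws \<otimes> ?w"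
    using building assms(2,1) ws(1)[symmetric]
  proof (rule gallery_induct)
    show "len (word_prod gen [] \<otimes> ?w) + length [] = len ?w \<longrightarrow> cod \<epsilon> G E = word_prod gen [] \<otimes> ?w"
      using w by simp
  next
    fix s us B B'
    let ?u = "word_prod gen us"
    assume B: "B \<in> Ch \<epsilon>" "B' \<in> Ch \<epsilon>" "\<delta> \<epsilon> B B' = gen s"
      and IH: "len (?u \<otimes> ?w) + length us = len ?w \<longrightarrow> cod \<epsilon> B' E = ?u \<otimes> ?w"
    show "len (word_prod gen (s # us) \<otimes> ?w) + length (s # us) = len ?w \<longrightarrow>
      cod \<epsilon> B E = word_prod gen (s # us) \<otimes> ?w"
    proof
      have eq: "word_prod gen (s # us) \<otimes> ?w = gen s \<otimes> (?u \<otimes> ?w)" using w by (simp add: m_assoc)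
      assume "len (word_prod gen (s # us) \<otimes> ?w) + length (s # us) = len ?w"
      then have l: "len (gen s \<otimes> (?u \<otimes> ?w)) + Suc (length us) = len ?w"
        unfolding eq by simp
      have "len (inv ?u \<otimes> (?u \<otimes> ?w)) \<le> len (inv ?u) + len (?u \<otimes> ?w)"
        using w by (intro len_mult_le) auto
      moreover have "inv ?u \<otimes> (?u \<otimes> ?w) = ?w" using w by (simp flip: m_assoc)
      ultimately have "len ?w \<le> length us + len (?u \<otimes> ?w)" using len_le_length[of us] by simp
      then have "len (gen s \<otimes> (?u \<otimes> ?w)) < len (?u \<otimes> ?w)" and "len (?u \<otimes> ?w) + length us = len ?w"
        using l len_gen_mult_cases[of "?u \<otimes> ?w" s] w by auto
      then show "cod \<epsilon> B E = word_prod gen (s # us) \<otimes> ?w"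
        using cod_reduce[OF B(2) assms(3) B(1) B(3)] IH unfolding eq by simp
    qed
  qed
  then show ?thesis using ws assms(4) by simp
qed

subsection \<open>Residues\<close>

lemma residue_self: "C \<in> Ch \<epsilon> \<Longrightarrow> C \<in> residue \<epsilon> J C"
  by (simp add: residue_def)

lemma residue_eq:
  assumes "C \<in> Ch \<epsilon>" "D \<in> residue \<epsilon> J C"
  shows "residue \<epsilon> J D = residue \<epsilon> J C"
proof -
  have D: "D \<in> Ch \<epsilon>" "\<delta> \<epsilon> C D \<in> parabolic J" using assms by (auto simp: residue_def)
  then have "\<delta> \<epsilon> D C \<in> parabolic J" using dist_parabolic_sym' assms by blast
  then show ?thesis using D assms(1) dist_parabolic_trans' unfolding residue_def by blast
qed

lemma residue_type:
  assumes "C \<in> Ch \<epsilon>" "C' \<in> Ch \<epsilon>" "residue \<epsilon> J C = residue \<epsilon> J' C'"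
  shows "J = J'"
proof -
  have dist_image: "\<delta> \<epsilon> D ` residue \<epsilon> I D = parabolic I" if "D \<in> Ch \<epsilon>" for D I
  proof
    show "parabolic I \<subseteq> \<delta> \<epsilon> D ` residue \<epsilon> I D"
    proof
      fix w assume w: "w \<in> parabolic I"
      then obtain E where "E \<in> Ch \<epsilon>" "\<delta> \<epsilon> D E = w"
        using dist_exists_any[OF building \<open>D \<in> Ch \<epsilon>\<close>] parabolic_closed by blast
      then show "w \<in> \<delta> \<epsilon> D ` residue \<epsilon> I D" using w by (auto simp: residue_def)
    qed
  qed (auto simp: residue_def)
  have "C \<in> residue \<epsilon> J' C'" using residue_self[OF assms(1), of J] assms(3) by simp
  then have "residue \<epsilon> J' C = residue \<epsilon> J C" using residue_eq[OF assms(2)] assms(3) by simp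
  then have "parabolic J = parabolic J'"
    using dist_image[OF assms(1), of J] dist_image[OF assms(1), of J'] by simp
  then show ?thesis by (rule parabolic_inj)
qed


end

section \<open>Half-spaces and chambers of points\<close>

context coxeter_system
begin

lemma nonneg_if_sgn_eq: "sgn a = sgn b \<Longrightarrow> 0 \<le> a \<Longrightarrow> 0 \<le> (b :: real)"
  by (auto simp: sgn_if split: if_splits)

lemma sgn_inner_same_type:
  assumes "\<gamma> \<in> roots" "0 \<le> x" "0 \<le> y" "zero_type y = zero_type x"
  shows "sgn (\<gamma> \<bullet> y) = sgn (\<gamma> \<bullet> x)"
proof (cases "\<gamma> \<bullet> x = 0")
  case True
  have "\<gamma> \<bullet> y = 0"
  proof (rule ccontr)
    assume "\<gamma> \<bullet> y \<noteq> 0"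
    then have "sgn (\<gamma> \<bullet> x) = sgn (\<gamma> \<bullet> y)"
      using assms by (intro sgn_inner_mono_type) auto
    then show False using True \<open>\<gamma> \<bullet> y \<noteq> 0\<close> by (simp add: sgn_zero_iff)
  qed
  then show ?thesis using True by simp
next
  case False
  then show ?thesis using assms by (intro sgn_inner_mono_type) auto
qed

text \<open>The chambers \<open>vC\<close> on the positive side of the wall of \<open>\<beta>\<close>.\<close>

definition half :: "real ^ 's \<Rightarrow> 'w set" where
  "half \<beta> = {v \<in> carrier W. 0 \<le> refl_rep (inv v) \<beta>}"

lemma half_subset: "half \<beta> \<subseteq> carrier W"
  by (auto simp: half_def)

lemma half_uminus:
  assumes "\<beta> \<in> roots"
  shows "half (- \<beta>) = carrier W - half \<beta>"
proof -
  have "0 \<le> refl_rep (inv v) (- \<beta>) \<longleftrightarrow> \<not> 0 \<le> refl_rep (inv v) \<beta>" if "v \<in> carrier W" for v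
    using root_neg_iff[of "refl_rep (inv v) \<beta>"] assms that by (simp add: refl_rep_uminus)
  then show ?thesis by (auto simp: half_def)
qed

text \<open>The chambers containing a point form a coset of its stabilizer, a parabolic subgroup.\<close>

lemma chm_eq_coset:
  assumes "v \<in> chm x"
  shows "w \<in> chm x \<longleftrightarrow> w \<in> carrier W \<and> inv v \<otimes> w \<in> parabolic (zero_type (dual_rep (inv v) x))"
proof
  have v: "v \<in> carrier W" "0 \<le> dual_rep (inv v) x" using assms by (auto simp: chm_def)
  let ?c = "dual_rep (inv v) x"
  show "w \<in> carrier W \<and> inv v \<otimes> w \<in> parabolic (zero_type ?c)" if "w \<in> chm x"
  proof -
    have w: "w \<in> carrier W" "0 \<le> dual_rep (inv w) x" using that by (auto simp: chm_def)
    have "0 \<le> dual_rep (inv w \<otimes> v) ?c" using v w by (simp add: dual_rep_mult)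
    then have "inv w \<otimes> v \<in> parabolic (zero_type ?c)"
      using v w by (intro parabolic_if_nonneg) auto
    then have "inv (inv w \<otimes> v) \<in> parabolic (zero_type ?c)" by (rule parabolic_inv)
    then show ?thesis using v w by (simp add: inv_mult_group)
  qed
  assume a: "w \<in> carrier W \<and> inv v \<otimes> w \<in> parabolic (zero_type ?c)"
  then have "dual_rep (inv (inv v \<otimes> w)) ?c = ?c"
    by (intro parabolic_fixes[OF parabolic_inv]) auto
  then have "dual_rep (inv w) x = ?c" using a v by (simp add: inv_mult_group dual_rep_mult)
  then show "w \<in> chm x" using a v by (simp add: chm_def)
qed

lemma chm_same_point:
  assumes "v \<in> chm x" "w \<in> chm x"
  shows "dual_rep (inv w) x = dual_rep (inv v) x"
proof -
  have v: "v \<in> carrier W" "w \<in> carrier W" using assms by (auto simp: chm_def)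
  have "inv v \<otimes> w \<in> parabolic (zero_type (dual_rep (inv v) x))" using chm_eq_coset assms by blast
  then have "dual_rep (inv (inv v \<otimes> w)) (dual_rep (inv v) x) = dual_rep (inv v) x"
    by (intro parabolic_fixes[OF parabolic_inv]) auto
  then show ?thesis using v by (simp add: inv_mult_group dual_rep_mult)
qed

lemma chm_mult_parabolic:
  assumes "v \<in> chm x" "u \<in> parabolic (zero_type (dual_rep (inv v) x))"
  shows "v \<otimes> u \<in> chm x"
proof -
  have "v \<in> carrier W" "u \<in> carrier W" using assms parabolic_closed by (auto simp: chm_def)
  then show ?thesis using chm_eq_coset[OF assms(1), of "v \<otimes> u"] assms(2) by (simp flip: m_assoc)
qed

text \<open>A reflection fixing \<open>x\<close> exchanges the two sides of its wall, so a wall through \<open>x\<close> has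
  chambers containing \<open>x\<close> on both sides.\<close>

lemma half_meets_chm:
  assumes "x \<in> tits_cone" "\<beta> \<in> roots"
  shows "half \<beta> \<inter> chm x \<noteq> {} \<longleftrightarrow> 0 \<le> \<beta> \<bullet> x"
proof
  assume "half \<beta> \<inter> chm x \<noteq> {}"
  then obtain v where "v \<in> carrier W" "0 \<le> refl_rep (inv v) \<beta>" "0 \<le> dual_rep (inv v) x"
    by (auto simp: half_def chm_def)
  then show "0 \<le> \<beta> \<bullet> x"
    using nonneg_inner[of "refl_rep (inv v) \<beta>" "dual_rep (inv v) x"] by (simp add: refl_rep_dual_rep_inner)
next
  assume nn: "0 \<le> \<beta> \<bullet> x"
  obtain v where v: "v \<in> chm x" "v \<in> carrier W" "0 \<le> dual_rep (inv v) x"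
    using tits_cone_obtain[OF assms(1)] .
  show "half \<beta> \<inter> chm x \<noteq> {}"
  proof (cases "0 \<le> refl_rep (inv v) \<beta>")
    case True
    then show ?thesis using v by (auto simp: half_def)
  next
    case False
    then have neg: "refl_rep (inv v) \<beta> \<le> 0" using v assms root_neg_iff by simp
    have "\<beta> \<bullet> x = refl_rep (inv v) \<beta> \<bullet> dual_rep (inv v) x" using v by (simp add: refl_rep_dual_rep_inner)
    then have "\<beta> \<bullet> x = 0" using nonpos_inner[OF neg v(3)] nn by simp
    obtain r where r: "r \<in> carrier W" "inv r = r" "\<And>v. refl_rep r v = v - (2 * bil \<beta> v) *\<^sub>R \<beta>"
      using root_reflection[OF assms(2)] by metis
    have rx: "dual_rep r x = x" using root_reflection_fixes[OF r] \<open>\<beta> \<bullet> x = 0\<close> by blast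
    have rb: "refl_rep r \<beta> = - \<beta>" using r(3)[of \<beta>] root_bil_self[OF assms(2)] by (simp add: vec_eq_iff)
    have "r \<otimes> v \<in> chm x" using v r(1,2) rx by (simp add: chm_def inv_mult_group dual_rep_mult)
    moreover have "r \<otimes> v \<in> half \<beta>"
      using v r(1,2) rb neg by (simp add: half_def inv_mult_group refl_rep_mult refl_rep_uminus)
    ultimately show ?thesis by blast
  qed
qed

lemma sign_face_chm_mono:
  assumes "sign_face x y"
  shows "chm y \<subseteq> chm x"
proof
  fix v assume "v \<in> chm y"
  then have v: "v \<in> carrier W" "0 \<le> dual_rep (inv v) y" by (auto simp: chm_def)
  have "0 \<le> dual_rep (inv v) x $ s" for s
  proof -
    let ?b = "refl_rep v (simple s)"
    have "?b \<bullet> x \<noteq> 0 \<longrightarrow> sgn (?b \<bullet> y) = sgn (?b \<bullet> x)" using assms v by (simp add: sign_face_def)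
    moreover have "0 \<le> ?b \<bullet> y" using v by (simp add: vec_nonneg_iff dual_rep_nth)
    ultimately have "0 \<le> ?b \<bullet> x" by (auto simp: sgn_if split: if_splits)
    then show ?thesis using v by (simp add: dual_rep_nth)
  qed
  then show "v \<in> chm x" using v by (simp add: chm_def vec_nonneg_iff)
qed

lemma sign_face_type_mono:
  assumes "sign_face x y" "v \<in> carrier W"
  shows "zero_type (dual_rep (inv v) y) \<subseteq> zero_type (dual_rep (inv v) x)"
proof
  fix s assume "s \<in> zero_type (dual_rep (inv v) y)"
  then have "refl_rep v (simple s) \<bullet> y = 0" using assms(2) by (simp add: zero_type_def dual_rep_nth)
  moreover have "refl_rep v (simple s) \<in> roots" using assms(2) by simp
  ultimately have "refl_rep v (simple s) \<bullet> x = 0"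
    using assms(1) unfolding sign_face_def by (metis sgn_0 sgn_zero_iff)
  then show "s \<in> zero_type (dual_rep (inv v) x)" using assms(2) by (simp add: zero_type_def dual_rep_nth)
qed

lemma sign_comp_dual_rep:
  assumes "sign_comp x y z" "w \<in> carrier W"
  shows "sign_comp (dual_rep w x) (dual_rep w y) (dual_rep w z)"
  using assms by (auto simp: sign_comp_def dual_rep_inner)

end

section \<open>Simplices of coordinatized apartments\<close>

context twin_building
begin

definition isometry :: "sign \<Rightarrow> ('w \<Rightarrow> 'c) \<Rightarrow> bool" where
  "isometry \<epsilon> \<psi> \<longleftrightarrow> (\<forall>u\<in>carrier W. \<psi> u \<in> Ch \<epsilon>) \<and>
    (\<forall>u\<in>carrier W. \<forall>v\<in>carrier W. \<delta> \<epsilon> (\<psi> u) (\<psi> v) = inv u \<otimes> v)"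

lemma isometry_closed: "isometry \<epsilon> \<psi> \<Longrightarrow> u \<in> carrier W \<Longrightarrow> \<psi> u \<in> Ch \<epsilon>"
  and isometry_dist: "isometry \<epsilon> \<psi> \<Longrightarrow> u \<in> carrier W \<Longrightarrow> v \<in> carrier W \<Longrightarrow>
    \<delta> \<epsilon> (\<psi> u) (\<psi> v) = inv u \<otimes> v"
  by (auto simp: isometry_def)

lemma apartment_iff: "apartment \<epsilon> Y \<longleftrightarrow> (\<exists>\<psi>. isometry \<epsilon> \<psi> \<and> Y = \<psi> ` carrier W)"
  unfolding apartment_def isometry_def by auto

lemma isometry_inj: "isometry \<epsilon> \<psi> \<Longrightarrow> inj_on \<psi> (carrier W)"
proof (rule inj_onI)
  fix u v assume iso: "isometry \<epsilon> \<psi>" and uv: "u \<in> carrier W" "v \<in> carrier W" "\<psi> u = \<psi> v"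
  have "inv u \<otimes> v = \<delta> \<epsilon> (\<psi> u) (\<psi> v)" using isometry_dist[OF iso uv(1,2)] by simp
  also have "\<dots> = \<one>" using isometry_closed[OF iso uv(2)] uv(3) by simp
  finally have "u \<otimes> (inv u \<otimes> v) = u" using uv by simp
  then show "u = v" using uv by (simp flip: m_assoc)
qed

text \<open>The simplex of the apartment \<open>\<psi> ` carrier W\<close> whose cell contains the point \<open>x\<close> of the Tits
  cone. Any chamber containing \<open>x\<close> gives the same residue.\<close>

definition simplex_at :: "sign \<Rightarrow> ('w \<Rightarrow> 'c) \<Rightarrow> real ^ 's \<Rightarrow> 'c set" where
  "simplex_at \<epsilon> \<psi> x =
    (let v = (SOME v. v \<in> chm x) in residue \<epsilon> (zero_type (dual_rep (inv v) x)) (\<psi> v))"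

lemma simplex_at_eq:
  assumes iso: "isometry \<epsilon> \<psi>" and v: "v \<in> chm x"
  shows "simplex_at \<epsilon> \<psi> x = residue \<epsilon> (zero_type (dual_rep (inv v) x)) (\<psi> v)"
proof -
  define u where "u = (SOME v. v \<in> chm x)"
  have u: "u \<in> chm x" unfolding u_def using v by (rule someI)
  have c: "u \<in> carrier W" "v \<in> carrier W" using u v chm_closed by auto
  let ?J = "zero_type (dual_rep (inv u) x)"
  have "inv u \<otimes> v \<in> parabolic ?J" using chm_eq_coset[OF u] v by blast
  then have "\<psi> v \<in> residue \<epsilon> ?J (\<psi> u)"
    using iso c by (simp add: residue_def isometry_closed isometry_dist)
  then have "residue \<epsilon> ?J (\<psi> v) = residue \<epsilon> ?J (\<psi> u)"
    using residue_eq iso c by (simp add: isometry_closed)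
  then show ?thesis
    using chm_same_point[OF u v] by (simp add: simplex_at_def u_def[symmetric])
qed

lemma isometry_in_simplex_at:
  assumes "isometry \<epsilon> \<psi>" "x \<in> tits_cone" "w \<in> carrier W"
  shows "\<psi> w \<in> simplex_at \<epsilon> \<psi> x \<longleftrightarrow> w \<in> chm x"
proof -
  obtain v where v: "v \<in> chm x" "v \<in> carrier W" using tits_cone_obtain[OF assms(2)] by blast
  show ?thesis
    unfolding simplex_at_eq[OF assms(1) v(1)] chm_eq_coset[OF v(1)]
    using assms v(2) by (simp add: residue_def isometry_closed isometry_dist)
qed

lemma simplex_at_inter:
  assumes "isometry \<epsilon> \<psi>" "x \<in> tits_cone"
  shows "simplex_at \<epsilon> \<psi> x \<inter> \<psi> ` carrier W = \<psi> ` chm x"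
  using isometry_in_simplex_at[OF assms] chm_closed by blast

lemma simplex_at_in_simplices:
  assumes "isometry \<epsilon> \<psi>" "x \<in> tits_cone" "V \<subseteq> carrier W"
  shows "simplex_at \<epsilon> \<psi> x \<in> simplices \<epsilon> (\<psi> ` V) \<longleftrightarrow> V \<inter> chm x \<noteq> {}"
proof
  assume "simplex_at \<epsilon> \<psi> x \<in> simplices \<epsilon> (\<psi> ` V)"
  then obtain J v where v: "v \<in> V" "simplex_at \<epsilon> \<psi> x = residue \<epsilon> J (\<psi> v)"
    by (auto simp: simplices_def)
  have vc: "v \<in> carrier W" using v(1) assms(3) by blast
  then have "\<psi> v \<in> simplex_at \<epsilon> \<psi> x" using v residue_self isometry_closed assms(1) by simp
  then have "v \<in> chm x" using isometry_in_simplex_at assms vc by blast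
  then show "V \<inter> chm x \<noteq> {}" using v by blast
next
  assume "V \<inter> chm x \<noteq> {}"
  then obtain v where "v \<in> V" "v \<in> chm x" by blast
  then show "simplex_at \<epsilon> \<psi> x \<in> simplices \<epsilon> (\<psi> ` V)"
    using simplex_at_eq[OF assms(1)] by (auto simp: simplices_def)
qed

lemma simplices_eq_simplex_at:
  assumes "isometry \<epsilon> \<psi>"
  shows "simplices \<epsilon> (\<psi> ` carrier W) = simplex_at \<epsilon> \<psi> ` tits_cone"
proof
  show "simplices \<epsilon> (\<psi> ` carrier W) \<subseteq> simplex_at \<epsilon> \<psi> ` tits_cone"
  proof
    fix A assume "A \<in> simplices \<epsilon> (\<psi> ` carrier W)"
    then obtain J v where v: "v \<in> carrier W" "A = residue \<epsilon> J (\<psi> v)" by (auto simp: simplices_def)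
    let ?x = "dual_rep v (base_point J)"
    have "v \<in> chm ?x" using v by (simp add: chm_def)
    then have "simplex_at \<epsilon> \<psi> ?x = A" using simplex_at_eq[OF assms, of v ?x] v by simp
    moreover have "?x \<in> tits_cone" using v by (simp add: dual_rep_in_tits_cone)
    ultimately show "A \<in> simplex_at \<epsilon> \<psi> ` tits_cone" by blast
  qed
  show "simplex_at \<epsilon> \<psi> ` tits_cone \<subseteq> simplices \<epsilon> (\<psi> ` carrier W)"
  proof clarify
    fix x assume x: "x \<in> tits_cone"
    then have "carrier W \<inter> chm x \<noteq> {}" using tits_cone_obtain by blast
    then show "simplex_at \<epsilon> \<psi> x \<in> simplices \<epsilon> (\<psi> ` carrier W)"
      using simplex_at_in_simplices[OF assms x] by blast
  qed
qed

lemma simplex_at_mono: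
  assumes "isometry \<epsilon> \<psi>" "y \<in> tits_cone" "sign_face x y"
  shows "simplex_at \<epsilon> \<psi> y \<subseteq> simplex_at \<epsilon> \<psi> x"
proof -
  obtain v where v: "v \<in> chm y" "v \<in> carrier W" using tits_cone_obtain[OF assms(2)] by blast
  have "v \<in> chm x" using sign_face_chm_mono assms(3) v(1) by blast
  moreover have "parabolic (zero_type (dual_rep (inv v) y)) \<subseteq> parabolic (zero_type (dual_rep (inv v) x))"
    using sign_face_type_mono[OF assms(3) v(2)] parabolic_subset_iff by blast
  ultimately show ?thesis
    using simplex_at_eq[OF assms(1)] v(1) by (auto simp: residue_def)
qed

lemma simplex_at_chm_eqI:
  assumes "isometry \<epsilon> \<psi>" "x \<in> tits_cone" "chm x = chm y"
  shows "simplex_at \<epsilon> \<psi> x = simplex_at \<epsilon> \<psi> y"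
proof -
  obtain v where v: "v \<in> chm x" "v \<in> carrier W" using tits_cone_obtain[OF assms(2)] by blast
  then have vy: "v \<in> chm y" using assms(3) by simp
  have "u \<in> parabolic (zero_type (dual_rep (inv v) x)) \<longleftrightarrow> u \<in> parabolic (zero_type (dual_rep (inv v) y))"
    if "u \<in> carrier W" for u
    using chm_eq_coset[OF v(1), of "v \<otimes> u"] chm_eq_coset[OF vy, of "v \<otimes> u"] that v(2) assms(3)
    by (simp flip: m_assoc)
  then have "parabolic (zero_type (dual_rep (inv v) x)) = parabolic (zero_type (dual_rep (inv v) y))"
    using parabolic_closed by blast
  then have "zero_type (dual_rep (inv v) x) = zero_type (dual_rep (inv v) y)"
    by (rule parabolic_inj)
  then show ?thesis using simplex_at_eq[OF assms(1)] v(1) vy by simp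
qed

text \<open>Since \<open>len (v\<^sup>-\<^sup>1u) < len (v\<^sup>-\<^sup>1us)\<close> iff \<open>v\<^sup>-\<^sup>1\<close> keeps the root \<open>ue\<^sub>s\<close> positive, the
  combinatorial roots of the apartment are the half-spaces of the roots of the geometric
  representation.\<close>

lemma root_iff_half:
  assumes "isometry \<epsilon> \<psi>"
  shows "root \<epsilon> (\<psi> ` carrier W) \<alpha> \<longleftrightarrow> (\<exists>\<beta>\<in>roots. \<alpha> = \<psi> ` half \<beta>)"
proof -
  have eq: "{D \<in> \<psi> ` carrier W. len (\<delta> \<epsilon> D (\<psi> u)) < len (\<delta> \<epsilon> D (\<psi> (u \<otimes> gen s)))}
    = \<psi> ` half (refl_rep u (simple s))" if u: "u \<in> carrier W" for u s
  proof -
    have "len (\<delta> \<epsilon> (\<psi> v) (\<psi> u)) < len (\<delta> \<epsilon> (\<psi> v) (\<psi> (u \<otimes> gen s))) \<longleftrightarrow>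
      v \<in> half (refl_rep u (simple s))" if v: "v \<in> carrier W" for v
    proof -
      have "len (inv v \<otimes> u) < len (inv v \<otimes> u \<otimes> gen s) \<longleftrightarrow> 0 \<le> refl_rep (inv v \<otimes> u) (simple s)"
        using u v by (intro len_less_mult_gen_iff) simp
      then show ?thesis
        using u v assms by (simp add: isometry_dist half_def refl_rep_mult m_assoc)
    qed
    then show ?thesis using half_subset by blast
  qed
  show ?thesis
  proof
    assume "root \<epsilon> (\<psi> ` carrier W) \<alpha>"
    then obtain u u' s where u: "u \<in> carrier W" "u' \<in> carrier W" "\<delta> \<epsilon> (\<psi> u) (\<psi> u') = gen s"
      "\<alpha> = {D \<in> \<psi> ` carrier W. len (\<delta> \<epsilon> D (\<psi> u)) < len (\<delta> \<epsilon> D (\<psi> u'))}"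
      unfolding root_def by blast
    have "inv u \<otimes> u' = gen s" using u assms isometry_dist by simp
    then have "u \<otimes> (inv u \<otimes> u') = u \<otimes> gen s" by simp
    then have "u' = u \<otimes> gen s" using u by (simp flip: m_assoc)
    then show "\<exists>\<beta>\<in>roots. \<alpha> = \<psi> ` half \<beta>" using u eq[of u s] by auto
  next
    assume "\<exists>\<beta>\<in>roots. \<alpha> = \<psi> ` half \<beta>"
    then obtain u s where u: "u \<in> carrier W" "\<alpha> = \<psi> ` half (refl_rep u (simple s))"
      by (auto simp: roots_def)
    have "\<delta> \<epsilon> (\<psi> u) (\<psi> (u \<otimes> gen s)) = gen s"
      using u assms by (simp add: isometry_dist flip: m_assoc)
    moreover have "\<psi> u \<in> \<psi> ` carrier W" "\<psi> (u \<otimes> gen s) \<in> \<psi> ` carrier W" using u by auto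
    ultimately show "root \<epsilon> (\<psi> ` carrier W) \<alpha>"
      unfolding root_def u(2) eq[OF u(1), symmetric] by blast
  qed
qed

lemma simplex_at_in_half:
  assumes "isometry \<epsilon> \<psi>" "x \<in> tits_cone" "\<beta> \<in> roots"
  shows "simplex_at \<epsilon> \<psi> x \<in> simplices \<epsilon> (\<psi> ` half \<beta>) \<longleftrightarrow> 0 \<le> \<beta> \<bullet> x"
  using simplex_at_in_simplices[OF assms(1,2) half_subset] half_meets_chm[OF assms(2,3)] by simp

lemma image_half_uminus:
  assumes "isometry \<epsilon> \<psi>" "\<beta> \<in> roots"
  shows "\<psi> ` half (- \<beta>) = \<psi> ` carrier W - \<psi> ` half \<beta>"
  unfolding half_uminus[OF assms(2)]
  using inj_on_image_set_diff[OF isometry_inj[OF assms(1)], of "carrier W" "half \<beta>"] half_subset by simp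

lemma side_simplex_at:
  assumes "isometry \<epsilon> \<psi>" "x \<in> tits_cone" "\<beta> \<in> roots"
  shows "real_of_int (side \<epsilon> (\<psi> ` carrier W) (\<psi> ` half \<beta>) (simplex_at \<epsilon> \<psi> x)) = sgn (\<beta> \<bullet> x)"
proof -
  have "simplex_at \<epsilon> \<psi> x \<in> simplices \<epsilon> (\<psi> ` carrier W - \<psi> ` half \<beta>) \<longleftrightarrow> \<beta> \<bullet> x \<le> 0"
    using simplex_at_in_half[of \<epsilon> \<psi> x "- \<beta>"] assms by (simp flip: image_half_uminus)
  then show ?thesis using simplex_at_in_half[OF assms] by (auto simp: side_def sgn_if)
qed

section \<open>Projections within a component\<close>

text \<open>The chamber \<open>\<psi> v\<close> of the projection and a suitable chamber \<open>\<psi> b\<close> of the second simplex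
  have a distance \<open>w = v\<^sup>-\<^sup>1b\<close> that is shortest in its double coset. Let \<open>u\<close> and \<open>k\<close> be the
  distances from \<open>\<psi> v\<close> and \<open>\<psi> b\<close> to the corresponding chambers in another apartment. As lengths
  add up, \<open>u w' = w k\<close>. Therefore \<open>u\<close> fixes the point of the fundamental cone that determines
  the projection, which means that both apartments yield the same residue.\<close>

lemma simplex_at_comp_unique:
  assumes iso: "isometry \<epsilon> \<psi>" "isometry \<epsilon> \<psi>'"
    and cone: "x \<in> tits_cone" "y \<in> tits_cone" "z \<in> tits_cone"
      "x' \<in> tits_cone" "y' \<in> tits_cone" "z' \<in> tits_cone"
    and comp: "sign_comp x y z" "sign_comp x' y' z'"
    and eq: "simplex_at \<epsilon> \<psi> x = simplex_at \<epsilon> \<psi>' x'" "simplex_at \<epsilon> \<psi> y = simplex_at \<epsilon> \<psi>' y'"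
  shows "simplex_at \<epsilon> \<psi> z = simplex_at \<epsilon> \<psi>' z'"
proof -
  \<comment> \<open>A chamber of the projection and a chamber of the second simplex nearest to it.\<close>
  have normal: "\<exists>v b. v \<in> chm x \<and> v \<in> chm z \<and> b \<in> chm y \<and>
      (\<forall>t\<in>zero_type (dual_rep (inv b) y). 0 \<le> refl_rep (inv v \<otimes> b) (simple t))"
    if z: "z \<in> tits_cone" and y: "y \<in> tits_cone" and c: "sign_comp x y z" for x y z
  proof -
    obtain v where v: "v \<in> chm z" "v \<in> carrier W" using tits_cone_obtain[OF z] by blast
    obtain b where b: "b \<in> chm y" "b \<in> carrier W" using tits_cone_obtain[OF y] by blast
    let ?K = "zero_type (dual_rep (inv b) y)"
    have "inv v \<otimes> b \<in> carrier W" using v b by simp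
    then obtain k where k: "k \<in> parabolic ?K"
      "\<And>t. t \<in> ?K \<Longrightarrow> 0 \<le> refl_rep (inv v \<otimes> b \<otimes> k) (simple t)"
      using ex_right_reduced by blast
    have bk: "b \<otimes> k \<in> chm y" using chm_mult_parabolic[OF b(1) k(1)] .
    have "v \<in> chm x" using sign_face_chm_mono[OF sign_face_sign_comp[OF c]] v(1) by blast
    then show ?thesis
      using v b bk k chm_same_point[OF b(1) bk] parabolic_closed[OF k(1)]
      by (intro exI[of _ v] exI[of _ "b \<otimes> k"]) (simp add: m_assoc)
  qed
  obtain v b where v: "v \<in> chm x" "v \<in> chm z" and b: "b \<in> chm y"
    and red: "\<And>t. t \<in> zero_type (dual_rep (inv b) y) \<Longrightarrow> 0 \<le> refl_rep (inv v \<otimes> b) (simple t)"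
    using normal[OF cone(3,2) comp(1)] by blast
  obtain v' b' where v': "v' \<in> chm x'" "v' \<in> chm z'" and b': "b' \<in> chm y'"
    and red': "\<And>t. t \<in> zero_type (dual_rep (inv b') y') \<Longrightarrow> 0 \<le> refl_rep (inv v' \<otimes> b') (simple t)"
    using normal[OF cone(6,5) comp(2)] by blast
  have cl [simp]: "v \<in> carrier W" "b \<in> carrier W" "v' \<in> carrier W" "b' \<in> carrier W"
    using v b v' b' chm_closed by blast+
  have ch: "\<psi> v \<in> Ch \<epsilon>" "\<psi> b \<in> Ch \<epsilon>" "\<psi>' v' \<in> Ch \<epsilon>" "\<psi>' b' \<in> Ch \<epsilon>"
    using iso isometry_closed cl by blast+
  define c where "c = dual_rep (inv v) x"
  define q where "q = dual_rep (inv v) z"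
  define p where "p = dual_rep (inv b) y"
  define w where "w = inv v \<otimes> b"
  define c' where "c' = dual_rep (inv v') x'"
  define q' where "q' = dual_rep (inv v') z'"
  define p' where "p' = dual_rep (inv b') y'"
  define w' where "w' = inv v' \<otimes> b'"
  have w [simp]: "w \<in> carrier W" "w' \<in> carrier W" by (simp_all add: w_def w'_def)
  have nn: "0 \<le> c" "0 \<le> q" "0 \<le> p" "0 \<le> c'" "0 \<le> q'" "0 \<le> p'"
    using v b v' b' chm_nonneg by (simp_all add: c_def q_def p_def c'_def q'_def p'_def)
  have sx: "simplex_at \<epsilon> \<psi> x = residue \<epsilon> (zero_type c) (\<psi> v)"
    "simplex_at \<epsilon> \<psi>' x' = residue \<epsilon> (zero_type c') (\<psi>' v')"
    using simplex_at_eq iso v(1) v'(1) by (simp_all add: c_def c'_def)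
  have sy: "simplex_at \<epsilon> \<psi> y = residue \<epsilon> (zero_type p) (\<psi> b)"
    "simplex_at \<epsilon> \<psi>' y' = residue \<epsilon> (zero_type p') (\<psi>' b')"
    using simplex_at_eq iso b b' by (simp_all add: p_def p'_def)
  have sz: "simplex_at \<epsilon> \<psi> z = residue \<epsilon> (zero_type q) (\<psi> v)"
    "simplex_at \<epsilon> \<psi>' z' = residue \<epsilon> (zero_type q') (\<psi>' v')"
    using simplex_at_eq iso v(2) v'(2) by (simp_all add: q_def q'_def)
  have types: "zero_type c' = zero_type c" "zero_type p' = zero_type p"
    using residue_type[OF ch(1,3), of "zero_type c" "zero_type c'"]
      residue_type[OF ch(2,4), of "zero_type p" "zero_type p'"] eq sx sy by simp_all
  have "sign_comp c (dual_rep (inv v) y) q" using sign_comp_dual_rep[OF comp(1), of "inv v"] by (simp add: c_def q_def)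
  moreover have "dual_rep (inv v) y = dual_rep w p" by (simp add: w_def p_def dual_rep_mult)
  ultimately have cq: "sign_comp c (dual_rep w p) q" by simp
  have "sign_comp c' (dual_rep (inv v') y') q'" using sign_comp_dual_rep[OF comp(2), of "inv v'"] by (simp add: c'_def q'_def)
  moreover have "dual_rep (inv v') y' = dual_rep w' p'" by (simp add: w'_def p'_def dual_rep_mult)
  ultimately have cq': "sign_comp c' (dual_rep w' p') q'" by simp
  define u where "u = \<delta> \<epsilon> (\<psi> v) (\<psi>' v')"
  define k where "k = \<delta> \<epsilon> (\<psi> b) (\<psi>' b')"
  have "\<psi>' v' \<in> residue \<epsilon> (zero_type c) (\<psi> v)" using eq(1) sx residue_self[OF ch(3)] by auto
  then have u: "u \<in> parabolic (zero_type c)" by (simp add: u_def residue_def)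
  have "\<psi>' b' \<in> residue \<epsilon> (zero_type p) (\<psi> b)" using eq(2) sy residue_self[OF ch(4)] by auto
  then have k: "k \<in> parabolic (zero_type p)" by (simp add: k_def residue_def)
  have uk [simp]: "u \<in> carrier W" "k \<in> carrier W" using u k parabolic_closed by auto
  have dw: "\<delta> \<epsilon> (\<psi> v) (\<psi> b) = w" "\<delta> \<epsilon> (\<psi>' v') (\<psi>' b') = w'"
    using iso isometry_dist by (simp_all add: w_def w'_def)
  have "len (w \<otimes> k) = len w + len k"
    using red k by (intro len_mult_parabolic) (auto simp: w_def p_def)
  then have d1: "\<delta> \<epsilon> (\<psi> v) (\<psi>' b') = w \<otimes> k"
    using dist_add[OF building ch(1,2,4)] dw by (simp add: k_def)
  have "0 \<le> refl_rep (inv w') (simple s)" if s: "s \<in> zero_type c'" for s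
  proof (rule left_nonneg_if_right_reduced[OF w(2) nn(6)])
    show "0 \<le> refl_rep w' (simple t)" if "t \<in> zero_type p'" for t
      using red' that by (simp add: w'_def p'_def)
    have "sgn (simple s \<bullet> q') = sgn (simple s \<bullet> dual_rep w' p')"
      using cq'[unfolded sign_comp_def, rule_format, of "simple s"] s by (simp add: zero_type_def)
    then show "0 \<le> dual_rep w' p' $ s"
      using nonneg_if_sgn_eq[of "q' $ s" "dual_rep w' p' $ s"] nn(5) by (simp add: vec_nonneg_iff)
  qed
  then have "len (u \<otimes> w') = len u + len w'"
    using u types by (intro len_mult_parabolic_left) auto
  then have "\<delta> \<epsilon> (\<psi> v) (\<psi>' b') = u \<otimes> w'"
    using dist_add[OF building ch(1,3,4)] dw by (simp add: u_def)
  then have uw: "u \<otimes> w' = w \<otimes> k" using d1 by simp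
  have kp: "dual_rep k p' = p'" using parabolic_fixes[OF k] types by simp
  have uc: "dual_rep u c' = c'" using parabolic_fixes[OF u] types by simp
  have "dual_rep u (dual_rep w' p') = dual_rep (w \<otimes> k) p'" by (simp flip: dual_rep_mult uw)
  then have up: "dual_rep u (dual_rep w' p') = dual_rep w p'" using kp by (simp add: dual_rep_mult)
  have c_iff: "c $ s = 0 \<longleftrightarrow> c' $ s = 0" for s using types(1) by (auto simp: zero_type_def)
  \<comment> \<open>Both points have the same signs on all simple walls, since \<open>u\<close> moves the data of the second apartment to those of the first.\<close>
  have same: "sgn (dual_rep u q' $ s) = sgn (q $ s)" for s
  proof -
    let ?g = "refl_rep (inv u) (simple s)"
    have g: "?g \<in> roots" by simp
    have gc: "?g \<bullet> c' = c' $ s" and gy: "?g \<bullet> dual_rep w' p' = dual_rep w p' $ s"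
      using uc up by (simp_all flip: dual_rep_nth)
    have s1: "sgn (dual_rep u q' $ s) = (if c' $ s = 0 then sgn (dual_rep w p' $ s) else sgn (c' $ s))"
      using cq'[unfolded sign_comp_def, rule_format, OF g] by (simp add: dual_rep_nth gc gy)
    have s2: "sgn (q $ s) = (if c $ s = 0 then sgn (dual_rep w p $ s) else sgn (c $ s))"
      using cq[unfolded sign_comp_def, rule_format, of "simple s"] by simp
    have "sgn (c' $ s) = sgn (c $ s)" 
      using sgn_inner_same_type[OF _ nn(1,4) types(1), of "simple s"] by simp
    moreover have "sgn (dual_rep w p' $ s) = sgn (dual_rep w p $ s)"
      unfolding dual_rep_nth[OF w(1)] by (rule sgn_inner_same_type[OF _ nn(3,6) types(2)]) simp
    ultimately show ?thesis using s1 s2 c_iff[of s] by simp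
  qed
  have "0 \<le> dual_rep u q' $ s" for s
    using nonneg_if_sgn_eq[OF same[of s, symmetric]] nn(2) by (simp add: vec_nonneg_iff)
  then have uq: "0 \<le> dual_rep u q'" by (simp add: vec_nonneg_iff)
  then have "dual_rep u q' = q'" "u \<in> parabolic (zero_type q')"
    using fundamental_domain[of u q'] parabolic_if_nonneg[of u q'] nn by auto
  moreover have "zero_type q = zero_type (dual_rep u q')"
    using same by (auto simp: zero_type_def) (metis sgn_zero_iff)+
  ultimately have "\<psi>' v' \<in> residue \<epsilon> (zero_type q) (\<psi> v)" "zero_type q' = zero_type q"
    using ch(3) by (auto simp: residue_def u_def)
  then show ?thesis using sz residue_eq[OF ch(1)] by simp
qed

theorem proj_simplex_at:
  assumes iso: "isometry \<epsilon> \<psi>" and cone: "x \<in> tits_cone" "y \<in> tits_cone" "z \<in> tits_cone"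
    and comp: "sign_comp x y z"
  shows "proj \<epsilon> (simplex_at \<epsilon> \<psi> x) (simplex_at \<epsilon> \<psi> y) = simplex_at \<epsilon> \<psi> z"
proof -
  let ?P = "\<lambda>P Y. apartment \<epsilon> Y \<and> simplex_at \<epsilon> \<psi> x \<in> simplices \<epsilon> Y \<and> simplex_at \<epsilon> \<psi> y \<in> simplices \<epsilon> Y \<and>
    P \<in> simplices \<epsilon> Y \<and> (\<forall>\<alpha>. root \<epsilon> Y \<alpha> \<longrightarrow> side \<epsilon> Y \<alpha> P =
      (if side \<epsilon> Y \<alpha> (simplex_at \<epsilon> \<psi> x) \<noteq> 0 then side \<epsilon> Y \<alpha> (simplex_at \<epsilon> \<psi> x)
       else side \<epsilon> Y \<alpha> (simplex_at \<epsilon> \<psi> y)))"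
  have side_comp: "(\<forall>\<alpha>. root \<epsilon> (\<psi>' ` carrier W) \<alpha> \<longrightarrow> side \<epsilon> (\<psi>' ` carrier W) \<alpha> (simplex_at \<epsilon> \<psi>' z') =
      (if side \<epsilon> (\<psi>' ` carrier W) \<alpha> (simplex_at \<epsilon> \<psi>' x') \<noteq> 0
       then side \<epsilon> (\<psi>' ` carrier W) \<alpha> (simplex_at \<epsilon> \<psi>' x')
       else side \<epsilon> (\<psi>' ` carrier W) \<alpha> (simplex_at \<epsilon> \<psi>' y'))) \<longleftrightarrow> sign_comp x' y' z'"
    if "isometry \<epsilon> \<psi>'" "x' \<in> tits_cone" "y' \<in> tits_cone" "z' \<in> tits_cone" for \<psi>' x' y' z'
  proof -
    let ?s = "\<lambda>\<beta> x. side \<epsilon> (\<psi>' ` carrier W) (\<psi>' ` half \<beta>) (simplex_at \<epsilon> \<psi>' x)"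
    have "?s \<beta> z' = (if ?s \<beta> x' \<noteq> 0 then ?s \<beta> x' else ?s \<beta> y') \<longleftrightarrow>
      sgn (\<beta> \<bullet> z') = (if \<beta> \<bullet> x' = 0 then sgn (\<beta> \<bullet> y') else sgn (\<beta> \<bullet> x'))" if b: "\<beta> \<in> roots" for \<beta>
    proof -
      note s = side_simplex_at[OF \<open>isometry \<epsilon> \<psi>'\<close> \<open>x' \<in> tits_cone\<close> b, symmetric]
        side_simplex_at[OF \<open>isometry \<epsilon> \<psi>'\<close> \<open>y' \<in> tits_cone\<close> b, symmetric]
        side_simplex_at[OF \<open>isometry \<epsilon> \<psi>'\<close> \<open>z' \<in> tits_cone\<close> b, symmetric]
      have "\<beta> \<bullet> x' = 0 \<longleftrightarrow> ?s \<beta> x' = 0" using s(1) by (metis of_int_0 of_int_eq_iff sgn_zero_iff)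
      then show ?thesis unfolding s by simp
    qed
    then show ?thesis
      unfolding sign_comp_def root_iff_half[OF \<open>isometry \<epsilon> \<psi>'\<close>] by blast
  qed
  show ?thesis
    unfolding proj_def
  proof (rule the_equality)
    have "?P (simplex_at \<epsilon> \<psi> z) (\<psi> ` carrier W)"
      using side_comp[OF iso cone] comp simplices_eq_simplex_at[OF iso] cone iso
      by (auto simp: apartment_iff)
    then show "\<exists>Y. ?P (simplex_at \<epsilon> \<psi> z) Y" by blast
  next
    fix P assume "\<exists>Y. ?P P Y"
    then obtain Y where Y: "?P P Y" by blast
    then obtain \<psi>' where iso': "isometry \<epsilon> \<psi>'" "Y = \<psi>' ` carrier W" by (auto simp: apartment_iff)
    then obtain x' y' z' where xyz: "x' \<in> tits_cone" "simplex_at \<epsilon> \<psi> x = simplex_at \<epsilon> \<psi>' x'"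
      "y' \<in> tits_cone" "simplex_at \<epsilon> \<psi> y = simplex_at \<epsilon> \<psi>' y'"
      "z' \<in> tits_cone" "P = simplex_at \<epsilon> \<psi>' z'"
      using Y unfolding iso'(2) simplices_eq_simplex_at[OF iso'(1)] by blast
    have "sign_comp x' y' z'"
      using Y unfolding iso'(2) xyz(2,4,6) side_comp[OF iso'(1) xyz(1,3,5)] by blast
    then show "P = simplex_at \<epsilon> \<psi> z"
      using simplex_at_comp_unique[OF iso iso'(1) cone xyz(1,3,5) comp] xyz by simp
  qed
qed

section \<open>Projections between the components\<close>

text \<open>If all letters of \<open>J\<close> shorten the codistance \<open>w\<close> from \<open>G\<close> to \<open>E\<close> then a chamber of the
  residue at distance \<open>j\<close> from \<open>G\<close> has a codistance of length \<open>len w - len j\<close>, so that \<open>G\<close> is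
  the unique chamber of maximal codistance.\<close>

lemma coproj_chamber_eq:
  assumes G: "G \<in> Ch \<epsilon>" and E: "E \<in> Ch (flip \<epsilon>)"
    and long: "\<And>s. s \<in> J \<Longrightarrow> refl_rep (inv (cod \<epsilon> G E)) (simple s) \<le> 0"
  shows "coproj_chamber \<epsilon> (residue \<epsilon> J G) E = G"
proof -
  have w: "cod \<epsilon> G E \<in> carrier W" using cod_closed G E by blast
  have lens: "len (cod \<epsilon> D E) + len (\<delta> \<epsilon> D G) = len (cod \<epsilon> G E)" if D: "D \<in> residue \<epsilon> J G" for D
  proof -
    have d: "D \<in> Ch \<epsilon>" "\<delta> \<epsilon> D G \<in> parabolic J"
      using D dist_parabolic_sym' G by (auto simp: residue_def)
    then have l: "len (\<delta> \<epsilon> D G \<otimes> cod \<epsilon> G E) + len (\<delta> \<epsilon> D G) = len (cod \<epsilon> G E)"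
      using len_parabolic_mult_longest[OF w long] by blast
    then have "cod \<epsilon> D E = \<delta> \<epsilon> D G \<otimes> cod \<epsilon> G E" using cod_descend[OF G d(1) E] by blast
    then show ?thesis using l by simp
  qed
  show ?thesis
    unfolding coproj_chamber_def
  proof (rule the_equality)
    show "G \<in> residue \<epsilon> J G \<and> (\<forall>D\<in>residue \<epsilon> J G. len (cod \<epsilon> D E) \<le> len (cod \<epsilon> G E))"
      using residue_self[OF G] lens by (metis le_add1)
  next
    fix F assume F: "F \<in> residue \<epsilon> J G \<and> (\<forall>D\<in>residue \<epsilon> J G. len (cod \<epsilon> D E) \<le> len (cod \<epsilon> F E))"
    then have "len (cod \<epsilon> G E) \<le> len (cod \<epsilon> F E)" using residue_self[OF G] by blast
    then have "len (\<delta> \<epsilon> F G) = 0" using lens[of F] F by simp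
    moreover have "F \<in> Ch \<epsilon>" using F by (simp add: residue_def)
    ultimately show "F = G" using len_eq_0_iff dist_closed' dist_one_iff' G by metis
  qed
qed

text \<open>Codistances from a spherical residue take finitely many values. If a letter of \<open>J\<close>
  lengthens the longest of them, the existence axiom provides a chamber of the residue with a
  longer one.\<close>

lemma ex_farthest_chamber:
  assumes C: "C \<in> Ch \<epsilon>" and E: "E \<in> Ch (flip \<epsilon>)" and fin: "finite (parabolic J)"
  shows "\<exists>G\<in>residue \<epsilon> J C. \<forall>s\<in>J. refl_rep (inv (cod \<epsilon> G E)) (simple s) \<le> 0"
proof -
  define A where "A = residue \<epsilon> J C"
  define L where "L = (\<lambda>D. len (cod \<epsilon> D E)) ` A"
  have "(\<lambda>D. cod \<epsilon> D E) ` A \<subseteq> (\<lambda>u. u \<otimes> cod \<epsilon> C E) ` parabolic J"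
  proof clarify
    fix D assume "D \<in> A"
    then have D: "D \<in> Ch \<epsilon>" "\<delta> \<epsilon> D C \<in> parabolic J"
      using dist_parabolic_sym' C by (auto simp: A_def residue_def)
    then show "cod \<epsilon> D E \<in> (\<lambda>u. u \<otimes> cod \<epsilon> C E) ` parabolic J"
      using cod_parabolic_left[OF D(1) C E D(2)] by blast
  qed
  then have "finite ((\<lambda>D. cod \<epsilon> D E) ` A)" by (rule finite_subset) (use fin in simp)
  then have "finite (len ` (\<lambda>D. cod \<epsilon> D E) ` A)" by (rule finite_imageI)
  then have L: "finite L" by (simp add: L_def image_image)
  have "C \<in> A" using residue_self[OF C] by (simp add: A_def)
  then have "L \<noteq> {}" by (auto simp: L_def)
  then have "Max L \<in> L" using L by (rule Max_in[rotated])
  then obtain G where G: "G \<in> A" "len (cod \<epsilon> G E) = Max L" by (auto simp: L_def)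
  have GC: "G \<in> Ch \<epsilon>" using G(1) by (simp add: A_def residue_def)
  have w: "cod \<epsilon> G E \<in> carrier W" using cod_closed GC E by blast
  have "refl_rep (inv (cod \<epsilon> G E)) (simple s) \<le> 0" if s: "s \<in> J" for s
  proof (rule ccontr)
    assume "\<not> ?thesis"
    then have "0 \<le> refl_rep (inv (cod \<epsilon> G E)) (simple s)"
      using root_sign[of "refl_rep (inv (cod \<epsilon> G E)) (simple s)"] w by auto
    then have lt: "len (cod \<epsilon> G E) < len (gen s \<otimes> cod \<epsilon> G E)"
      using len_less_gen_mult_iff[OF w] by blast
    obtain D where D: "D \<in> Ch \<epsilon>" "\<delta> \<epsilon> D G = gen s" "cod \<epsilon> D E = gen s \<otimes> cod \<epsilon> G E"
      using cod_exists[OF GC E] by blast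
    have "\<delta> \<epsilon> G D \<in> parabolic J" using dist_gen_sym[OF building GC D(1,2)] s parabolic_gen by simp
    then have "D \<in> residue \<epsilon> J G" using D by (simp add: residue_def)
    then have "D \<in> A" using residue_eq[OF C] G(1) by (simp add: A_def)
    then have "len (cod \<epsilon> D E) \<le> Max L" using L by (auto simp: L_def)
    then show False using lt G(2) D(3) by simp
  qed
  then show ?thesis using G(1) by (auto simp: A_def)
qed

text \<open>The argument is that of projections within a component, with \<open>y\<close> replaced by \<open>- y\<close>, since
  maximal codistance to \<open>\<psi>' b\<close> means maximal distance from the chamber opposite to \<open>\<psi>' b\<close>. The
  chambers of the claimed projection in the apartment are the \<open>\<psi> (v \<otimes> i)\<close> with \<open>i\<close> in the
  stabilizer of \<open>q\<close>. Each of them is the projection of some chamber of the second simplex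
  (\<open>hit\<close>), and the projection of every chamber of the second simplex, inside the apartment or
  not, lies in the same residue (\<open>into\<close>).\<close>

theorem coproj_simplex_at:
  assumes iso: "isometry \<epsilon> \<psi>" "isometry (flip \<epsilon>) \<psi>'"
    and cod: "\<And>u v. u \<in> carrier W \<Longrightarrow> v \<in> carrier W \<Longrightarrow> cod \<epsilon> (\<psi> u) (\<psi>' v) = inv u \<otimes> v"
    and cone: "x \<in> tits_cone" "y \<in> tits_cone" "z \<in> tits_cone"
    and comp: "sign_comp x (- y) z" and fin: "finite (zero_roots x)"
  shows "coproj \<epsilon> (simplex_at \<epsilon> \<psi> x) (simplex_at (flip \<epsilon>) \<psi>' y) = simplex_at \<epsilon> \<psi> z"
proof -
  obtain v where v: "v \<in> chm z" "v \<in> carrier W" using tits_cone_obtain[OF cone(3)] by blast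
  have vx: "v \<in> chm x" using sign_face_chm_mono[OF sign_face_sign_comp[OF comp]] v(1) by blast
  obtain b0 where b0: "b0 \<in> chm y" "b0 \<in> carrier W" using tits_cone_obtain[OF cone(2)] by blast
  have "inv v \<otimes> b0 \<in> carrier W" using v b0 by simp
  then obtain k0 where k0: "k0 \<in> parabolic (zero_type (dual_rep (inv b0) y))"
    "\<And>t. t \<in> zero_type (dual_rep (inv b0) y) \<Longrightarrow> 0 \<le> refl_rep (inv v \<otimes> b0 \<otimes> k0) (simple t)"
    using ex_right_reduced by blast
  define b where "b = b0 \<otimes> k0"
  have b: "b \<in> chm y" "b \<in> carrier W"
    using chm_mult_parabolic[OF b0(1) k0(1)] b0(2) parabolic_closed[OF k0(1)] by (simp_all add: b_def)
  define c where "c = dual_rep (inv v) x"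
  define q where "q = dual_rep (inv v) z"
  define p where "p = dual_rep (inv b) y"
  define w where "w = inv v \<otimes> b"
  define J where "J = zero_type c"
  define I where "I = zero_type q"
  define K where "K = zero_type p"
  have w: "w \<in> carrier W" using v b by (simp add: w_def)
  have nn: "0 \<le> c" "0 \<le> q" "0 \<le> p"
    using vx v b chm_nonneg by (simp_all add: c_def q_def p_def)
  have red: "0 \<le> refl_rep w (simple t)" if "t \<in> K" for t
    using k0(2) that chm_same_point[OF b0(1) b(1)] v(2) b0(2) parabolic_closed[OF k0(1)]
    by (simp add: K_def p_def w_def b_def m_assoc)
  have ch: "\<psi> v \<in> Ch \<epsilon>" "\<psi>' b \<in> Ch (flip \<epsilon>)" using iso isometry_closed v(2) b(2) by blast+
  have sx: "simplex_at \<epsilon> \<psi> x = residue \<epsilon> J (\<psi> v)"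
    and sz: "simplex_at \<epsilon> \<psi> z = residue \<epsilon> I (\<psi> v)"
    and sy: "simplex_at (flip \<epsilon>) \<psi>' y = residue (flip \<epsilon>) K (\<psi>' b)"
    using simplex_at_eq[OF iso(1) vx] simplex_at_eq[OF iso(1) v(1)] simplex_at_eq[OF iso(2) b(1)]
    by (simp_all add: J_def I_def K_def c_def q_def p_def)
  have "dual_rep (inv v) (- y) = - dual_rep w p"
    using v(2) b(2) by (simp add: w_def p_def dual_rep_mult linear_neg[OF linear_dual_rep])
  then have cq: "sign_comp c (- dual_rep w p) q"
    using sign_comp_dual_rep[OF comp, of "inv v"] v(2) by (simp add: c_def q_def)
  have cq_s: "sgn (q $ s) = (if c $ s = 0 then - sgn (dual_rep w p $ s) else sgn (c $ s))" for s
    using cq[unfolded sign_comp_def, rule_format, of "simple s"] by (simp add: sgn_minus)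
  have I_eq: "I = {s \<in> J. dual_rep w p $ s = 0}"
  proof -
    have "q $ s = 0 \<longleftrightarrow> c $ s = 0 \<and> dual_rep w p $ s = 0" for s
      using cq_s[of s] by (auto simp: sgn_zero_iff split: if_splits)
    then show ?thesis by (auto simp: I_def J_def zero_type_def)
  qed
  have J_nonpos: "dual_rep w p $ s \<le> 0" if "s \<in> J" for s
  proof -
    have "sgn (q $ s) = sgn (- dual_rep w p $ s)" using cq_s[of s] that by (simp add: J_def zero_type_def sgn_minus)
    then show ?thesis using nonneg_if_sgn_eq[of "q $ s" "- dual_rep w p $ s"] nn(2) by (simp add: vec_nonneg_iff)
  qed
  have IJ: "parabolic I \<subseteq> parabolic J" using I_eq parabolic_subset_iff by auto
  have fixI: "dual_rep i (dual_rep w p) = dual_rep w p" if "i \<in> parabolic I" for i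
    using that by (rule parabolic_fixes) (auto simp: I_eq zero_type_def)
  have fixJ: "dual_rep j c = c" if "j \<in> parabolic J" for j
    using that by (rule parabolic_fixes) (auto simp: J_def)
  have "zero_roots c = refl_rep (inv v) ` zero_roots x" using zero_roots_dual_rep v(2) by (simp add: c_def)
  then have finJ: "finite (parabolic J)"
    using finite_parabolic_iff[OF nn(1)] fin by (simp add: J_def)
  then have "finite (parabolic I)" using IJ finite_subset by blast
  then obtain m where m: "m \<in> parabolic I" "\<And>s. s \<in> I \<Longrightarrow> refl_rep m (simple s) \<le> 0"
    by (rule ex_longest) blast
  have mc: "m \<in> carrier W" using m(1) parabolic_closed by blast
  \<comment> \<open>\<open>w\<close> was chosen short in its coset; multiplying by the longest element \<open>m\<close> makes all letters of \<open>J\<close> shorten it.\<close>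
  define w1 where "w1 = inv m \<otimes> w"
  have w1: "w1 \<in> carrier W" using mc w by (simp add: w1_def)
  have w1p: "dual_rep w1 p = dual_rep w p"
    using fixI[OF parabolic_inv[OF m(1)]] mc w by (simp add: w1_def dual_rep_mult)
  have inv_w1: "refl_rep (inv w1) u = refl_rep (inv w) (refl_rep m u)" for u
    using mc w by (simp add: w1_def inv_mult_group refl_rep_mult)
  have long: "refl_rep (inv w1) (simple s) \<le> 0" if s: "s \<in> J" for s
  proof (cases "s \<in> I")
    case True
    have "0 \<le> refl_rep (inv w) (- refl_rep m (simple s))"
    proof (rule refl_rep_nonneg_comb)
      show "0 \<le> - refl_rep m (simple s)" using m(2) True by simp
      fix t assume "(- refl_rep m (simple s)) $ t \<noteq> 0"
      then have "t \<in> I" using refl_rep_parabolic_supp[OF m(1) True] by simp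
      then have "dual_rep w p $ t = 0" by (simp add: I_eq)
      then show "0 \<le> refl_rep (inv w) (simple t)"
        using left_nonneg_if_right_reduced[OF w nn(3)] red by (simp add: K_def)
    qed (use w in simp)
    then show ?thesis using w by (simp add: inv_w1 refl_rep_uminus)
  next
    case False
    then have "dual_rep w1 p $ s < 0" using s J_nonpos[OF s] w1p by (auto simp: I_eq less_le)
    then have "refl_rep (inv w1) (simple s) \<bullet> p < 0" using w1 by (simp add: dual_rep_nth)
    then show ?thesis using root_inner_neg nn(3) w1 by simp
  qed
  let ?A = "residue \<epsilon> J (\<psi> v)" and ?B = "residue (flip \<epsilon>) K (\<psi>' b)" and ?P = "residue \<epsilon> I (\<psi> v)"
  have hit: "\<exists>E\<in>?B. coproj_chamber \<epsilon> ?A E = \<psi> (v \<otimes> i) \<and> cod \<epsilon> (\<psi> (v \<otimes> i)) E = w1"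
    if i: "i \<in> parabolic I" for i
  proof -
    define h where "h = i \<otimes> inv m"
    have h: "h \<in> parabolic I" using i m(1) by (simp add: h_def parabolic_mult parabolic_inv)
    have hc: "h \<in> carrier W" "i \<in> carrier W" using h i parabolic_closed by auto
    define b' where "b' = v \<otimes> (h \<otimes> w)"
    have b': "b' \<in> carrier W" using v(2) hc w by (simp add: b'_def)
    have bb: "inv b \<otimes> b' = inv w \<otimes> (h \<otimes> w)"
      using v(2) b(2) hc w by (simp add: b'_def w_def inv_mult_group m_assoc)
    have "dual_rep (inv w \<otimes> (h \<otimes> w)) p = p" using fixI[OF h] w hc by (simp add: dual_rep_mult)
    then have "inv b \<otimes> b' \<in> parabolic K"
      using parabolic_if_nonneg[of "inv w \<otimes> (h \<otimes> w)" p] nn(3) w hc by (simp add: bb K_def)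
    then have E: "\<psi>' b' \<in> ?B" using iso(2) b(2) b' by (simp add: residue_def isometry_closed isometry_dist)
    have vi: "v \<otimes> i \<in> carrier W" using v(2) hc by simp
    have "cod \<epsilon> (\<psi> (v \<otimes> i)) (\<psi>' b') = inv (v \<otimes> i) \<otimes> b'" using cod vi b' by blast
    also have "\<dots> = w1"
      using v(2) hc(2) w mc by (simp add: b'_def h_def w1_def inv_mult_group m_assoc)
    finally have cw: "cod \<epsilon> (\<psi> (v \<otimes> i)) (\<psi>' b') = w1" .
    have "inv v \<otimes> (v \<otimes> i) = i" using v(2) hc by simp
    then have "\<psi> (v \<otimes> i) \<in> ?A"
      using iso(1) v(2) vi i IJ by (auto simp: residue_def isometry_closed isometry_dist)
    then have "residue \<epsilon> J (\<psi> (v \<otimes> i)) = ?A" using residue_eq ch(1) by blast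
    then have "coproj_chamber \<epsilon> ?A (\<psi>' b') = \<psi> (v \<otimes> i)"
      using coproj_chamber_eq[of "\<psi> (v \<otimes> i)" \<epsilon> "\<psi>' b'" J] long cw vi b' iso isometry_closed by simp
    then show ?thesis using E cw by blast
  qed
  have into: "coproj_chamber \<epsilon> ?A E \<in> ?P" if E: "E \<in> ?B" for E
  proof -
    have EC: "E \<in> Ch (flip \<epsilon>)" using E by (simp add: residue_def)
    obtain G where G: "G \<in> ?A" "\<And>s. s \<in> J \<Longrightarrow> refl_rep (inv (cod \<epsilon> G E)) (simple s) \<le> 0"
      using ex_farthest_chamber[OF ch(1) EC finJ] by blast
    have GC: "G \<in> Ch \<epsilon>" using G(1) by (simp add: residue_def)
    have "residue \<epsilon> J G = ?A" using residue_eq[OF ch(1) G(1)] .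
    then have pr: "coproj_chamber \<epsilon> ?A E = G" using coproj_chamber_eq[OF GC EC, of J] G(2) by simp
    obtain F where F: "F \<in> ?B" "cod \<epsilon> (\<psi> (v \<otimes> m)) F = w1" using hit[OF m(1)] by blast
    define H where "H = \<psi> (v \<otimes> m)"
    have HC: "H \<in> Ch \<epsilon>" using iso(1) isometry_closed v(2) mc by (simp add: H_def)
    have vH: "\<delta> \<epsilon> (\<psi> v) H = m" using isometry_dist[OF iso(1)] v(2) mc by (simp add: H_def)
    have FC: "F \<in> Ch (flip \<epsilon>)" using F(1) by (simp add: residue_def)
    have "residue (flip \<epsilon>) K F = ?B" using residue_eq[OF ch(2) F(1)] .
    then have "\<delta> (flip \<epsilon>) F E \<in> parabolic K" using E by (auto simp: residue_def)
    then obtain k where k: "k \<in> parabolic K" "cod \<epsilon> H E = w1 \<otimes> k"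
      using cod_parabolic_right[OF HC FC EC] F(2) by (auto simp: H_def)
    have kc: "k \<in> carrier W" using k(1) parabolic_closed by blast
    define w2 where "w2 = cod \<epsilon> G E"
    have w2: "w2 \<in> carrier W" using cod_closed GC EC by (simp add: w2_def)
    define j where "j = \<delta> \<epsilon> G H"
    have "H \<in> ?A" using HC vH m(1) IJ by (auto simp: residue_def)
    then have "\<delta> \<epsilon> H G \<in> parabolic J" using G(1) residue_eq[OF ch(1), of H J] by (auto simp: residue_def)
    then have j: "j \<in> parabolic J" "\<delta> \<epsilon> H G = inv j"
      using dist_parabolic_sym'[OF HC GC] dist_sym'[OF GC HC] by (auto simp: j_def)
    have jc: "j \<in> carrier W" using j(1) parabolic_closed by blast
    have "len (inv j \<otimes> w2) + len (inv j) = len w2"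
      using len_parabolic_mult_longest[OF w2 _ parabolic_inv[OF j(1)]] G(2) by (simp add: w2_def)
    then have "cod \<epsilon> H E = inv j \<otimes> w2"
      using cod_descend[OF GC HC EC] j(2) by (simp add: w2_def)
    then have "j \<otimes> (inv j \<otimes> w2) = j \<otimes> (w1 \<otimes> k)" using k(2) by simp
    \<comment> \<open>\<open>G\<close> and \<open>H\<close> are both farthest chambers, so \<open>j\<close> matches their codistances and must fix \<open>q\<close>.\<close>
    then have w2_eq: "w2 = j \<otimes> (w1 \<otimes> k)" using jc w2 by simp
    have "dual_rep k p = p" using parabolic_fixes[OF k(1)] by (simp add: K_def)
    then have w2p: "dual_rep w2 p = dual_rep j (dual_rep w p)"
      using w1p jc w1 kc by (simp add: w2_eq dual_rep_mult)
    have "0 \<le> dual_rep j q $ s" for s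
    proof -
      let ?g = "refl_rep (inv j) (simple s)"
      have gq: "sgn (?g \<bullet> q) = (if ?g \<bullet> c = 0 then sgn (?g \<bullet> (- dual_rep w p)) else sgn (?g \<bullet> c))"
        using cq jc by (simp add: sign_comp_def)
      have gc: "?g \<bullet> c = c $ s" and gw: "?g \<bullet> dual_rep w p = dual_rep w2 p $ s"
        and gj: "?g \<bullet> q = dual_rep j q $ s"
        using fixJ[OF j(1)] w2p jc by (simp_all flip: dual_rep_nth)
      show ?thesis
      proof (cases "c $ s = 0")
        case True
        then have "s \<in> J" by (simp add: J_def zero_type_def)
        then have "refl_rep (inv w2) (simple s) \<bullet> p \<le> 0"
          using G(2) nn(3) by (intro nonpos_inner) (simp_all add: w2_def)
        then have "0 \<le> ?g \<bullet> (- dual_rep w p)" using w2 by (simp add: gw dual_rep_nth)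
        moreover have "sgn (?g \<bullet> (- dual_rep w p)) = sgn (dual_rep j q $ s)" using gq gc gj True by simp
        ultimately show ?thesis using nonneg_if_sgn_eq by blast
      next
        case False
        then have "sgn (c $ s) = sgn (dual_rep j q $ s)" using gq gc gj by simp
        then show ?thesis using nonneg_if_sgn_eq nn(1) by (auto simp: vec_nonneg_iff)
      qed
    qed
    then have "0 \<le> dual_rep j q" by (simp add: vec_nonneg_iff)
    then have "j \<in> parabolic I" using parabolic_if_nonneg jc nn(2) by (simp add: I_def)
    then have "\<delta> \<epsilon> H G \<in> parabolic I" using j(2) parabolic_inv by simp
    then have "\<delta> \<epsilon> (\<psi> v) G \<in> parabolic I"
      using dist_parabolic_trans'[OF ch(1) HC GC] vH m(1) by simp
    then show ?thesis using pr GC by (simp add: residue_def)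
  qed
  have least: "?P \<subseteq> Q" if Q: "Q \<in> simplices \<epsilon> (Ch \<epsilon>)" "coproj_chamber \<epsilon> ?A ` ?B \<subseteq> Q" for Q
  proof
    fix D assume "D \<in> ?P"
    then have D: "D \<in> Ch \<epsilon>" "\<delta> \<epsilon> (\<psi> v) D \<in> parabolic I" by (auto simp: residue_def)
    obtain J' C' where J': "C' \<in> Ch \<epsilon>" "Q = residue \<epsilon> J' C'" using Q(1) by (auto simp: simplices_def)
    let ?i = "\<delta> \<epsilon> (\<psi> v) D"
    have ic: "?i \<in> carrier W" using D(2) parabolic_closed by blast
    have inQ: "\<psi> (v \<otimes> i) \<in> Q" if "i \<in> parabolic I" for i using hit[OF that] Q(2) by (metis imageI subsetD)
    have "\<psi> v \<in> Q" using inQ[OF parabolic_one] v(2) by simp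
    then have Qv: "Q = residue \<epsilon> J' (\<psi> v)" using residue_eq[OF J'(1)] J'(2) by simp
    have "\<delta> \<epsilon> (\<psi> v) (\<psi> (v \<otimes> ?i)) \<in> parabolic J'" using inQ[OF D(2)] Qv by (auto simp: residue_def)
    moreover have "\<delta> \<epsilon> (\<psi> v) (\<psi> (v \<otimes> ?i)) = ?i"
      using isometry_dist[OF iso(1)] v(2) ic by simp
    ultimately show "D \<in> Q" using Qv D(1) by (simp add: residue_def)
  qed
  have P: "?P \<in> simplices \<epsilon> (Ch \<epsilon>)" using ch(1) by (auto simp: simplices_def)
  have im: "coproj_chamber \<epsilon> ?A ` ?B \<subseteq> ?P" using into by blast
  show ?thesis
    unfolding coproj_def sx sy sz
  proof (rule the_equality)
    show "?P \<in> simplices \<epsilon> (Ch \<epsilon>) \<and> coproj_chamber \<epsilon> ?A ` ?B \<subseteq> ?P \<and>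
      (\<forall>Q\<in>simplices \<epsilon> (Ch \<epsilon>). coproj_chamber \<epsilon> ?A ` ?B \<subseteq> Q \<longrightarrow> ?P \<subseteq> Q)"
      using P im least by blast
  next
    fix P assume "P \<in> simplices \<epsilon> (Ch \<epsilon>) \<and> coproj_chamber \<epsilon> ?A ` ?B \<subseteq> P \<and>
      (\<forall>Q\<in>simplices \<epsilon> (Ch \<epsilon>). coproj_chamber \<epsilon> ?A ` ?B \<subseteq> Q \<longrightarrow> P \<subseteq> Q)"
    then show "P = ?P" using \<open>?P \<in> simplices \<epsilon> (Ch \<epsilon>)\<close> im least by (intro subset_antisym) blast+
  qed
qed

lemma spherical_simplex_at:
  assumes iso: "isometry \<epsilon> \<psi>" and x: "x \<in> tits_cone"
  shows "spherical \<epsilon> (simplex_at \<epsilon> \<psi> x) \<longleftrightarrow> finite (zero_roots x)"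
proof -
  obtain v where v: "v \<in> chm x" "v \<in> carrier W" "0 \<le> dual_rep (inv v) x" using tits_cone_obtain[OF x] .
  let ?J = "zero_type (dual_rep (inv v) x)"
  have s: "simplex_at \<epsilon> \<psi> x = residue \<epsilon> ?J (\<psi> v)" using simplex_at_eq[OF iso v(1)] .
  have vC: "\<psi> v \<in> Ch \<epsilon>" using iso isometry_closed v(2) by blast
  have "zero_roots (dual_rep (inv v) x) = refl_rep (inv v) ` zero_roots x"
    using zero_roots_dual_rep v(2) by simp
  moreover have "inj_on (refl_rep (inv v)) (zero_roots x)"
    using v(2) by (intro inj_on_inverseI[where g = "refl_rep v"]) simp
  ultimately have fin: "finite (parabolic ?J) \<longleftrightarrow> finite (zero_roots x)"
    using finite_parabolic_iff[OF v(3)] by (simp add: finite_image_iff)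
  show ?thesis
  proof
    assume "spherical \<epsilon> (simplex_at \<epsilon> \<psi> x)"
    then obtain J C where J: "C \<in> Ch \<epsilon>" "simplex_at \<epsilon> \<psi> x = residue \<epsilon> J C" "finite (parabolic J)"
      unfolding spherical_def by blast
    then have "?J = J" using s residue_type[OF vC J(1)] by simp
    then show "finite (zero_roots x)" using fin J(3) by simp
  next
    assume "finite (zero_roots x)"
    then show "spherical \<epsilon> (simplex_at \<epsilon> \<psi> x)"
      unfolding spherical_def s using fin vC by blast
  qed
qed

end

section \<open>Twin apartments\<close>

context twin_apartment
begin

lemma Apt_subset: "Apt \<epsilon> \<subseteq> Ch \<epsilon>"
  using apartments[of \<epsilon>] by (simp add: apartment_def)

lemma op_props:
  assumes "C \<in> Apt \<epsilon>"
  shows op_in: "op \<epsilon> C \<in> Apt (flip \<epsilon>)" and op_opposite: "opposite \<epsilon> C (op \<epsilon> C)"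
  using theI'[OF opposite_unique[OF assms]] by (simp_all add: op_def)

lemma op_eqI:
  assumes "C \<in> Apt \<epsilon>" "D \<in> Apt (flip \<epsilon>)" "opposite \<epsilon> C D"
  shows "op \<epsilon> C = D"
  using opposite_unique[OF assms(1)] op_props[OF assms(1)] assms(2,3) by blast

text \<open>Let \<open>v\<close> be the codistance from \<open>C\<close> to \<open>D\<close>. A gallery from \<open>D\<close> of type \<open>v\<^sup>-\<^sup>1\<close> inside the
  apartment shortens the codistance in every step and ends opposite to \<open>C\<close>, hence at the unique
  opposite of \<open>C\<close>.\<close>

lemma cod_eq_dist_op:
  assumes C: "C \<in> Apt \<epsilon>" and D: "D \<in> Apt (flip \<epsilon>)"
  shows "cod \<epsilon> C D = \<delta> (flip \<epsilon>) (op \<epsilon> C) D"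
proof -
  obtain \<psi> where \<psi>: "isometry (flip \<epsilon>) \<psi>" "Apt (flip \<epsilon>) = \<psi> ` carrier W"
    using apartments[of "flip \<epsilon>"] by (auto simp: apartment_iff)
  obtain a where a: "a \<in> carrier W" "D = \<psi> a" using D \<psi>(2) by blast
  have CC: "C \<in> Ch \<epsilon>" and DC: "D \<in> Ch (flip \<epsilon>)" using C D Apt_subset by blast+
  define v where "v = cod \<epsilon> C D"
  have v: "v \<in> carrier W" using cod_closed CC DC by (simp add: v_def)
  define E where "E = \<psi> (a \<otimes> inv v)"
  have E: "E \<in> Apt (flip \<epsilon>)" using \<psi>(2) a v by (simp add: E_def)
  then have EC: "E \<in> Ch (flip \<epsilon>)" using Apt_subset by blast
  have ED: "\<delta> (flip \<epsilon>) E D = v"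
    using isometry_dist[OF \<psi>(1)] a v by (simp add: E_def inv_mult_group m_assoc)
  have DCv: "cod (flip \<epsilon>) D C = inv v" using cod_inv[OF CC DC] by (simp add: v_def)
  have "cod (flip \<epsilon>) E C = v \<otimes> inv v"
    using cod_descend[of D "flip \<epsilon>" E C] DC EC CC ED DCv v by simp
  then have "cod \<epsilon> C E = \<one>" using cod_flip[OF CC EC] v by simp
  then have "op \<epsilon> C = E" using op_eqI C E by (simp add: opposite_def)
  then show ?thesis using ED by (simp add: v_def)
qed

lemma op_op:
  assumes "C \<in> Apt \<epsilon>"
  shows "op (flip \<epsilon>) (op \<epsilon> C) = C"
proof (rule op_eqI)
  have o: "op \<epsilon> C \<in> Apt (flip \<epsilon>)" "cod \<epsilon> C (op \<epsilon> C) = \<one>"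
    using op_props[OF assms] by (simp_all add: opposite_def)
  then show "op \<epsilon> C \<in> Apt (flip \<epsilon>)" by simp
  show "C \<in> Apt (flip (flip \<epsilon>))" using assms by simp
  have "C \<in> Ch \<epsilon>" "op \<epsilon> C \<in> Ch (flip \<epsilon>)" using assms o(1) Apt_subset by blast+
  then show "opposite (flip \<epsilon>) (op \<epsilon> C) C" using cod_inv o(2) by (simp add: opposite_def)
qed

text \<open>Both distances are codistances from \<open>C\<close> to the opposite of \<open>D\<close>, read from either side.\<close>

lemma dist_op:
  assumes "C \<in> Apt \<epsilon>" "D \<in> Apt \<epsilon>"
  shows "\<delta> (flip \<epsilon>) (op \<epsilon> C) (op \<epsilon> D) = \<delta> \<epsilon> C D"
proof -
  have C: "C \<in> Ch \<epsilon>" "D \<in> Ch \<epsilon>" "op \<epsilon> D \<in> Ch (flip \<epsilon>)"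
    using assms op_in[OF assms(2)] Apt_subset by blast+
  have "cod (flip \<epsilon>) (op \<epsilon> D) C = \<delta> \<epsilon> D C"
    using cod_eq_dist_op[of "op \<epsilon> D" "flip \<epsilon>" C] op_in[OF assms(2)] op_op[OF assms(2)] assms(1) by simp
  then have "cod \<epsilon> C (op \<epsilon> D) = \<delta> \<epsilon> C D"
    using cod_flip[OF C(1,3)] dist_sym'[OF C(2,1)] by simp
  then show ?thesis using cod_eq_dist_op[OF assms(1) op_in[OF assms(2)]] by simp
qed

lemma ex_coordinates:
  assumes "C\<^sub>0 \<in> Apt Pos"
  obtains \<phi> where "\<phi> Pos \<one> = C\<^sub>0" "\<And>\<epsilon>. isometry \<epsilon> (\<phi> \<epsilon>)" "\<And>\<epsilon>. Apt \<epsilon> = \<phi> \<epsilon> ` carrier W"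
    "\<And>\<epsilon> w. w \<in> carrier W \<Longrightarrow> op \<epsilon> (\<phi> \<epsilon> w) = \<phi> (flip \<epsilon>) w"
proof -
  obtain \<psi> where \<psi>: "isometry Pos \<psi>" "Apt Pos = \<psi> ` carrier W"
    using apartments[of Pos] by (auto simp: apartment_iff)
  obtain a where a: "a \<in> carrier W" "C\<^sub>0 = \<psi> a" using assms \<psi>(2) by blast
  define f where "f w = \<psi> (a \<otimes> w)" for w
  have "f ` carrier W = \<psi> ` carrier W"
  proof
    show "\<psi> ` carrier W \<subseteq> f ` carrier W"
    proof
      fix D assume "D \<in> \<psi> ` carrier W"
      then obtain w where "w \<in> carrier W" "D = \<psi> w" by blast
      then have "D = f (inv a \<otimes> w)" "inv a \<otimes> w \<in> carrier W" using a by (simp_all add: f_def)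
      then show "D \<in> f ` carrier W" by blast
    qed
  qed (use a in \<open>auto simp: f_def\<close>)
  then have fA: "Apt Pos = f ` carrier W" using \<psi>(2) by simp
  have f_iso: "isometry Pos f"
    using \<psi>(1) a by (simp add: isometry_def f_def inv_mult_group m_assoc)
  define \<phi> where "\<phi> = (\<lambda>\<epsilon> w. case \<epsilon> of Pos \<Rightarrow> f w | Neg \<Rightarrow> op Pos (f w))"
  have f_in: "f w \<in> Apt Pos" if "w \<in> carrier W" for w using fA that by blast
  have g_in: "op Pos (f w) \<in> Apt Neg" if "w \<in> carrier W" for w using op_in[OF f_in[OF that]] by simp
  have "isometry Neg (\<lambda>w. op Pos (f w))"
    unfolding isometry_def
  proof (intro conjI ballI)
    fix u v assume uv: "u \<in> carrier W" "v \<in> carrier W"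
    show "op Pos (f u) \<in> Ch Neg" using g_in[OF uv(1)] Apt_subset by blast
    show "\<delta> Neg (op Pos (f u)) (op Pos (f v)) = inv u \<otimes> v"
      using dist_op[OF f_in[OF uv(1)] f_in[OF uv(2)]] isometry_dist[OF f_iso uv] by simp
  qed
  then have iso: "isometry \<epsilon> (\<phi> \<epsilon>)" for \<epsilon> using f_iso by (cases \<epsilon>) (simp_all add: \<phi>_def)
  have "Apt Neg = (\<lambda>w. op Pos (f w)) ` carrier W"
  proof
    show "Apt Neg \<subseteq> (\<lambda>w. op Pos (f w)) ` carrier W"
    proof
      fix D assume D: "D \<in> Apt Neg"
      then have "op Neg D \<in> Apt Pos" using op_in[of D Neg] by simp
      then obtain w where w: "w \<in> carrier W" "op Neg D = f w" using fA by blast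
      have "op Pos (op Neg D) = D" using op_op[OF D] by simp
      then show "D \<in> (\<lambda>w. op Pos (f w)) ` carrier W" using w by force
    qed
  qed (use g_in in blast)
  then have "Apt \<epsilon> = \<phi> \<epsilon> ` carrier W" for \<epsilon> using fA by (cases \<epsilon>) (simp_all add: \<phi>_def)
  moreover have "op \<epsilon> (\<phi> \<epsilon> w) = \<phi> (flip \<epsilon>) w" if "w \<in> carrier W" for \<epsilon> w
    using op_op[OF f_in[OF that]] by (cases \<epsilon>) (simp_all add: \<phi>_def)
  moreover have "\<phi> Pos \<one> = C\<^sub>0" using a by (simp add: \<phi>_def f_def)
  ultimately show ?thesis using that iso by blast
qed

end

text \<open>A twin apartment with compatible coordinates: \<open>\<phi> \<epsilon>\<close> identifies \<open>W\<close> with the apartment of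
  sign \<open>\<epsilon>\<close>, and opposite chambers have the same coordinate.\<close>

locale coordinatized_twin_apartment = twin_apartment W gen Ch \<delta> cod Apt
  for W :: "('w, 'b) monoid_scheme" (structure) and gen :: "'s::finite \<Rightarrow> 'w"
    and Ch :: "sign \<Rightarrow> 'c set" and \<delta> :: "sign \<Rightarrow> 'c \<Rightarrow> 'c \<Rightarrow> 'w" and cod :: "sign \<Rightarrow> 'c \<Rightarrow> 'c \<Rightarrow> 'w"
    and Apt :: "sign \<Rightarrow> 'c set" +
  fixes \<phi> :: "sign \<Rightarrow> 'w \<Rightarrow> 'c"
  assumes iso: "isometry \<epsilon> (\<phi> \<epsilon>)"
    and Apt_eq: "Apt \<epsilon> = \<phi> \<epsilon> ` carrier W"
    and op_coord: "w \<in> carrier W \<Longrightarrow> op \<epsilon> (\<phi> \<epsilon> w) = \<phi> (flip \<epsilon>) w"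
begin

abbreviation smp :: "sign \<Rightarrow> real ^ 's \<Rightarrow> 'c set" where
  "smp \<epsilon> \<equiv> simplex_at \<epsilon> (\<phi> \<epsilon>)"

text \<open>The points of the cells of the simplices in \<open>K \<epsilon>\<close>, the negative ones reflected into the
  Tits cone.\<close>

definition points :: "(sign \<Rightarrow> 'c set set) \<Rightarrow> sign \<Rightarrow> (real ^ 's) set" where
  "points K \<epsilon> = {x \<in> tits_cone. smp \<epsilon> x \<in> K \<epsilon>}"

lemma simplices_Apt: "simplices \<epsilon> (Apt \<epsilon>) = smp \<epsilon> ` tits_cone"
  unfolding Apt_eq by (rule simplices_eq_simplex_at[OF iso])

lemma cod_coord:
  assumes "u \<in> carrier W" "v \<in> carrier W"
  shows "cod \<epsilon> (\<phi> \<epsilon> u) (\<phi> (flip \<epsilon>) v) = inv u \<otimes> v"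
proof -
  have "\<phi> \<epsilon> u \<in> Apt \<epsilon>" "\<phi> (flip \<epsilon>) v \<in> Apt (flip \<epsilon>)" using assms by (simp_all add: Apt_eq)
  then have "cod \<epsilon> (\<phi> \<epsilon> u) (\<phi> (flip \<epsilon>) v) = \<delta> (flip \<epsilon>) (\<phi> (flip \<epsilon>) u) (\<phi> (flip \<epsilon>) v)"
    using cod_eq_dist_op op_coord[OF assms(1)] by simp
  then show ?thesis using isometry_dist[OF iso assms] by simp
qed

lemma proj_smp:
  assumes "x \<in> tits_cone" "y \<in> tits_cone" "z \<in> tits_cone" "sign_comp x y z"
  shows "proj \<epsilon> (smp \<epsilon> x) (smp \<epsilon> y) = smp \<epsilon> z"
  using proj_simplex_at[OF iso assms] .

lemma coproj_smp:
  assumes "x \<in> tits_cone" "y \<in> tits_cone" "z \<in> tits_cone" "sign_comp x (- y) z" "finite (zero_roots x)"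
  shows "coproj \<epsilon> (smp \<epsilon> x) (smp (flip \<epsilon>) y) = smp \<epsilon> z"
  using coproj_simplex_at[OF iso iso cod_coord assms] .

lemma spherical_smp: "x \<in> tits_cone \<Longrightarrow> spherical \<epsilon> (smp \<epsilon> x) \<longleftrightarrow> finite (zero_roots x)"
  using spherical_simplex_at[OF iso] .

lemma smp_in_half: "x \<in> tits_cone \<Longrightarrow> \<beta> \<in> roots \<Longrightarrow>
    smp \<epsilon> x \<in> simplices \<epsilon> (\<phi> \<epsilon> ` half \<beta>) \<longleftrightarrow> 0 \<le> \<beta> \<bullet> x"
  using simplex_at_in_half[OF iso] .

lemma smp_eq_iff:
  assumes "x \<in> tits_cone" "y \<in> tits_cone"
  shows "smp \<epsilon> x = smp \<epsilon> y \<longleftrightarrow> chm x = chm y"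
proof
  assume "smp \<epsilon> x = smp \<epsilon> y"
  then have "\<phi> \<epsilon> ` chm x = \<phi> \<epsilon> ` chm y"
    using simplex_at_inter[OF iso assms(1), of \<epsilon>] simplex_at_inter[OF iso assms(2), of \<epsilon>] by simp
  then show "chm x = chm y"
    using inj_on_image_eq_iff[OF isometry_inj[OF iso], of "chm x" "chm y"] chm_closed by blast
qed (use simplex_at_chm_eqI[OF iso assms(1)] in blast)

subsection \<open>Translation of the three conditions\<close>

lemma closed_points:
  assumes "\<And>\<epsilon>. subcomplex \<epsilon> (K \<epsilon>)" "\<And>\<epsilon>. \<exists>A\<in>K \<epsilon>. spherical \<epsilon> A"
  shows "closed_twin_family (points K)"
  unfolding closed_twin_family_def
proof (intro allI conjI ballI impI)
  fix \<epsilon>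
  show "points K \<epsilon> \<subseteq> tits_cone" by (auto simp: points_def)
  show "\<exists>x\<in>points K \<epsilon>. finite (zero_roots x)"
  proof -
    obtain A where A: "A \<in> K \<epsilon>" "spherical \<epsilon> A" using assms(2) by blast
    then have "A \<in> smp \<epsilon> ` tits_cone" using assms(1) simplices_Apt by (auto simp: subcomplex_def)
    then obtain x where "x \<in> tits_cone" "A = smp \<epsilon> x" by blast
    then show ?thesis using A spherical_smp by (auto simp: points_def)
  qed
  fix x y assume xy: "x \<in> tits_cone" "y \<in> points K \<epsilon>" "sign_face x y"
  then have "smp \<epsilon> y \<subseteq> smp \<epsilon> x" using simplex_at_mono[OF iso] by (auto simp: points_def)
  moreover have "smp \<epsilon> x \<in> simplices \<epsilon> (Apt \<epsilon>)" using xy(1) simplices_Apt by blast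
  ultimately show "x \<in> points K \<epsilon>"
    using assms(1)[of \<epsilon>] xy by (auto simp: subcomplex_def points_def)
qed

lemma projection_closed_iff:
  assumes sub: "\<And>\<epsilon>. subcomplex \<epsilon> (K \<epsilon>)"
  shows "projection_closed K \<longleftrightarrow> comp_closed (points K)"
proof
  assume P: "projection_closed K"
  show "comp_closed (points K)"
    unfolding comp_closed_def
  proof (intro conjI allI ballI impI)
    fix \<epsilon> x y z assume a: "x \<in> points K \<epsilon>" "y \<in> points K \<epsilon>" "z \<in> tits_cone" "sign_comp x y z"
    then have "proj \<epsilon> (smp \<epsilon> x) (smp \<epsilon> y) = smp \<epsilon> z" by (intro proj_smp) (auto simp: points_def)
    moreover have "proj \<epsilon> (smp \<epsilon> x) (smp \<epsilon> y) \<in> K \<epsilon>"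
      using P a by (auto simp: projection_closed_def points_def)
    ultimately show "z \<in> points K \<epsilon>" using a(3) by (simp add: points_def)
  next
    fix \<epsilon> x y z assume a: "x \<in> points K \<epsilon>" "y \<in> points K (flip \<epsilon>)" "z \<in> tits_cone"
      "finite (zero_roots x)" "sign_comp x (- y) z"
    then have "coproj \<epsilon> (smp \<epsilon> x) (smp (flip \<epsilon>) y) = smp \<epsilon> z"
      by (intro coproj_smp) (auto simp: points_def)
    moreover have "spherical \<epsilon> (smp \<epsilon> x)" using a spherical_smp by (simp add: points_def)
    then have "coproj \<epsilon> (smp \<epsilon> x) (smp (flip \<epsilon>) y) \<in> K \<epsilon>"
      using P a(1,2) unfolding projection_closed_def points_def by blast
    ultimately show "z \<in> points K \<epsilon>" using a(3) by (simp add: points_def)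
  qed
next
  assume C: "comp_closed (points K)"
  have obt: "\<exists>x\<in>points K \<epsilon>. A = smp \<epsilon> x" if "A \<in> K \<epsilon>" for A \<epsilon>
    using that sub[of \<epsilon>] unfolding subcomplex_def simplices_Apt points_def by blast
  show "projection_closed K"
    unfolding projection_closed_def
  proof (intro conjI allI ballI impI)
    fix \<epsilon> A B assume "A \<in> K \<epsilon>" "B \<in> K \<epsilon>"
    then obtain x y where xy: "x \<in> points K \<epsilon>" "A = smp \<epsilon> x" "y \<in> points K \<epsilon>" "B = smp \<epsilon> y"
      using obt by meson
    have cone: "x \<in> tits_cone" "y \<in> tits_cone" using xy by (auto simp: points_def)
    then obtain z where z: "z \<in> tits_cone" "sign_comp x y z" by (rule sign_comp_in_tits_cone)
    then have "z \<in> points K \<epsilon>" using C xy unfolding comp_closed_def by blast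
    then show "proj \<epsilon> A B \<in> K \<epsilon>" using proj_smp[OF cone z] xy by (simp add: points_def)
  next
    fix \<epsilon> A B assume "A \<in> K \<epsilon>" "B \<in> K (flip \<epsilon>)" "spherical \<epsilon> A"
    then obtain x y where xy: "x \<in> points K \<epsilon>" "A = smp \<epsilon> x" "y \<in> points K (flip \<epsilon>)" "B = smp (flip \<epsilon>) y"
      using obt by meson
    have cone: "x \<in> tits_cone" "y \<in> tits_cone" using xy by (auto simp: points_def)
    have fin: "finite (zero_roots x)" using spherical_smp[OF cone(1)] xy(2) \<open>spherical \<epsilon> A\<close> by simp
    obtain z where z: "z \<in> tits_cone" "sign_comp x (- y) z"
      using cone(1) fin by (rule sign_comp_spherical)
    then have "z \<in> points K \<epsilon>" using C xy fin unfolding comp_closed_def by blast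
    then show "coproj \<epsilon> A B \<in> K \<epsilon>" using coproj_smp[OF cone z fin] xy by (simp add: points_def)
  qed
qed

text \<open>The negative part of a twin root is opposite to the complement of its positive part, so in
  coordinates the two parts are the half-spaces of \<open>\<beta>\<close> and \<open>- \<beta>\<close>.\<close>

lemma twin_root_iff: "twin_root \<alpha> \<longleftrightarrow> (\<exists>\<beta>\<in>roots. \<forall>\<epsilon>. \<alpha> \<epsilon> = \<phi> \<epsilon> ` half (sg \<epsilon> *\<^sub>R \<beta>))"
proof -
  have op_half: "op Pos ` (Apt Pos - \<phi> Pos ` half \<beta>) = \<phi> Neg ` half (- \<beta>)" if b: "\<beta> \<in> roots" for \<beta>
  proof -
    have "op Pos ` \<phi> Pos ` half (- \<beta>) = \<phi> Neg ` half (- \<beta>)"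
      unfolding image_image using op_coord[of _ Pos] half_subset by (intro image_cong) auto
    then show ?thesis using image_half_uminus[OF iso b, of Pos] by (simp add: Apt_eq)
  qed
  show ?thesis
  proof
    assume t: "twin_root \<alpha>"
    then have "root Pos (Apt Pos) (\<alpha> Pos)" by (simp add: twin_root_def)
    then obtain \<beta> where b: "\<beta> \<in> roots" "\<alpha> Pos = \<phi> Pos ` half \<beta>"
      unfolding Apt_eq using root_iff_half[OF iso] by blast
    have "\<alpha> Neg = \<phi> Neg ` half (- \<beta>)" using t b op_half by (simp add: twin_root_def)
    then have "\<alpha> \<epsilon> = \<phi> \<epsilon> ` half (sg \<epsilon> *\<^sub>R \<beta>)" for \<epsilon> using b(2) by (cases \<epsilon>) simp_all
    then show "\<exists>\<beta>\<in>roots. \<forall>\<epsilon>. \<alpha> \<epsilon> = \<phi> \<epsilon> ` half (sg \<epsilon> *\<^sub>R \<beta>)" using b(1) by blast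
  next
    assume "\<exists>\<beta>\<in>roots. \<forall>\<epsilon>. \<alpha> \<epsilon> = \<phi> \<epsilon> ` half (sg \<epsilon> *\<^sub>R \<beta>)"
    then obtain \<beta> where b: "\<beta> \<in> roots" "\<And>\<epsilon>. \<alpha> \<epsilon> = \<phi> \<epsilon> ` half (sg \<epsilon> *\<^sub>R \<beta>)" by blast
    have "sg \<epsilon> *\<^sub>R \<beta> \<in> roots" for \<epsilon> using b(1) by (cases \<epsilon>) simp_all
    then have "root \<epsilon> (Apt \<epsilon>) (\<alpha> \<epsilon>)" for \<epsilon>
      unfolding Apt_eq root_iff_half[OF iso] using b(2) by blast
    moreover have "\<alpha> Neg = op Pos ` (Apt Pos - \<alpha> Pos)" using op_half[OF b(1)] by (simp add: b(2))
    ultimately show "twin_root \<alpha>" by (simp add: twin_root_def)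
  qed
qed

lemma intersection_iff:
  assumes sub: "\<And>\<epsilon>. subcomplex \<epsilon> (K \<epsilon>)"
  shows "intersection_of_twin_roots K \<longleftrightarrow> cut_out (points K)"
proof -
  have in_root: "smp \<epsilon> x \<in> simplices \<epsilon> (\<phi> \<epsilon> ` half (sg \<epsilon> *\<^sub>R \<beta>)) \<longleftrightarrow> 0 \<le> sg \<epsilon> * (\<beta> \<bullet> x)"
    if "\<beta> \<in> roots" "x \<in> tits_cone" for \<epsilon> \<beta> x
    using smp_in_half[of x "sg \<epsilon> *\<^sub>R \<beta>" \<epsilon>] that by (cases \<epsilon>) simp_all
  show ?thesis
  proof
    assume "intersection_of_twin_roots K"
    then obtain R where R: "\<And>\<alpha>. \<alpha> \<in> R \<Longrightarrow> twin_root \<alpha>"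
      "\<And>\<epsilon>. K \<epsilon> = simplices \<epsilon> (Apt \<epsilon>) \<inter> (\<Inter>\<alpha>\<in>R. simplices \<epsilon> (\<alpha> \<epsilon>))"
      unfolding intersection_of_twin_roots_def by blast
    define B where "B = {\<beta> \<in> roots. \<exists>\<alpha>\<in>R. \<forall>\<epsilon>. \<alpha> \<epsilon> = \<phi> \<epsilon> ` half (sg \<epsilon> *\<^sub>R \<beta>)}"
    have "points K \<epsilon> = {x \<in> tits_cone. \<forall>\<beta>\<in>B. 0 \<le> sg \<epsilon> * (\<beta> \<bullet> x)}" for \<epsilon>
    proof -
      have "smp \<epsilon> x \<in> K \<epsilon> \<longleftrightarrow> (\<forall>\<beta>\<in>B. 0 \<le> sg \<epsilon> * (\<beta> \<bullet> x))" if x: "x \<in> tits_cone" for x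
      proof -
        have "smp \<epsilon> x \<in> K \<epsilon> \<longleftrightarrow> (\<forall>\<alpha>\<in>R. smp \<epsilon> x \<in> simplices \<epsilon> (\<alpha> \<epsilon>))"
          unfolding R(2)[of \<epsilon>] simplices_Apt using x by blast
        also have "\<dots> \<longleftrightarrow> (\<forall>\<beta>\<in>B. 0 \<le> sg \<epsilon> * (\<beta> \<bullet> x))"
        proof
          assume a: "\<forall>\<alpha>\<in>R. smp \<epsilon> x \<in> simplices \<epsilon> (\<alpha> \<epsilon>)"
          show "\<forall>\<beta>\<in>B. 0 \<le> sg \<epsilon> * (\<beta> \<bullet> x)"
          proof
            fix \<beta> assume "\<beta> \<in> B"
            then obtain \<alpha> where "\<beta> \<in> roots" "\<alpha> \<in> R" "\<alpha> \<epsilon> = \<phi> \<epsilon> ` half (sg \<epsilon> *\<^sub>R \<beta>)"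
              by (auto simp: B_def)
            then show "0 \<le> sg \<epsilon> * (\<beta> \<bullet> x)" using in_root x a by metis
          qed
        next
          assume a: "\<forall>\<beta>\<in>B. 0 \<le> sg \<epsilon> * (\<beta> \<bullet> x)"
          show "\<forall>\<alpha>\<in>R. smp \<epsilon> x \<in> simplices \<epsilon> (\<alpha> \<epsilon>)"
          proof
            fix \<alpha> assume al: "\<alpha> \<in> R"
            then obtain \<beta> where b: "\<beta> \<in> roots" "\<forall>\<epsilon>. \<alpha> \<epsilon> = \<phi> \<epsilon> ` half (sg \<epsilon> *\<^sub>R \<beta>)"
              using R(1) twin_root_iff by blast
            then have "\<beta> \<in> B" using al by (auto simp: B_def)
            then show "smp \<epsilon> x \<in> simplices \<epsilon> (\<alpha> \<epsilon>)" using in_root[OF b(1) x] a b(2) by simp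
          qed
        qed
        finally show ?thesis .
      qed
      then show ?thesis by (auto simp: points_def)
    qed
    moreover have "B \<subseteq> roots" by (auto simp: B_def)
    ultimately show "cut_out (points K)" unfolding cut_out_def by blast
  next
    assume "cut_out (points K)"
    then obtain B where B: "B \<subseteq> roots"
      "\<And>\<epsilon>. points K \<epsilon> = {x \<in> tits_cone. \<forall>\<beta>\<in>B. 0 \<le> sg \<epsilon> * (\<beta> \<bullet> x)}"
      unfolding cut_out_def by blast
    define a where "a \<beta> = (\<lambda>\<epsilon>. \<phi> \<epsilon> ` half (sg \<epsilon> *\<^sub>R \<beta>))" for \<beta>
    have "K \<epsilon> = simplices \<epsilon> (Apt \<epsilon>) \<inter> (\<Inter>\<alpha>\<in>a ` B. simplices \<epsilon> (\<alpha> \<epsilon>))" for \<epsilon>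
    proof -
      have "smp \<epsilon> x \<in> K \<epsilon> \<longleftrightarrow> smp \<epsilon> x \<in> (\<Inter>\<alpha>\<in>a ` B. simplices \<epsilon> (\<alpha> \<epsilon>))" if x: "x \<in> tits_cone" for x
      proof -
        have "smp \<epsilon> x \<in> K \<epsilon> \<longleftrightarrow> x \<in> points K \<epsilon>" using x by (simp add: points_def)
        also have "\<dots> \<longleftrightarrow> (\<forall>\<beta>\<in>B. 0 \<le> sg \<epsilon> * (\<beta> \<bullet> x))" using x by (simp add: B(2))
        also have "\<dots> \<longleftrightarrow> (\<forall>\<beta>\<in>B. smp \<epsilon> x \<in> simplices \<epsilon> (a \<beta> \<epsilon>))"
          using in_root[OF _ x] B(1) by (auto simp: a_def)
        finally show ?thesis by simp
      qed
      moreover have "K \<epsilon> \<subseteq> simplices \<epsilon> (Apt \<epsilon>)" using sub by (simp add: subcomplex_def)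
      ultimately show ?thesis unfolding simplices_Apt by blast
    qed
    moreover have "twin_root \<alpha>" if "\<alpha> \<in> a ` B" for \<alpha>
      using that B(1) unfolding twin_root_iff a_def by blast
    ultimately show "intersection_of_twin_roots K"
      unfolding intersection_of_twin_roots_def by blast
  qed
qed

lemma cell_pos_eq:
  assumes "\<phi> Pos \<one> = C\<^sub>0"
  shows "cell_pos C\<^sub>0 A = {y \<in> tits_cone. smp Pos y = A}"
proof (intro Set.set_eqI iffI)
  have d: "\<delta> Pos C\<^sub>0 (\<phi> Pos w) = w" if "w \<in> carrier W" for w
    using isometry_dist[OF iso, of \<one> w Pos] that assms by simp
  {
    fix y assume "y \<in> cell_pos C\<^sub>0 A"
    then obtain J C where C: "C \<in> Apt Pos" "A = residue Pos J C"
      "y \<in> dual_rep (\<delta> Pos C\<^sub>0 C) ` fund_face J" unfolding cell_pos_def by blast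
    then obtain w where w: "w \<in> carrier W" "C = \<phi> Pos w" using Apt_eq by blast
    then obtain c where c: "0 \<le> c" "zero_type c = J" "y = dual_rep w c"
      using C(3) d by (auto simp: fund_face_eq)
    have wy: "w \<in> chm y" using w c by (simp add: chm_def)
    then have "smp Pos y = A" using simplex_at_eq[OF iso wy] w c C(2) by simp
    moreover have "y \<in> tits_cone" using c w dual_rep_in_tits_cone by simp
    ultimately show "y \<in> {y \<in> tits_cone. smp Pos y = A}" by simp
  next
    fix y assume "y \<in> {y \<in> tits_cone. smp Pos y = A}"
    then have y: "y \<in> tits_cone" "smp Pos y = A" by auto
    obtain w where w: "w \<in> chm y" "w \<in> carrier W" "0 \<le> dual_rep (inv w) y"
      using tits_cone_obtain[OF y(1)] .
    let ?J = "zero_type (dual_rep (inv w) y)"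
    have "A = residue Pos ?J (\<phi> Pos w)" using simplex_at_eq[OF iso w(1)] y(2) by simp
    moreover have "\<phi> Pos w \<in> Apt Pos" using w(2) by (simp add: Apt_eq)
    moreover have "y \<in> dual_rep (\<delta> Pos C\<^sub>0 (\<phi> Pos w)) ` fund_face ?J"
    proof (rule image_eqI)
      show "y = dual_rep (\<delta> Pos C\<^sub>0 (\<phi> Pos w)) (dual_rep (inv w) y)" using d[OF w(2)] w(2) by simp
      show "dual_rep (inv w) y \<in> fund_face ?J" using w(3) by (simp add: fund_face_eq)
    qed
    ultimately show "y \<in> cell_pos C\<^sub>0 A" unfolding cell_pos_def by blast
  }
qed

text \<open>A simplex of an apartment is determined by its chambers in the apartment, and opposition
  preserves their coordinates.\<close>

lemma op_simplex_smp:
  assumes x: "x \<in> tits_cone"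
  shows "op_simplex Neg (smp Neg x) = smp Pos x"
proof -
  have inter: "smp \<epsilon> y \<inter> Apt \<epsilon> = \<phi> \<epsilon> ` chm y" if "y \<in> tits_cone" for \<epsilon> y
    using simplex_at_inter[OF iso that] by (simp add: Apt_eq)
  have opc: "op Neg ` (smp Neg x \<inter> Apt Neg) = \<phi> Pos ` chm x"
    unfolding inter[OF x] image_image using op_coord[of _ Neg] chm_closed by (intro image_cong) auto
  show ?thesis
    unfolding op_simplex_def opc flip.simps
  proof (rule the_equality)
    show "smp Pos x \<in> simplices Pos (Apt Pos) \<and> smp Pos x \<inter> Apt Pos = \<phi> Pos ` chm x"
      using x inter[OF x] simplices_Apt by blast
  next
    fix B assume B: "B \<in> simplices Pos (Apt Pos) \<and> B \<inter> Apt Pos = \<phi> Pos ` chm x"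
    then obtain y where y: "y \<in> tits_cone" "B = smp Pos y" unfolding simplices_Apt by blast
    then have "\<phi> Pos ` chm y = \<phi> Pos ` chm x" using B inter[OF y(1), of Pos] by simp
    then have "chm y = chm x"
      using inj_on_image_eq_iff[OF isometry_inj[OF iso], of "chm y" "chm x"] chm_closed by blast
    then show "B = smp Pos x" using y smp_eq_iff[OF y(1) x] by simp
  qed
qed

lemma realization_eq:
  assumes sub: "\<And>\<epsilon>. subcomplex \<epsilon> (K \<epsilon>)" and C0: "\<phi> Pos \<one> = C\<^sub>0"
  shows "realization C\<^sub>0 K = realized (points K)"
proof -
  have "(\<Union>A\<in>K \<epsilon>. cell C\<^sub>0 \<epsilon> A) = (\<lambda>x. sg \<epsilon> *\<^sub>R x) ` points K \<epsilon>" for \<epsilon>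
  proof (cases \<epsilon>)
    case Pos
    then show ?thesis by (auto simp: cell_pos_eq[OF C0] points_def)
  next
    case Neg
    have "(\<Union>A\<in>K Neg. cell_pos C\<^sub>0 (op_simplex Neg A)) = points K Neg"
    proof (intro Set.set_eqI iffI)
      fix y assume "y \<in> (\<Union>A\<in>K Neg. cell_pos C\<^sub>0 (op_simplex Neg A))"
      then obtain A where A: "A \<in> K Neg" "y \<in> cell_pos C\<^sub>0 (op_simplex Neg A)" by blast
      then obtain x where x: "x \<in> tits_cone" "A = smp Neg x"
        using sub[of Neg] unfolding subcomplex_def simplices_Apt by blast
      have y: "y \<in> tits_cone" "smp Pos y = smp Pos x"
        using A(2) x op_simplex_smp by (simp_all add: cell_pos_eq[OF C0])
      then have "smp Neg y = smp Neg x" using smp_eq_iff x(1) by simp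
      then show "y \<in> points K Neg" using A(1) x(2) y(1) by (simp add: points_def)
    next
      fix y assume "y \<in> points K Neg"
      then have y: "y \<in> tits_cone" "smp Neg y \<in> K Neg" by (auto simp: points_def)
      then have "y \<in> cell_pos C\<^sub>0 (op_simplex Neg (smp Neg y))"
        using op_simplex_smp by (simp add: cell_pos_eq[OF C0])
      then show "y \<in> (\<Union>A\<in>K Neg. cell_pos C\<^sub>0 (op_simplex Neg A))" using y(2) by blast
    qed
    then have "uminus ` (\<Union>A\<in>K Neg. cell_pos C\<^sub>0 (op_simplex Neg A)) = uminus ` points K Neg" by simp
    then show ?thesis using Neg by (simp add: image_UN)
  qed
  then show ?thesis unfolding realization_def realized_def by auto
qed

end

theorem theorem14:
  fixes W :: "('w, 'b) monoid_scheme" (structure)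
    and gen :: "'s::finite \<Rightarrow> 'w"
    and Ch :: "sign \<Rightarrow> 'c set"
    and \<delta> :: "sign \<Rightarrow> 'c \<Rightarrow> 'c \<Rightarrow> 'w"
    and cod :: "sign \<Rightarrow> 'c \<Rightarrow> 'c \<Rightarrow> 'w"
    and Apt :: "sign \<Rightarrow> 'c set"
    and C\<^sub>0 :: 'c
    and K :: "sign \<Rightarrow> 'c set set"
  assumes "twin_apartment W gen Ch \<delta> cod Apt"
    and "infinite (carrier W)"
    and "coxeter_system.irreducible W gen"
    and "C\<^sub>0 \<in> Apt Pos"
    and "\<And>\<epsilon>. K \<epsilon> \<noteq> {} \<and> twin_apartment.subcomplex W gen Ch \<delta> Apt \<epsilon> (K \<epsilon>)"
    and "\<And>\<epsilon>. \<exists>A\<in>K \<epsilon>. twin_building.spherical W gen Ch \<delta> \<epsilon> A"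
  shows "(twin_building.projection_closed W gen Ch \<delta> cod K \<longleftrightarrow>
      twin_apartment.intersection_of_twin_roots W gen Ch \<delta> cod Apt K) \<and>
    (twin_apartment.intersection_of_twin_roots W gen Ch \<delta> cod Apt K \<longleftrightarrow>
      twin_apartment.convex_in_cone W gen (twin_apartment.realization W gen Ch \<delta> cod Apt C\<^sub>0 K))"
proof -
  interpret twin_apartment W gen Ch \<delta> cod Apt by (rule assms(1))
  obtain \<phi> where \<phi>: "\<phi> Pos \<one> = C\<^sub>0" "\<And>\<epsilon>. isometry \<epsilon> (\<phi> \<epsilon>)" "\<And>\<epsilon>. Apt \<epsilon> = \<phi> \<epsilon> ` carrier W"
    "\<And>\<epsilon> w. w \<in> carrier W \<Longrightarrow> op \<epsilon> (\<phi> \<epsilon> w) = \<phi> (flip \<epsilon>) w"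
    using ex_coordinates[OF assms(4)] by metis
  interpret coordinatized_twin_apartment W gen Ch \<delta> cod Apt \<phi>
    by unfold_locales (use \<phi> in auto)
  have sub: "subcomplex \<epsilon> (K \<epsilon>)" for \<epsilon> using assms(5) by blast
  have closed: "closed_twin_family (points K)" using closed_points[OF sub] assms(6) by blast
  have "convex_in_cone (realization C\<^sub>0 K) \<longleftrightarrow> twin_convex (points K)"
    unfolding realization_eq[OF sub \<phi>(1)] convex_in_cone_def twin_convex_def ..
  then show ?thesis
    using convexity_equivalence[OF assms(2,3) closed] projection_closed_iff[OF sub] intersection_iff[OF sub]
    by simp
qed

end
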